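(* Let $X\subset\mathbb R^2$ be a compact subset of positive Lebesgue measure and let $r\ge2$ be a natural number. Then $$ms(X,r)=\begin{cases}\frac1{r^2},&\text{if the group }\operatorname{Iso}(X)\text{ is infinite};\\ ms(\mathcal D_{2n}\times I,r),&\text{if }\operatorname{Iso}(X)\text{ is isomorphic to the dihedral group }\mathcal D_{2n}\text{ for some }n\ge2;\\ 0,&\text{otherwise.}\end{cases}$$
   Context: $\operatorname{Iso}(X)$ is the group of all isometries $f$ of $\mathbb R^2$ with $f(X)=X$. $X$ is endowed with the normalized Lebesgue measure $\mu(A)=\lambda(A)/\lambda(X)$ (an $\operatorname{Iso}(X)$-invariant probability Borel measure). $ms(X,r)$ is the least upper bound of $\varepsilon>0$ such that for every measurable $r$-coloring of $X$ (partition into $r$ measurable color classes) there is a measurable monochromatic subset $A\subset X$ with $\mu(A)\ge\varepsilon$ and $f(A)=A$ for some non-identity $f\in\operatorname{Iso}(X)$. $\mathcal D_{2n}$ is the dihedral group of order $2n$ (the isometry group of a regular $n$-gon; for $n=2$ it is the Klein group $\mathbb Z_2\times\mathbb Z_2$). For a finite group $G$, $G\times I$ (with $I=[0,1]$) is the $G$-space with action $g\cdot(h,t)=(gh,t)$ and product measure of the normalized counting measure on $G$ and Lebesgue measure on $I$; $ms(G\times I,r)$ is the least upper bound of $\varepsilon>0$ such that for every measurable $r$-coloring of $G\times I$ there is a measurable monochromatic subset $A$ of measure $\ge\varepsilon$ with $A=g\cdot A$ for some non-identity $g\in G$. *)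

theory Defs
  imports "HOL-Probability.Probability" "HOL-Algebra.Coset"
begin

text \<open>
  The summand \<open>{0}\<close> fixes the least upper bound to be \<open>0\<close> when no \<open>\<epsilon> > 0\<close> qualifies; the supremum
  of the empty set of reals is not meaningful in HOL. A colouring is a measurable map to the discrete
  space of \<open>r\<close> colours; colour classes may be empty.
\<close>

definition ms :: "'x measure \<Rightarrow> ('g, 'm) monoid_scheme \<Rightarrow> ('g \<Rightarrow> 'x \<Rightarrow> 'x) \<Rightarrow> nat \<Rightarrow> real" where
  "ms M G act r = Sup ({0} \<union> {\<epsilon>. \<epsilon> > 0 \<and>
     (\<forall>col \<in> measurable M (count_space {..<r}).
        \<exists>A \<in> sets M. (\<exists>c<r. \<forall>x\<in>A. col x = c) \<and> measure M A \<ge> \<epsilon> \<and>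
          (\<exists>g \<in> carrier G. g \<noteq> \<one>\<^bsub>G\<^esub> \<and> act g ` A = A))})"

definition Iso :: "'a::metric_space set \<Rightarrow> ('a \<Rightarrow> 'a) monoid" where
  "Iso X = \<lparr>carrier = {f. bij f \<and> (\<forall>x y. dist (f x) (f y) = dist x y) \<and> f ` X = X},
            mult = (\<circ>), one = id\<rparr>"

text \<open>Measurable subsets of \<open>X\<close> are the Borel ones, as \<open>\<mu>\<close> is a Borel measure.\<close>

definition normalized_lebesgue :: "'a::euclidean_space set \<Rightarrow> 'a measure" where
  "normalized_lebesgue X = restrict_space (uniform_measure lborel X) X"

definition ms_set :: "'a::euclidean_space set \<Rightarrow> nat \<Rightarrow> real" where
  "ms_set X r = ms (normalized_lebesgue X) (Iso X) (\<lambda>f x. f x) r"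

definition ms_group_interval :: "('g, 'm) monoid_scheme \<Rightarrow> nat \<Rightarrow> real" where
  "ms_group_interval G r =
     ms (uniform_count_measure (carrier G) \<Otimes>\<^sub>M restrict_space lborel {0..1::real}) G
        (\<lambda>g (h, t). (g \<otimes>\<^bsub>G\<^esub> h, t)) r"

text \<open>
  The dihedral group of order \<open>2n\<close>, for \<open>n \<ge> 1\<close>: the pair \<open>(i, s)\<close> stands for \<open>\<rho>\<^sup>i\<sigma>\<^sup>s\<close>, where
  \<open>\<rho>\<close> is the rotation by \<open>2\<pi>/n\<close> and \<open>\<sigma>\<close> a reflection, so that \<open>\<sigma>\<rho>\<^sup>j = \<rho>\<^sup>-\<^sup>j\<sigma>\<close>.
\<close>

definition dihedral_group :: "nat \<Rightarrow> (int \<times> bool) monoid" where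
  "dihedral_group n =
     \<lparr>carrier = {0..<int n} \<times> UNIV,
      mult = (\<lambda>(i, s) (j, t). ((if s then i - j else i + j) mod int n, s \<noteq> t)),
      one = (0, False)\<rparr>"

lemma group_Iso: "group (Iso X)"
proof (rule groupI)
  fix f assume "f \<in> carrier (Iso X)"
  then have f: "bij f" "\<And>x y. dist (f x) (f y) = dist x y" "f ` X = X"
    by (auto simp: Iso_def)
  have "dist (inv_into UNIV f x) (inv_into UNIV f y) = dist x y" for x y
    using f(2)[of "inv_into UNIV f x" "inv_into UNIV f y"] f(1)
    by (simp add: bij_is_surj surj_f_inv_f)
  moreover have "inv_into UNIV f ` X = X"
    using f(1,3) by (metis bij_is_inj image_inv_f_f)
  ultimately have "inv_into UNIV f \<in> carrier (Iso X)"
    using f(1) by (auto simp: Iso_def bij_imp_bij_inv)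
  moreover have "inv_into UNIV f \<otimes>\<^bsub>Iso X\<^esub> f = \<one>\<^bsub>Iso X\<^esub>"
    using f(1) by (simp add: Iso_def bij_is_inj)
  ultimately show "\<exists>g\<in>carrier (Iso X). g \<otimes>\<^bsub>Iso X\<^esub> f = \<one>\<^bsub>Iso X\<^esub>"
    by blast
next
  fix f g assume "f \<in> carrier (Iso X)" "g \<in> carrier (Iso X)"
  then show "f \<otimes>\<^bsub>Iso X\<^esub> g \<in> carrier (Iso X)"
    by (simp add: Iso_def bij_comp) (metis image_image)
qed (auto simp: Iso_def)

lemma group_dihedral_group:
  assumes "n \<ge> 1"
  shows "group (dihedral_group n)"
proof (rule groupI)
  fix x assume x: "x \<in> carrier (dihedral_group n)"
  obtain i s where "x = (i, s)" by force
  with x assms show "\<exists>y\<in>carrier (dihedral_group n). y \<otimes>\<^bsub>dihedral_group n\<^esub> x = \<one>\<^bsub>dihedral_group n\<^esub>"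
    by (intro bexI [of _ "if s then (i, s) else ((- i) mod int n, s)"])
       (auto simp: dihedral_group_def mod_simps)
qed (use assms in \<open>auto simp: dihedral_group_def mod_simps algebra_simps\<close>)

lemma order_dihedral_group: "order (dihedral_group n) = 2 * n"
  by (simp add: order_def dihedral_group_def card_cartesian_product)

lemma sets_normalized_lebesgue:
  "X \<in> sets borel \<Longrightarrow> sets (normalized_lebesgue X) = {A \<in> sets borel. A \<subseteq> X}"
  by (auto simp: normalized_lebesgue_def sets_restrict_space_iff sets_restrict_space)

lemma measure_normalized_lebesgue:
  assumes "compact X" "A \<in> sets borel" "A \<subseteq> X"
  shows "measure (normalized_lebesgue X) A = measure lborel A / measure lborel X"
proof -
  have X: "X \<in> sets borel" using assms(1) by (simp add: borel_compact)
  have "measure (normalized_lebesgue X) A = measure (uniform_measure lborel X) A"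
    unfolding normalized_lebesgue_def using X assms(3)
    by (intro measure_restrict_space) auto
  also have "\<dots> = measure lborel (X \<inter> A) / measure lborel X"
  proof (cases "emeasure lborel X = 0")
    case True
    then have "emeasure lborel (X \<inter> A) = 0"
      using X assms(2) by (metis emeasure_eq_0 inf_le1 sets_lborel)
    then show ?thesis
      using X assms(2) by (simp add: measure_def emeasure_uniform_measure)
  next
    case False
    then show ?thesis
      using X assms emeasure_compact_finite [OF assms(1)]
      by (intro measure_uniform_measure) auto
  qed
  finally show ?thesis
    using assms(3) by (simp add: Int_absorb1)
qed

end

theory Submission
  imports Defs
begin

text \<open>
  For a measure-preserving action, a symmetry \<open>g\<close> and a colour \<open>c\<close>, the largest \<open>g\<close>-invariant subset of
  colour \<open>c\<close> consists of the points whose \<open>g\<close>-orbit has colour \<open>c\<close>. Its size depends only on the joint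
  law of the colours along an orbit, so \<open>ms\<close> can only grow when one passes to an equivariant factor.

  If the group of symmetries of \<open>X\<close> is finite, \<open>G \<times> I\<close> is a factor of \<open>X\<close>: the Dirichlet cells of a generic
  orbit give an equivariant map to \<open>G\<close>, and the distance to the centroid, which every symmetry fixes,
  gives an invariant coordinate with an atomless law. Conversely the law of the colours along an orbit in \<open>X\<close>
  takes finitely many values and is realised on \<open>G \<times> I\<close>. In the plane, a finite group that contains a
  reflection is dihedral, its rotations being the \<open>n\<close>-th roots of unity; for a group of rotations, or of
  one reflection and the identity, a half-plane colouring shows that the value is \<open>0\<close>.

  If the group is infinite, compactness makes \<open>X\<close> invariant under all rotations. Averaging over all
  reflections gives the lower bound \<open>1/r\<^sup>2\<close>. For the upper bound one colours by the angle, with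
  frequencies that grow rapidly from arc to arc: then the colours of a point and of its image under
  a reflection, or under a rotation by an angle far from \<open>0\<close>, are almost independent. Every
  nontrivial rotation has a power of the latter kind.
\<close>

section \<open>Symmetric subsets under measure-preserving actions\<close>

definition admissible ::
  "'x measure \<Rightarrow> ('g, 'm) monoid_scheme \<Rightarrow> ('g \<Rightarrow> 'x \<Rightarrow> 'x) \<Rightarrow> nat \<Rightarrow> real \<Rightarrow> bool" where
  "admissible M G act r \<epsilon> \<longleftrightarrow>
     (\<forall>col \<in> measurable M (count_space {..<r}).
        \<exists>A \<in> sets M. (\<exists>c<r. \<forall>x\<in>A. col x = c) \<and> measure M A \<ge> \<epsilon> \<and>
          (\<exists>g \<in> carrier G. g \<noteq> \<one>\<^bsub>G\<^esub> \<and> act g ` A = A))"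

lemma ms_eq_Sup_admissible: "ms M G act r = Sup ({0} \<union> {\<epsilon>. \<epsilon> > 0 \<and> admissible M G act r \<epsilon>})"
  by (simp add: ms_def admissible_def)

lemma ms_leI:
  assumes "v \<ge> 0" and col: "col \<in> measurable M (count_space {..<r})"
    and small: "\<And>A c g. A \<in> sets M \<Longrightarrow> \<forall>x\<in>A. col x = c \<Longrightarrow> g \<in> carrier G \<Longrightarrow> g \<noteq> \<one>\<^bsub>G\<^esub> \<Longrightarrow>
      act g ` A = A \<Longrightarrow> measure M A \<le> v"
  shows "ms M G act r \<le> v"
proof -
  have "\<epsilon> \<le> v" if "admissible M G act r \<epsilon>" for \<epsilon>
    using that[unfolded admissible_def, rule_format, OF col] small by (meson order_trans)
  with \<open>v \<ge> 0\<close> show ?thesis unfolding ms_eq_Sup_admissible by (intro cSup_least) auto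
qed

lemma bdd_above_admissible:
  assumes "prob_space M" "r \<ge> 1"
  shows "bdd_above ({0} \<union> {\<epsilon>. \<epsilon> > 0 \<and> admissible M G act r \<epsilon>})"
proof (rule bdd_aboveI[of _ 1])
  interpret prob_space M by fact
  fix \<epsilon> :: real assume \<epsilon>: "\<epsilon> \<in> {0} \<union> {\<epsilon>. \<epsilon> > 0 \<and> admissible M G act r \<epsilon>}"
  have "(\<lambda>_. 0) \<in> measurable M (count_space {..<r})" using assms by simp
  then have "\<epsilon> \<le> 1" if "admissible M G act r \<epsilon>"
    using that prob_le_1 order_trans unfolding admissible_def by blast
  then show "\<epsilon> \<le> 1" using \<epsilon> by auto
qed

lemma ms_nonneg:
  assumes "prob_space M" "r \<ge> 1"
  shows "ms M G act r \<ge> 0"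
  unfolding ms_eq_Sup_admissible using bdd_above_admissible[OF assms] by (intro cSup_upper) auto

lemma ms_geI:
  assumes "prob_space M" "r \<ge> 1" and adm: "\<epsilon> > 0 \<Longrightarrow> admissible M G act r \<epsilon>"
  shows "ms M G act r \<ge> \<epsilon>"
proof (cases "\<epsilon> > 0")
  case True
  then show ?thesis
    unfolding ms_eq_Sup_admissible using bdd_above_admissible[OF assms(1,2)] adm
    by (intro cSup_upper) auto
next
  case False
  then show ?thesis using ms_nonneg[OF assms(1,2), of G act] by linarith
qed

lemma ms_mono:
  assumes "prob_space N" "r \<ge> 1"
    and "\<And>\<epsilon>. \<epsilon> > 0 \<Longrightarrow> admissible M G act r \<epsilon> \<Longrightarrow> admissible N H act' r \<epsilon>"
  shows "ms M G act r \<le> ms N H act' r"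
  unfolding ms_eq_Sup_admissible using bdd_above_admissible[OF assms(1,2)] assms(3)
  by (intro cSup_subset_mono) auto

locale measure_preserving_action = prob_space M + group G
  for M :: "'x measure" and G :: "('g, 'm) monoid_scheme" (structure) +
  fixes act :: "'g \<Rightarrow> 'x \<Rightarrow> 'x"
  assumes act_measurable: "g \<in> carrier G \<Longrightarrow> act g \<in> measurable M M"
    and distr_act: "g \<in> carrier G \<Longrightarrow> distr M M (act g) = M"
    and act_one: "x \<in> space M \<Longrightarrow> act \<one> x = x"
    and act_mult: "g \<in> carrier G \<Longrightarrow> h \<in> carrier G \<Longrightarrow> x \<in> space M \<Longrightarrow> act (g \<otimes> h) x = act g (act h x)"
begin

lemma act_in_space: "g \<in> carrier G \<Longrightarrow> x \<in> space M \<Longrightarrow> act g x \<in> space M"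
  using measurable_space[OF act_measurable] .

lemma act_inv_cancel:
  assumes "g \<in> carrier G" "x \<in> space M"
  shows "act (inv g) (act g x) = x" "act g (act (inv g) x) = x"
  using act_mult[of "inv g" g x] act_mult[of g "inv g" x] act_one assms by simp_all

lemma prob_act_vimage:
  assumes "g \<in> carrier G" "S \<in> sets M"
  shows "prob {x\<in>space M. act g x \<in> S} = prob S"
proof -
  have "prob S = measure (distr M M (act g)) S" using assms by (simp add: distr_act)
  also have "\<dots> = prob (act g -` S \<inter> space M)" using act_measurable assms by (intro measure_distr)
  also have "act g -` S \<inter> space M = {x\<in>space M. act g x \<in> S}" by auto
  finally show ?thesis by simp
qed

definition monochromatic_orbits :: "('x \<Rightarrow> 'c) \<Rightarrow> 'g \<Rightarrow> 'c \<Rightarrow> 'x set" where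
  "monochromatic_orbits col g c = {x\<in>space M. \<forall>k::int. col (act (g [^] k) x) = c}"

lemma sets_monochromatic_orbits:
  assumes "col \<in> measurable M (count_space C)" "g \<in> carrier G"
  shows "monochromatic_orbits col g c \<in> sets M"
proof -
  have "Measurable.pred M (\<lambda>x. col (act (g [^] k) x) = c)" for k :: int
    using measurable_compose[OF act_measurable assms(1)] assms(2) by (intro pred_eq_const1) auto
  then show ?thesis unfolding monochromatic_orbits_def by measurable
qed

lemma act_monochromatic_orbits:
  assumes g: "g \<in> carrier G"
  shows "act g ` monochromatic_orbits col g c = monochromatic_orbits col g c"
proof -
  have shift: "act (g [^] i) x \<in> monochromatic_orbits col g c"
    if "x \<in> monochromatic_orbits col g c" for x and i :: int
  proof -
    have "act (g [^] k) (act (g [^] i) x) = act (g [^] (k + i)) x" for k :: int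
      using that g by (simp add: int_pow_mult act_mult monochromatic_orbits_def)
    then show ?thesis using that g act_in_space by (simp add: monochromatic_orbits_def)
  qed
  show ?thesis
  proof
    show "act g ` monochromatic_orbits col g c \<subseteq> monochromatic_orbits col g c"
      using shift[of _ 1] g by (auto simp del: int_pow_neg)
    show "monochromatic_orbits col g c \<subseteq> act g ` monochromatic_orbits col g c"
    proof
      fix x assume x: "x \<in> monochromatic_orbits col g c"
      then have "x = act g (act (inv g) x)"
        using act_inv_cancel g by (simp add: monochromatic_orbits_def)
      moreover have "act (inv g) x \<in> monochromatic_orbits col g c"
        using shift[OF x, of "- 1"] g by (simp add: int_pow_neg)
      ultimately show "x \<in> act g ` monochromatic_orbits col g c" by blast
    qed
  qed
qed

lemma subset_monochromatic_orbits:
  assumes g: "g \<in> carrier G" and A: "A \<subseteq> space M" "act g ` A = A" "\<forall>x\<in>A. col x = c"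
  shows "A \<subseteq> monochromatic_orbits col g c"
proof
  fix x assume x: "x \<in> A"
  have up: "act (g [^] n) x \<in> A" for n :: nat
  proof (induction n)
    case 0
    show ?case using x A(1) act_one by auto
  next
    case (Suc n)
    have "act (g [^] Suc n) x = act g (act (g [^] n) x)"
      using g x A(1) nat_pow_Suc2[OF g] by (simp add: act_mult subset_iff del: nat_pow_Suc)
    then show ?case using Suc A(2) by auto
  qed
  have inv_closed: "act (inv g) y \<in> A" if "y \<in> A" for y
  proof -
    have "y \<in> act g ` A" unfolding A(2) by (rule that)
    then obtain z where "z \<in> A" "y = act g z" by blast
    then show ?thesis using A(1) act_inv_cancel(1)[OF g, of z] by auto
  qed
  have down: "act (inv (g [^] n)) x \<in> A" for n :: nat
  proof (induction n)
    case 0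
    show ?case using x A(1) act_one by auto
  next
    case (Suc n)
    have "act (inv (g [^] Suc n)) x = act (inv g) (act (inv (g [^] n)) x)"
      using g x A(1) by (simp add: inv_mult_group act_mult subset_iff)
    then show ?case using Suc inv_closed by simp
  qed
  have "act (g [^] k) x \<in> A" for k :: int
    by (cases k rule: int_cases2) (use up down g in \<open>simp_all add: int_pow_int int_pow_neg_int\<close>)
  then show "x \<in> monochromatic_orbits col g c" using x A by (auto simp: monochromatic_orbits_def)
qed

lemma admissible_iff_monochromatic_orbits:
  "admissible M G act r \<epsilon> \<longleftrightarrow>
    (\<forall>col \<in> measurable M (count_space {..<r}). \<exists>c<r. \<exists>g\<in>carrier G. g \<noteq> \<one> \<and>
        \<epsilon> \<le> prob (monochromatic_orbits col g c))"
  unfolding admissible_def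
proof (intro ball_cong refl iffI)
  fix col assume col: "col \<in> measurable M (count_space {..<r})"
  assume "\<exists>A\<in>events. (\<exists>c<r. \<forall>x\<in>A. col x = c) \<and> \<epsilon> \<le> prob A \<and> (\<exists>g\<in>carrier G. g \<noteq> \<one> \<and> act g ` A = A)"
  then obtain A c g where A: "A \<in> events" "c < r" "\<forall>x\<in>A. col x = c" "\<epsilon> \<le> prob A"
    and g: "g \<in> carrier G" "g \<noteq> \<one>" "act g ` A = A" by blast
  have "prob A \<le> prob (monochromatic_orbits col g c)"
    using A g
    by (intro finite_measure_mono subset_monochromatic_orbits sets_monochromatic_orbits[OF col]
        sets.sets_into_space)
  with A(4) have "\<epsilon> \<le> prob (monochromatic_orbits col g c)" by (rule order_trans)
  with A(2) g show "\<exists>c<r. \<exists>g\<in>carrier G. g \<noteq> \<one> \<and> \<epsilon> \<le> prob (monochromatic_orbits col g c)" by blast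
next
  fix col assume col: "col \<in> measurable M (count_space {..<r})"
  assume "\<exists>c<r. \<exists>g\<in>carrier G. g \<noteq> \<one> \<and> \<epsilon> \<le> prob (monochromatic_orbits col g c)"
  then obtain c g where c: "c < r" "\<epsilon> \<le> prob (monochromatic_orbits col g c)"
    and g: "g \<in> carrier G" "g \<noteq> \<one>"
    by blast
  have "\<forall>x\<in>monochromatic_orbits col g c. col x = c"
    using act_one by (force simp: monochromatic_orbits_def dest: spec[of _ 0])
  with c g show "\<exists>A\<in>events. (\<exists>c<r. \<forall>x\<in>A. col x = c) \<and> \<epsilon> \<le> prob A \<and>
      (\<exists>g\<in>carrier G. g \<noteq> \<one> \<and> act g ` A = A)"
    using act_monochromatic_orbits[OF g(1)] sets_monochromatic_orbits[OF col g(1)]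
    by (intro bexI[of _ "monochromatic_orbits col g c"] conjI exI[of _ c] bexI[of _ g])
qed

end

lemma prob_space_pullback_AE:
  assumes "prob_space M" and \<theta>: "\<theta> \<in> measurable M N" "distr M N \<theta> = N"
    and sets: "A \<in> sets M" "B \<in> sets N" and eq: "AE x in M. x \<in> A \<longleftrightarrow> \<theta> x \<in> B"
  shows "measure M A = measure N B"
proof -
  interpret prob_space M by fact
  have "measure N B = measure M (\<theta> -` B \<inter> space M)"
    using measure_distr[OF \<theta>(1) sets(2)] \<theta>(2) by simp
  also have "\<dots> = measure M A"
    using measurable_sets[OF \<theta>(1) sets(2)] sets(1) eq AE_space
    by (intro finite_measure_eq_AE) (auto elim: eventually_elim2)
  finally show ?thesis by simp
qed

text \<open>A colouring of a factor pulls back to a colouring whose monochromatic orbits are the preimages.\<close>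

lemma ms_le_factor:
  assumes "measure_preserving_action M G act" "measure_preserving_action N H act'" and r: "r \<ge> 1"
    and \<psi>: "\<psi> \<in> hom G H" "\<And>g. g \<in> carrier G \<Longrightarrow> \<psi> g = \<one>\<^bsub>H\<^esub> \<Longrightarrow> g = \<one>\<^bsub>G\<^esub>"
    and \<theta>: "\<theta> \<in> measurable M N" "distr M N \<theta> = N"
    and equivariant: "AE x in M. \<forall>g\<in>carrier G. \<theta> (act g x) = act' (\<psi> g) (\<theta> x)"
  shows "ms M G act r \<le> ms N H act' r"
proof (rule ms_mono[OF _ r])
  interpret M: measure_preserving_action M G act by fact
  interpret N: measure_preserving_action N H act' by fact
  interpret group_hom G H \<psi> by unfold_locales (fact \<psi>(1))
  show "prob_space N" by (rule N.prob_space_axioms)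
  fix \<epsilon> :: real assume adm: "admissible M G act r \<epsilon>"
  show "admissible N H act' r \<epsilon>"
    unfolding N.admissible_iff_monochromatic_orbits
  proof
    fix col assume col: "col \<in> measurable N (count_space {..<r})"
    have col\<theta>: "col \<circ> \<theta> \<in> measurable M (count_space {..<r})"
      using \<theta>(1) col by (rule measurable_comp)
    obtain c g where c: "c < r" "\<epsilon> \<le> M.prob (M.monochromatic_orbits (col \<circ> \<theta>) g c)"
      and g: "g \<in> carrier G" "g \<noteq> \<one>\<^bsub>G\<^esub>"
      using adm[unfolded M.admissible_iff_monochromatic_orbits] col\<theta> by blast
    have "AE x in M. x \<in> M.monochromatic_orbits (col \<circ> \<theta>) g c \<longleftrightarrow>
        \<theta> x \<in> N.monochromatic_orbits col (\<psi> g) c"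
      using equivariant AE_space
    proof eventually_elim
      case (elim x)
      then have "\<theta> (act (g [^]\<^bsub>G\<^esub> k) x) = act' (\<psi> g [^]\<^bsub>H\<^esub> k) (\<theta> x)" for k :: int
        using g by (simp add: hom_int_pow)
      then show ?case
        using elim measurable_space[OF \<theta>(1)]
        by (simp add: M.monochromatic_orbits_def N.monochromatic_orbits_def)
    qed
    then have "M.prob (M.monochromatic_orbits (col \<circ> \<theta>) g c) =
        N.prob (N.monochromatic_orbits col (\<psi> g) c)"
      using \<theta> g col col\<theta>
      by (intro prob_space_pullback_AE[OF M.prob_space_axioms \<theta>] M.sets_monochromatic_orbits[OF col\<theta>]
          N.sets_monochromatic_orbits[OF col]) auto
    with c have "\<epsilon> \<le> N.prob (N.monochromatic_orbits col (\<psi> g) c)" by simp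
    moreover have "\<psi> g \<noteq> \<one>\<^bsub>H\<^esub>" using g(2) \<psi>(2)[OF g(1)] by (rule contrapos_nn)
    ultimately show "\<exists>c<r. \<exists>g\<in>carrier H. g \<noteq> \<one>\<^bsub>H\<^esub> \<and> \<epsilon> \<le> N.prob (N.monochromatic_orbits col g c)"
      using c(1) hom_closed[OF g(1)] by blast
  qed
qed

section \<open>Finite groups and the product with the interval\<close>

abbreviation unit_interval :: "real measure" where
  "unit_interval \<equiv> restrict_space lborel {0..1}"

abbreviation group_interval :: "('g, 'm) monoid_scheme \<Rightarrow> ('g \<times> real) measure" where
  "group_interval G \<equiv> uniform_count_measure (carrier G) \<Otimes>\<^sub>M unit_interval"

lemma prob_space_unit_interval: "prob_space unit_interval"
  by (rule prob_spaceI) (simp add: emeasure_restrict_space space_restrict_space)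

lemma distr_uniform_count_measure_bij_betw:
  assumes "finite A" and f: "bij_betw f A B"
  shows "distr (uniform_count_measure A) (uniform_count_measure B) f = uniform_count_measure B"
proof (rule measure_eqI_finite)
  show "finite B" using assms bij_betw_finite by blast
  fix b assume b: "b \<in> B"
  then obtain a where a: "a \<in> A" "f a = b" using f by (auto simp: bij_betw_def)
  have "f \<in> measurable (uniform_count_measure A) (uniform_count_measure B)"
    using f
    by (auto simp: measurable_def space_uniform_count_measure sets_uniform_count_measure bij_betw_def)
  moreover have "f -` {b} \<inter> A = {a}" using a f by (auto simp: bij_betw_def inj_on_def)
  ultimately show "emeasure (distr (uniform_count_measure A) (uniform_count_measure B) f) {b} =
      emeasure (uniform_count_measure B) {b}"
    using a b \<open>finite A\<close> \<open>finite B\<close> bij_betw_same_card[OF f]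
    by (simp add: emeasure_distr sets_uniform_count_measure space_uniform_count_measure
        emeasure_uniform_count_measure)
qed (simp_all add: sets_uniform_count_measure)

lemma group_interval_bij_betw:
  assumes "finite (carrier G)" "carrier G \<noteq> {}" and f: "bij_betw f (carrier G) (carrier H)"
  shows "(\<lambda>(h, t). (f h, t)) \<in> measurable (group_interval G) (group_interval H)"
    and "distr (group_interval G) (group_interval H) (\<lambda>(h, t). (f h, t)) = group_interval H"
proof -
  interpret I: prob_space unit_interval by (rule prob_space_unit_interval)
  have fm: "f \<in> measurable (uniform_count_measure (carrier G)) (uniform_count_measure (carrier H))"
    using f
    by (auto simp: measurable_def space_uniform_count_measure sets_uniform_count_measure bij_betw_def)
  then show "(\<lambda>(h, t). (f h, t)) \<in> measurable (group_interval G) (group_interval H)"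
    unfolding case_prod_beta by measurable
  have "distr unit_interval unit_interval (\<lambda>t. t) = unit_interval" by (rule distr_id)
  then show "distr (group_interval G) (group_interval H) (\<lambda>(h, t). (f h, t)) = group_interval H"
    using pair_measure_distr[OF fm, of "\<lambda>t. t" unit_interval unit_interval]
      I.sigma_finite_measure_axioms
      distr_uniform_count_measure_bij_betw[OF assms(1) f] by simp
qed

lemma measure_preserving_action_group_interval:
  assumes "group G" and fin: "finite (carrier G)"
  shows "measure_preserving_action (group_interval G) G (\<lambda>g (h, t). (g \<otimes>\<^bsub>G\<^esub> h, t))"
proof -
  interpret group G by fact
  have "carrier G \<noteq> {}" using one_closed by blast
  then have "prob_space (group_interval G)"
    using fin by (intro prob_space_pair prob_space_uniform_count_measure prob_space_unit_interval)
  moreover have "bij_betw ((\<otimes>\<^bsub>G\<^esub>) g) (carrier G) (carrier G)" if "g \<in> carrier G" for g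
    using that by (intro bij_betw_byWitness[of _ "(\<otimes>\<^bsub>G\<^esub>) (inv\<^bsub>G\<^esub> g)"]) (auto simp: m_assoc[symmetric])
  then have "(\<lambda>(h, t). (g \<otimes>\<^bsub>G\<^esub> h, t)) \<in> measurable (group_interval G) (group_interval G)"
    "distr (group_interval G) (group_interval G) (\<lambda>(h, t). (g \<otimes>\<^bsub>G\<^esub> h, t)) = group_interval G"
    if "g \<in> carrier G" for g
    using group_interval_bij_betw[OF fin \<open>carrier G \<noteq> {}\<close>] that by blast+
  ultimately show ?thesis
    using group_axioms
    by (intro measure_preserving_action.intro measure_preserving_action_axioms.intro)
      (auto simp: space_pair_measure space_uniform_count_measure m_assoc)
qed

lemma finite_carrier_iso: "G \<cong> H \<Longrightarrow> finite (carrier G) \<longleftrightarrow> finite (carrier H)"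
  using bij_betw_finite by (auto simp: is_iso_def iso_def)

lemma ms_group_interval_le_iso:
  assumes "group G" "group H" "finite (carrier G)" and \<psi>: "\<psi> \<in> iso G H" and r: "r \<ge> 1"
  shows "ms_group_interval G r \<le> ms_group_interval H r"
  unfolding ms_group_interval_def
proof (rule ms_le_factor[OF _ _ r, where \<theta> = "\<lambda>(h, t). (\<psi> h, t)" and \<psi> = \<psi>])
  have bij: "bij_betw \<psi> (carrier G) (carrier H)" and hom: "\<psi> \<in> hom G H"
    using \<psi> by (auto simp: iso_def)
  have ne: "carrier G \<noteq> {}" using group.is_monoid[OF \<open>group G\<close>] monoid.one_closed by blast
  show "measure_preserving_action (group_interval G) G (\<lambda>g (h, t). (g \<otimes>\<^bsub>G\<^esub> h, t))"
    using assms by (intro measure_preserving_action_group_interval)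
  show "measure_preserving_action (group_interval H) H (\<lambda>g (h, t). (g \<otimes>\<^bsub>H\<^esub> h, t))"
    using assms bij_betw_finite[OF bij] by (intro measure_preserving_action_group_interval) auto
  show "\<psi> \<in> hom G H" by fact
  show "(\<lambda>(h, t). (\<psi> h, t)) \<in> measurable (group_interval G) (group_interval H)"
    "distr (group_interval G) (group_interval H) (\<lambda>(h, t). (\<psi> h, t)) = group_interval H"
    using group_interval_bij_betw[OF \<open>finite (carrier G)\<close> ne bij] by blast+
  show "AE x in group_interval G. \<forall>g\<in>carrier G.
      (case case x of (h, t) \<Rightarrow> (g \<otimes>\<^bsub>G\<^esub> h, t) of (h, t) \<Rightarrow> (\<psi> h, t)) =
      (case case x of (h, t) \<Rightarrow> (\<psi> h, t) of (h, t) \<Rightarrow> (\<psi> g \<otimes>\<^bsub>H\<^esub> h, t))"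
    using hom by (intro AE_I2) (auto simp: space_pair_measure space_uniform_count_measure hom_mult)
  show "g = \<one>\<^bsub>G\<^esub>" if "g \<in> carrier G" "\<psi> g = \<one>\<^bsub>H\<^esub>" for g
    using that bij hom_one[OF hom \<open>group G\<close> \<open>group H\<close>] group.is_monoid[OF \<open>group G\<close>]
      monoid.one_closed
    unfolding bij_betw_def inj_on_def by metis
qed

lemma ms_group_interval_cong_iso:
  assumes "group G" "group H" "finite (carrier G)" "G \<cong> H" "r \<ge> 1"
  shows "ms_group_interval G r = ms_group_interval H r"
proof (rule antisym)
  obtain \<psi> where \<psi>: "\<psi> \<in> iso G H" using assms(4) by (auto simp: is_iso_def)
  have "finite (carrier H)" using assms(3) finite_carrier_iso[OF assms(4)] by simp
  moreover have "inv_into (carrier G) \<psi> \<in> iso H G" using \<psi> by (rule group.iso_set_sym[OF assms(1)])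
  ultimately show "ms_group_interval G r \<le> ms_group_interval H r"
      "ms_group_interval H r \<le> ms_group_interval G r"
    using assms(1-3,5) \<psi> by - (rule ms_group_interval_le_iso; assumption)+
qed

lemma finite_interval_partition:
  fixes p :: "'v \<Rightarrow> real"
  assumes "finite V" "\<And>a. a \<in> V \<Longrightarrow> p a \<ge> 0"
  shows "\<exists>S. (\<forall>a\<in>V. S a \<in> sets borel \<and> emeasure lborel (S a) = p a) \<and> disjoint_family_on S V \<and>
    (\<Union>a\<in>V. S a) = {0..<sum p V}"
  using assms
proof (induction V rule: finite_induct)
  case (insert b V)
  then obtain S
    where S: "\<forall>a\<in>V. S a \<in> sets borel \<and> emeasure lborel (S a) = p a" "disjoint_family_on S V"
    "(\<Union>a\<in>V. S a) = {0..<sum p V}"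
    by auto
  define S' where "S' = S(b := {sum p V..<sum p V + p b})"
  have S'_V: "S' a = S a" if "a \<in> V" for a using that insert.hyps by (auto simp: S'_def)
  have "\<forall>a\<in>insert b V. S' a \<in> sets borel \<and> emeasure lborel (S' a) = p a"
    using S(1) insert.prems by (auto simp: S'_def)
  moreover have "disjoint_family_on S' (insert b V)"
    using S(2,3) insert.hyps S'_V
    by (subst disjoint_family_on_insert) (auto simp: S'_def disjoint_family_on_def)
  moreover have "(\<Union>a\<in>insert b V. S' a) = {0..<sum p (insert b V)}"
  proof -
    have "(\<Union>a\<in>V. S' a) = {0..<sum p V}" using S(3) S'_V by simp
    moreover have "S' b = {sum p V..<sum p V + p b}" by (simp add: S'_def)
    ultimately have "(\<Union>a\<in>insert b V. S' a) = {0..<sum p V} \<union> {sum p V..<sum p V + p b}" by auto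
    also have "\<dots> = {0..<sum p V + p b}"
      using insert.prems by (intro ivl_disj_un_two(3)) (auto intro: sum_nonneg)
    finally show ?thesis using insert.hyps by (simp add: add.commute)
  qed
  ultimately show ?case by blast
qed (simp add: disjoint_family_on_def)

lemma finite_law_on_unit_interval:
  assumes "prob_space M" and V: "finite V" and v: "v \<in> measurable M (count_space V)"
  obtains w where "w \<in> measurable unit_interval (count_space V)"
    "distr unit_interval (count_space V) w = distr M (count_space V) v"
proof -
  interpret prob_space M by fact
  define p where "p a = prob (v -` {a} \<inter> space M)" for a
  have v_sets: "v -` {a} \<inter> space M \<in> sets M" if "a \<in> V" for a
    using measurable_sets[OF v] that by simp
  have "(\<Union>a\<in>V. v -` {a} \<inter> space M) = space M" using measurable_space[OF v] by auto
  then have "sum p V = 1"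
    unfolding p_def using V v_sets prob_space
    by (subst finite_measure_finite_Union[symmetric]) (auto simp: disjoint_family_on_def)
  moreover have "p a \<ge> 0" for a by (simp add: p_def)
  ultimately obtain S
    where S: "\<forall>a\<in>V. S a \<in> sets borel \<and> emeasure lborel (S a) = p a" "disjoint_family_on S V"
    "(\<Union>a\<in>V. S a) = {0..<1::real}"
    using finite_interval_partition[OF V, of p] by auto
  then have "\<exists>a\<in>V. t \<in> S a" if "t \<in> {0..<1}" for t using that by blast
  then obtain u where u: "\<And>t. t \<in> {0..<1} \<Longrightarrow> u t \<in> V \<and> t \<in> S (u t)" by metis
  define w where "w t = u (if t \<in> {0..<1} then t else 0)" for t
  have w_V: "w t \<in> V" for t using u by (simp add: w_def)
  have fibre: "w -` {a} \<inter> {0..1} = S a \<union> ({1} \<inter> w -` {a})" if a: "a \<in> V" for a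
  proof -
    have "w t = a \<longleftrightarrow> t \<in> S a" if "t \<in> {0..<1}" for t
      using u[OF that] S(2) a that by (auto simp: w_def disjoint_family_on_def)
    moreover have "S a \<subseteq> {0..<1}" using S(3) a by blast
    moreover have "{0..1::real} = {0..<1} \<union> {1}" by auto
    ultimately show ?thesis by blast
  qed
  have w_sets: "w -` {a} \<inter> {0..1} \<in> sets borel" if "a \<in> V" for a
    using S(1) that unfolding fibre[OF that] by (cases "w 1 = a") auto
  have w: "w \<in> measurable unit_interval (count_space V)"
    unfolding measurable_count_space_eq2[OF V] using w_V w_sets
    by (auto simp: space_restrict_space sets_restrict_space_iff)
  moreover have "distr unit_interval (count_space V) w = distr M (count_space V) v"
  proof (rule measure_eqI_finite[OF _ _ V])
    fix a assume a: "a \<in> V"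
    have "emeasure (distr unit_interval (count_space V) w) {a} =
        emeasure lborel (w -` {a} \<inter> {0..1})"
      using w a by (simp add: emeasure_distr space_restrict_space emeasure_restrict_space)
    also have "\<dots> = emeasure lborel (S a)"
      unfolding fibre[OF a] using S(1) a
      by (intro emeasure_Un_null_set) (auto intro: countable_imp_null_set_lborel)
    also have "\<dots> = emeasure (distr M (count_space V) v) {a}"
      using S(1) a v by (simp add: emeasure_distr p_def emeasure_eq_measure)
    finally show "emeasure (distr unit_interval (count_space V) w) {a} =
        emeasure (distr M (count_space V) v) {a}" .
  qed simp_all
  ultimately show ?thesis using that by blast
qed

lemma measurable_group_interval:
  assumes "finite (carrier G)"
    and "\<And>h. h \<in> carrier G \<Longrightarrow> (\<lambda>t. f (h, t)) \<in> measurable unit_interval N"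
  shows "f \<in> measurable (group_interval G) N"
proof -
  have "f \<in> measurable (count_space (carrier G) \<Otimes>\<^sub>M unit_interval) N"
    using assms by (intro measurable_pair_measure_countable1 countable_finite)
  then show ?thesis
    using sets_pair_measure_cong[OF sets_uniform_count_measure_count_space refl]
    by (simp cong: measurable_cong_sets)
qed

lemma measure_group_interval:
  assumes fin: "finite (carrier G)" and E: "E \<in> sets (group_interval G)"
  shows "measure (group_interval G) E =
    (\<Sum>h\<in>carrier G. measure unit_interval (Pair h -` E)) / card (carrier G)"
proof -
  interpret I: prob_space unit_interval by (rule prob_space_unit_interval)
  have "emeasure (group_interval G) E =
      (\<integral>\<^sup>+h. emeasure unit_interval (Pair h -` E) \<partial>uniform_count_measure (carrier G))"
    by (rule I.emeasure_pair_measure_alt[OF E])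
  also have "\<dots> = (\<Sum>h\<in>carrier G. ennreal (1 / card (carrier G)) *
      ennreal (measure unit_interval (Pair h -` E)))"
    unfolding uniform_count_measure_def using fin
    by (subst nn_integral_point_measure_finite) (auto simp: I.emeasure_eq_measure)
  also have "\<dots> = ennreal ((\<Sum>h\<in>carrier G. measure unit_interval (Pair h -` E)) / card (carrier G))"
    by (simp add: ennreal_mult[symmetric] sum_ennreal sum_divide_distrib)
  finally show ?thesis by (simp add: measure_def sum_nonneg)
qed


context measure_preserving_action
begin

definition orbit_colouring :: "('x \<Rightarrow> 'c) \<Rightarrow> 'x \<Rightarrow> 'g \<Rightarrow> 'c" where
  "orbit_colouring col x = restrict (\<lambda>h. col (act h x)) (carrier G)"

lemma measurable_orbit_colouring:
  assumes fin: "finite (carrier G)" "finite C" and col: "col \<in> measurable M (count_space C)"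
  shows "orbit_colouring col \<in> measurable M (count_space (carrier G \<rightarrow>\<^sub>E C))"
proof -
  have col_act: "(\<lambda>x. col (act h x)) \<in> measurable M (count_space C)" if "h \<in> carrier G" for h
    using act_measurable[OF that] col by (rule measurable_compose)
  have "orbit_colouring col -` {a} \<inter> space M \<in> sets M" if a: "a \<in> carrier G \<rightarrow>\<^sub>E C" for a
  proof -
    have "orbit_colouring col -` {a} \<inter> space M = {x\<in>space M. \<forall>h\<in>carrier G. col (act h x) = a h}"
      using a by (auto simp: orbit_colouring_def fun_eq_iff restrict_def PiE_iff extensional_def)
    also have "\<dots> \<in> sets M"
    proof (rule sets.sets_Collect_finite_All'[OF _ fin(1)])
      fix h assume "h \<in> carrier G"
      then have "Measurable.pred M (\<lambda>x. col (act h x) = a h)"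
        using col_act a by (intro pred_eq_const1) auto
      then show "{x\<in>space M. col (act h x) = a h} \<in> sets M" by measurable
    qed (use one_closed in blast)
    finally show ?thesis .
  qed
  moreover have "orbit_colouring col x \<in> carrier G \<rightarrow>\<^sub>E C" if "x \<in> space M" for x
    using measurable_space[OF col_act that] by (auto simp: orbit_colouring_def)
  ultimately show ?thesis
    using fin by (subst measurable_count_space_eq2) (auto intro: finite_PiE)
qed

text \<open>
  The size of a set of monochromatic orbits is determined by the joint law of the colours along an orbit,
  which takes finitely many values and can therefore be realised on the interval.
\<close>

lemma colouring_group_interval:
  fixes r :: nat
  assumes fin: "finite (carrier G)" and col: "col \<in> measurable M (count_space {..<r})"
  shows "\<exists>col' \<in> measurable (group_interval G) (count_space {..<r}). \<forall>g\<in>carrier G. \<forall>c.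
      measure (group_interval G) (measure_preserving_action.monochromatic_orbits (group_interval G) G
        (\<lambda>g (h, t). (g \<otimes> h, t)) col' g c) = prob (monochromatic_orbits col g c)"
proof -
  interpret I: measure_preserving_action "group_interval G" G "\<lambda>g (h, t). (g \<otimes> h, t)"
    using group_axioms fin by (rule measure_preserving_action_group_interval)
  define V where "V = (carrier G \<rightarrow>\<^sub>E {..<r})"
  have V: "finite V" unfolding V_def using fin by (intro finite_PiE) auto
  have v: "orbit_colouring col \<in> measurable M (count_space V)"
    unfolding V_def using fin col by (intro measurable_orbit_colouring) auto
  obtain w where w: "w \<in> measurable unit_interval (count_space V)"
    and w_law: "distr unit_interval (count_space V) w =
        distr M (count_space V) (orbit_colouring col)"
    using finite_law_on_unit_interval[OF prob_space_axioms V v] .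
  have w_V: "w t \<in> V" if "t \<in> {0..1}" for t
    using measurable_space[OF w] that by (simp add: space_restrict_space)
  define col' where "col' = (\<lambda>(h, t). w t h)"
  have "(\<lambda>a. a h) \<in> measurable (count_space V) (count_space {..<r})" if "h \<in> carrier G" for h
    using that by (auto simp: V_def)
  from measurable_compose[OF w this] have col':
      "col' \<in> measurable (group_interval G) (count_space {..<r})"
    using fin by (intro measurable_group_interval) (simp_all add: col'_def)
  have slice: "measure unit_interval (Pair h -` I.monochromatic_orbits col' g c) =
      prob (monochromatic_orbits col g c)"
    if g: "g \<in> carrier G" and h: "h \<in> carrier G" for g h c
  proof -
    define B where "B = {a\<in>V. \<forall>k::int. a (g [^] k \<otimes> h) = c}"
    have "Pair h -` I.monochromatic_orbits col' g c = w -` B \<inter> space unit_interval"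
      using h w_V by (auto simp: I.monochromatic_orbits_def B_def col'_def space_pair_measure
          space_uniform_count_measure space_restrict_space)
    then have "measure unit_interval (Pair h -` I.monochromatic_orbits col' g c) =
        measure (distr unit_interval (count_space V) w) B"
      using w by (subst measure_distr) (auto simp: B_def)
    also have "\<dots> = prob (orbit_colouring col -` B \<inter> space M)"
      unfolding w_law using v by (intro measure_distr) (auto simp: B_def)
    also have "orbit_colouring col -` B \<inter> space M =
        {x\<in>space M. act h x \<in> monochromatic_orbits col g c}"
      using measurable_space[OF v] g h act_in_space
      by (auto simp: B_def orbit_colouring_def monochromatic_orbits_def act_mult)
    also have "prob \<dots> = prob (monochromatic_orbits col g c)"
      using h sets_monochromatic_orbits[OF col g] by (rule prob_act_vimage)
    finally show ?thesis .
  qed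
  have "measure (group_interval G) (I.monochromatic_orbits col' g c) =
      prob (monochromatic_orbits col g c)"
    if g: "g \<in> carrier G" for g c
    using measure_group_interval[OF fin I.sets_monochromatic_orbits[OF col' g]] slice[OF g] fin
      one_closed
    by (simp add: card_eq_0_iff) blast
  with col' show ?thesis by blast
qed

lemma ms_group_interval_le:
  assumes fin: "finite (carrier G)" and r: "r \<ge> 1"
  shows "ms_group_interval G r \<le> ms M G act r"
  unfolding ms_group_interval_def
proof (rule ms_mono[OF prob_space_axioms r])
  interpret I: measure_preserving_action "group_interval G" G "\<lambda>g (h, t). (g \<otimes> h, t)"
    using group_axioms fin by (rule measure_preserving_action_group_interval)
  fix \<epsilon> assume adm: "admissible (group_interval G) G (\<lambda>g (h, t). (g \<otimes> h, t)) r \<epsilon>"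
  show "admissible M G act r \<epsilon>"
    unfolding admissible_iff_monochromatic_orbits
  proof
    fix col assume "col \<in> measurable M (count_space {..<r})"
    with fin obtain col' where "col' \<in> measurable (group_interval G) (count_space {..<r})"
      "\<forall>g\<in>carrier G. \<forall>c.
        measure (group_interval G) (I.monochromatic_orbits col' g c) = prob (monochromatic_orbits col g c)"
      using colouring_group_interval by blast
    with adm show "\<exists>c<r. \<exists>g\<in>carrier G. g \<noteq> \<one> \<and> \<epsilon> \<le> prob (monochromatic_orbits col g c)"
      unfolding I.admissible_iff_monochromatic_orbits by fastforce
  qed
qed

context
  fixes \<eta> :: "'x \<Rightarrow> 'g" and T :: "'x \<Rightarrow> 'y" and N :: "'y measure"
  assumes fin: "finite (carrier G)"
    and \<eta>: "\<eta> \<in> measurable M (count_space (carrier G))"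
    and equivariant: "AE x in M. \<forall>g\<in>carrier G. \<eta> (act g x) = g \<otimes> \<eta> x"
    and T: "T \<in> measurable M N"
    and invariant: "\<And>g x. g \<in> carrier G \<Longrightarrow> x \<in> space M \<Longrightarrow> T (act g x) = T x"
begin

lemma sets_equivariant_cell:
  assumes "g \<in> carrier G" "B \<in> sets N"
  shows "{x\<in>space M. \<eta> x = g \<and> T x \<in> B} \<in> events"
proof -
  have "{x\<in>space M. \<eta> x = g \<and> T x \<in> B} = (\<eta> -` {g} \<inter> space M) \<inter> (T -` B \<inter> space M)" by auto
  then show ?thesis using measurable_sets[OF \<eta>, of "{g}"] measurable_sets[OF T] assms by simp
qed

lemma prob_equivariant_cell_eq:
  assumes g: "g \<in> carrier G" and B: "B \<in> sets N"
  shows "prob {x\<in>space M. \<eta> x = g \<and> T x \<in> B} = prob {x\<in>space M. \<eta> x = \<one> \<and> T x \<in> B}"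
    (is "prob (?cell g) = _")
proof -
  have cell_g: "?cell g \<in> events" using g B by (rule sets_equivariant_cell)
  have "AE x in M. x \<in> ?cell \<one> \<longleftrightarrow> x \<in> {x\<in>space M. act g x \<in> ?cell g}"
    using equivariant AE_space
  proof eventually_elim
    case (elim x)
    then have "\<eta> (act g x) = g \<otimes> \<eta> x" "\<eta> x \<in> carrier G" using g measurable_space[OF \<eta>] by auto
    then show ?case using elim g act_in_space invariant by (auto simp: r_cancel_one)
  qed
  moreover have "{x\<in>space M. act g x \<in> ?cell g} \<in> events"
    using measurable_sets[OF act_measurable[OF g] cell_g]
    by (simp add: vimage_def Int_def conj_commute)
  ultimately have "prob (?cell \<one>) = prob {x\<in>space M. act g x \<in> ?cell g}"
    using sets_equivariant_cell[OF one_closed B] by (intro finite_measure_eq_AE) auto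
  then show ?thesis using prob_act_vimage[OF g cell_g] by simp
qed

lemma prob_equivariant_invariant:
  assumes A: "A \<subseteq> carrier G" and B: "B \<in> sets N"
  shows "prob {x\<in>space M. \<eta> x \<in> A \<and> T x \<in> B} = card A * prob {x\<in>space M. \<eta> x = \<one> \<and> T x \<in> B}"
proof -
  have "{x\<in>space M. \<eta> x \<in> A \<and> T x \<in> B} = (\<Union>g\<in>A. {x\<in>space M. \<eta> x = g \<and> T x \<in> B})" by auto
  also have "prob \<dots> = (\<Sum>g\<in>A. prob {x\<in>space M. \<eta> x = g \<and> T x \<in> B})"
    using A B sets_equivariant_cell finite_subset[OF A fin]
    by (intro finite_measure_finite_Union) (auto simp: disjoint_family_on_def)
  also have "\<dots> = (\<Sum>g\<in>A. prob {x\<in>space M. \<eta> x = \<one> \<and> T x \<in> B})"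
    using A B by (intro sum.cong refl prob_equivariant_cell_eq) auto
  finally show ?thesis by simp
qed

lemma distr_equivariant_invariant:
  "distr M (uniform_count_measure (carrier G) \<Otimes>\<^sub>M distr M N T) (\<lambda>x. (\<eta> x, T x)) =
    uniform_count_measure (carrier G) \<Otimes>\<^sub>M distr M N T"
proof (rule pair_measure_eqI[symmetric])
  have ne: "carrier G \<noteq> {}" using one_closed by blast
  show "sigma_finite_measure (uniform_count_measure (carrier G))"
    using prob_space_uniform_count_measure[OF fin ne] by (rule prob_space_imp_sigma_finite)
  show "sigma_finite_measure (distr M N T)"
    using prob_space_distr[OF T] by (rule prob_space_imp_sigma_finite)
  let ?P = "uniform_count_measure (carrier G) \<Otimes>\<^sub>M distr M N T"
  have pair: "(\<lambda>x. (\<eta> x, T x)) \<in> measurable M ?P"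
    using \<eta> T by (intro measurable_Pair)
      (simp_all cong: measurable_cong_sets add: sets_uniform_count_measure_count_space)
  fix A B assume "A \<in> sets (uniform_count_measure (carrier G))" and "B \<in> sets (distr M N T)"
  then have A: "A \<subseteq> carrier G" and B: "B \<in> sets N" by (simp_all add: sets_uniform_count_measure)
  let ?p = "prob {x\<in>space M. \<eta> x = \<one> \<and> T x \<in> B}"
  have "emeasure (distr M N T) B = prob {x\<in>space M. \<eta> x \<in> carrier G \<and> T x \<in> B}"
    using measurable_space[OF \<eta>] by (subst emeasure_distr[OF T B])
      (auto simp: emeasure_eq_measure intro!: arg_cong[of _ _ prob])
  then have T_law: "emeasure (distr M N T) B = card (carrier G) * ?p"
    using prob_equivariant_invariant[OF order_refl B] by simp
  have "emeasure (distr M ?P (\<lambda>x. (\<eta> x, T x))) (A \<times> B) = prob {x\<in>space M. \<eta> x \<in> A \<and> T x \<in> B}"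
    using pair A B by (subst emeasure_distr)
      (auto simp: emeasure_eq_measure sets_uniform_count_measure intro!: arg_cong[of _ _ prob] pair_measureI)
  also have "\<dots> = ennreal (card A / card (carrier G)) * ennreal (card (carrier G) * ?p)"
    unfolding prob_equivariant_invariant[OF A B]
    using fin ne by (subst ennreal_mult[symmetric]) auto
  finally show "emeasure (uniform_count_measure (carrier G)) A * emeasure (distr M N T) B =
      emeasure (distr M ?P (\<lambda>x. (\<eta> x, T x))) (A \<times> B)"
    using A fin T_law by (simp add: emeasure_uniform_count_measure)
qed simp

end

definition fundamental_domain :: "'x set \<Rightarrow> bool" where
  "fundamental_domain F \<longleftrightarrow> F \<in> sets M \<and> (AE x in M. \<exists>!g. g \<in> carrier G \<and> act (inv g) x \<in> F)"

definition domain_position :: "'x set \<Rightarrow> 'x \<Rightarrow> 'g" where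
  "domain_position F x =
    (if \<exists>!g. g \<in> carrier G \<and> act (inv g) x \<in> F then THE g. g \<in> carrier G \<and> act (inv g) x \<in> F else \<one>)"

lemma domain_position_eq_iff:
  assumes "\<exists>!g. g \<in> carrier G \<and> act (inv g) x \<in> F"
  shows "domain_position F x = g \<longleftrightarrow> g \<in> carrier G \<and> act (inv g) x \<in> F"
  using assms the1_equality[OF assms, of g] theI'[OF assms] by (auto simp: domain_position_def)

lemma domain_position_closed: "domain_position F x \<in> carrier G"
proof (cases "\<exists>!g. g \<in> carrier G \<and> act (inv g) x \<in> F")
  case True
  then show ?thesis using domain_position_eq_iff[OF True, of "domain_position F x"] by simp
qed (simp only: domain_position_def if_False one_closed)

lemma measurable_domain_position:
  assumes fin: "finite (carrier G)" and F: "F \<in> sets M"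
  shows "domain_position F \<in> measurable M (count_space (carrier G))"
  unfolding measurable_count_space_eq2[OF fin]
proof (intro conjI ballI)
  define D where "D = {x\<in>space M. \<exists>!g. g \<in> carrier G \<and> act (inv g) x \<in> F}"
  have translate: "{x\<in>space M. act (inv g) x \<in> F} \<in> sets M" if "g \<in> carrier G" for g
    using measurable_sets[OF act_measurable F] that by (simp add: vimage_def Int_def conj_commute)
  have "D = {x\<in>space M. \<exists>g\<in>carrier G. act (inv g) x \<in> F \<and> (\<forall>h\<in>carrier G - {g}. act (inv h) x \<notin> F)}"
    by (auto simp: D_def)
  moreover have "{x\<in>space M. act (inv g) x \<in> F \<and> (\<forall>h\<in>carrier G - {g}. act (inv h) x \<notin> F)} \<in> sets M"
    if "g \<in> carrier G" for g
    using translate that fin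
    by (intro sets.sets_Collect_conj sets.sets_Collect_finite_All sets.sets_Collect_neg) auto
  ultimately have D: "D \<in> sets M" using fin by (simp only: sets.sets_Collect_finite_Ex)
  fix g assume g: "g \<in> carrier G"
  have "x \<in> domain_position F -` {g} \<inter> space M \<longleftrightarrow>
      x \<in> (D \<inter> {x\<in>space M. act (inv g) x \<in> F}) \<union> (if g = \<one> then space M - D else {})" for x
    using domain_position_eq_iff[of x F g] g
    by (cases "\<exists>!g. g \<in> carrier G \<and> act (inv g) x \<in> F") (auto simp: D_def domain_position_def)
  then have "domain_position F -` {g} \<inter> space M =
      (D \<inter> {x\<in>space M. act (inv g) x \<in> F}) \<union> (if g = \<one> then space M - D else {})"
    by blast
  moreover have "(if g = \<one> then space M - D else {}) \<in> sets M" using D by simp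
  ultimately show "domain_position F -` {g} \<inter> space M \<in> sets M"
    by (simp only: sets.Un sets.Int D translate[OF g])
qed (use domain_position_closed in blast)

lemma domain_position_equivariant:
  assumes unique: "\<exists>!g. g \<in> carrier G \<and> act (inv g) x \<in> F" and x: "x \<in> space M"
    and g: "g \<in> carrier G"
  shows "domain_position F (act g x) = g \<otimes> domain_position F x"
proof -
  have shift: "act (inv h) (act g x) = act (inv (inv g \<otimes> h)) x" if "h \<in> carrier G" for h
    using that g x by (simp add: inv_mult_group act_mult)
  let ?p = "domain_position F x"
  have p: "?p \<in> carrier G" "act (inv ?p) x \<in> F" using domain_position_eq_iff[OF unique] by blast+
  then have "act (inv (g \<otimes> ?p)) (act g x) \<in> F"
    using shift[of "g \<otimes> ?p"] g by (simp add: m_assoc[symmetric])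
  moreover have "h = g \<otimes> ?p" if h: "h \<in> carrier G" "act (inv h) (act g x) \<in> F" for h
  proof -
    have "?p = inv g \<otimes> h" using domain_position_eq_iff[OF unique] shift[OF h(1)] h g by simp
    then show ?thesis using g h(1) by (simp add: m_assoc[symmetric])
  qed
  ultimately have "\<exists>!h. h \<in> carrier G \<and> act (inv h) (act g x) \<in> F" using g p(1) by blast
  from domain_position_eq_iff[OF this] show ?thesis
    using \<open>act (inv (g \<otimes> ?p)) (act g x) \<in> F\<close> g p(1) by blast
qed

end

lemma (in cdf_distribution) cdf_pseudoinverse:
  assumes atomless: "\<And>x. measure M {x} = 0" and t: "0 < t" "t < 1"
  shows "cdf M (Inf {x. t \<le> cdf M x}) = t"
proof (rule antisym)
  let ?q = "Inf {x. t \<le> cdf M x}"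
  have q: "t \<le> cdf M x \<longleftrightarrow> ?q \<le> x" for x using t by (rule pseudoinverse)
  then show "t \<le> cdf M ?q" by blast
  have "eventually (\<lambda>x. cdf M x \<le> t) (at_left ?q)"
    unfolding eventually_at_left_field
  proof (intro exI[of _ "?q - 1"] conjI allI impI)
    fix y assume "y < ?q"
    then show "cdf M y \<le> t" using q[of y] by linarith
  qed simp
  moreover have "(cdf M \<longlongrightarrow> cdf M ?q) (at_left ?q)"
    using atomless isCont_cdf[of ?q] by (simp add: isCont_def filterlim_at_split)
  ultimately show "cdf M ?q \<le> t" by (intro tendsto_upperbound) auto
qed

lemma distr_open_unit_interval:
  "distr (restrict_space lborel {0<..<1}) unit_interval (\<lambda>t. t) = unit_interval"
proof (rule measure_eqI)
  let ?\<Omega> = "restrict_space lborel {0<..<1::real}"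
  fix B assume "B \<in> sets (distr ?\<Omega> unit_interval (\<lambda>t. t))"
  then have B: "B \<in> sets unit_interval" "B \<in> sets borel" "B \<subseteq> {0..1}"
    by (auto simp: sets_restrict_space_iff)
  have "(\<lambda>t. t) \<in> measurable ?\<Omega> unit_interval"
    by (intro measurable_restrict_space2 measurable_restrict_space1)
      (auto simp: space_restrict_space)
  then have "emeasure (distr ?\<Omega> unit_interval (\<lambda>t. t)) B = emeasure lborel (B \<inter> {0<..<1})"
    using B by (simp add: emeasure_distr space_restrict_space emeasure_restrict_space)
  also have "\<dots> = emeasure lborel ((B \<inter> {0<..<1}) \<union> (B \<inter> {0, 1}))"
    using B by (intro emeasure_Un_null_set[symmetric]) (auto intro: countable_imp_null_set_lborel)
  also have "(B \<inter> {0<..<1}) \<union> (B \<inter> {0, 1}) = B" using B(3) by force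
  finally show "emeasure (distr ?\<Omega> unit_interval (\<lambda>t. t)) B = emeasure unit_interval B"
    using B by (simp add: emeasure_restrict_space)
qed simp

lemma distr_cdf_atomless:
  assumes "real_distribution L" and atomless: "\<And>x. measure L {x} = 0"
  shows "distr L unit_interval (cdf L) = unit_interval"
proof -
  interpret real_distribution L by fact
  interpret cdf_distribution L ..
  let ?\<Omega> = "restrict_space lborel {0<..<1::real}"
  define q where "q t = Inf {x. t \<le> cdf L x}" for t
  have q: "distr ?\<Omega> borel q = L" unfolding q_def by (rule distr_I_eq_M)
  have q_meas: "q \<in> borel_measurable ?\<Omega>"
    using measurable_CI
    by (simp add: q_def[abs_def] measurable_def space_restrict_space sets_restrict_space)
  have cdf_meas: "cdf L \<in> measurable borel unit_interval"
    using cdf_nonneg cdf_bounded_prob by (intro measurable_restrict_space2) auto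
  have "distr L unit_interval (cdf L) = distr ?\<Omega> unit_interval (cdf L \<circ> q)"
    using distr_distr[OF cdf_meas q_meas] q by simp
  also have "\<dots> = distr ?\<Omega> unit_interval (\<lambda>t. t)"
    using cdf_pseudoinverse[OF atomless]
    by (intro distr_cong) (auto simp: q_def space_restrict_space)
  also have "\<dots> = unit_interval" by (rule distr_open_unit_interval)
  finally show ?thesis .
qed

theorem (in measure_preserving_action) ms_eq_ms_group_interval:
  assumes fin: "finite (carrier G)" and F: "fundamental_domain F"
    and f: "f \<in> borel_measurable M"
        "\<And>g x. g \<in> carrier G \<Longrightarrow> x \<in> space M \<Longrightarrow> f (act g x) = (f x :: real)"
    and atomless: "\<And>s. prob {x\<in>space M. f x = s} = 0" and r: "r \<ge> 1"
  shows "ms M G act r = ms_group_interval G r"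
proof (rule antisym)
  have \<eta>: "domain_position F \<in> measurable M (count_space (carrier G))"
    using fin F by (simp add: measurable_domain_position fundamental_domain_def)
  have equivariant: "AE x in M. \<forall>g\<in>carrier G. domain_position F (act g x) = g \<otimes> domain_position F x"
    using conjunct2[OF F[unfolded fundamental_domain_def]] AE_space
    by eventually_elim (simp add: domain_position_equivariant)
  define L where "L = distr M borel f"
  have L: "real_distribution L" unfolding L_def using f(1) by (rule real_distribution_distr)
  interpret L: real_distribution L by (rule L)
  define T where "T x = cdf L (f x)" for x
  have "cdf L \<in> borel_measurable borel" by (intro borel_measurable_mono monoI L.cdf_nondecreasing)
  then have cdf_meas: "cdf L \<in> measurable borel unit_interval"
    using L.cdf_nonneg L.cdf_bounded_prob by (intro measurable_restrict_space2) auto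
  have T: "T \<in> measurable M unit_interval" unfolding T_def
    using f(1) cdf_meas by (rule measurable_compose)
  have "measure L {s} = 0" for s
    using atomless[of s] f(1) by (simp add: L_def measure_distr vimage_def Int_def conj_commute)
  then have "distr L unit_interval (cdf L) = unit_interval" by (intro distr_cdf_atomless[OF L])
  then have T_law: "distr M unit_interval T = unit_interval"
    using distr_distr[OF cdf_meas f(1)] by (simp add: L_def T_def[abs_def] comp_def)
  have T_inv: "T (act g x) = T x" if "g \<in> carrier G" "x \<in> space M" for g x
    using f(2)[OF that] by (simp add: T_def)
  show "ms M G act r \<le> ms_group_interval G r"
    unfolding ms_group_interval_def
  proof (rule ms_le_factor[OF measure_preserving_action_axioms _ r,
      where \<psi> = "\<lambda>g. g" and \<theta> = "\<lambda>x. (domain_position F x, T x)"])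
    show "measure_preserving_action (group_interval G) G (\<lambda>g (h, t). (g \<otimes> h, t))"
      using group_axioms fin by (rule measure_preserving_action_group_interval)
    show "(\<lambda>x. (domain_position F x, T x)) \<in> measurable M (group_interval G)"
      using \<eta> T
      by (intro measurable_Pair) (simp_all cong: measurable_cong_sets add: sets_uniform_count_measure_count_space)
    show "distr M (group_interval G) (\<lambda>x. (domain_position F x, T x)) = group_interval G"
      using distr_equivariant_invariant[OF fin \<eta> equivariant T T_inv] by (simp add: T_law)
    show "AE x in M. \<forall>g\<in>carrier G. (domain_position F (act g x), T (act g x)) =
        (case (domain_position F x, T x) of (h, t) \<Rightarrow> (g \<otimes> h, t))"
      using equivariant AE_space by eventually_elim (simp add: T_inv)
  qed (auto simp: hom_def)
  show "ms_group_interval G r \<le> ms M G act r" using fin r by (rule ms_group_interval_le)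
qed

section \<open>Isometries and Lebesgue measure\<close>

definition isometry :: "('a::metric_space \<Rightarrow> 'b::metric_space) \<Rightarrow> bool" where
  "isometry f \<longleftrightarrow> (\<forall>x y. dist (f x) (f y) = dist x y)"

lemma isometryD: "isometry f \<Longrightarrow> dist (f x) (f y) = dist x y"
  by (simp add: isometry_def)

lemma isometry_inj: "isometry f \<Longrightarrow> inj f"
  by (rule injI) (metis dist_eq_0_iff isometryD)

lemma isometry_inv: "isometry f \<Longrightarrow> surj f \<Longrightarrow> isometry (inv_into UNIV f)"
  unfolding isometry_def by (metis surj_f_inv_f)

lemma isometry_compose: "isometry f \<Longrightarrow> isometry g \<Longrightarrow> isometry (g \<circ> f)"
  by (simp add: isometry_def)

lemma continuous_on_isometry: "isometry f \<Longrightarrow> continuous_on A f"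
  unfolding continuous_on_iff by (auto simp: isometry_def)

lemma borel_measurable_isometry: "isometry f \<Longrightarrow> f \<in> borel_measurable borel"
  by (intro borel_measurable_continuous_onI continuous_on_isometry)

lemma isometry_linear_part:
  fixes f :: "'a::real_inner \<Rightarrow> 'b::real_inner"
  assumes "isometry f"
  obtains L where "linear L" "\<And>x. L x = f x - f 0"
proof -
  define L where "L x = f x - f 0" for x
  have "norm (L x) = norm x" "norm (L x - L y) = norm (x - y)" for x y
    using isometryD[OF assms, of x 0] isometryD[OF assms, of x y] by (simp_all add: L_def dist_norm)
  then have inner: "L x \<bullet> L y = x \<bullet> y" for x y by (simp add: dot_norm_neg)
  have "linear L"
  proof (rule linearI)
    fix x y
    have "(L (x + y) - (L x + L y)) \<bullet> (L (x + y) - (L x + L y)) = 0"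
      by (simp add: inner_simps inner)
    then show "L (x + y) = L x + L y" by simp
  next
    fix c x
    have "(L (c *\<^sub>R x) - c *\<^sub>R L x) \<bullet> (L (c *\<^sub>R x) - c *\<^sub>R L x) = 0"
      by (simp add: inner_simps inner)
    then show "L (c *\<^sub>R x) = c *\<^sub>R L x" by simp
  qed
  then show ?thesis using that by (simp add: L_def)
qed

lemma DIM_eq_isometry:
  fixes f :: "'a::euclidean_space \<Rightarrow> 'b::euclidean_space"
  assumes "isometry f" "surj f"
  shows "DIM('a) = DIM('b)"
proof -
  obtain L where L: "linear L" "\<And>x. L x = f x - f 0"
    using isometry_linear_part[OF assms(1)] by blast
  have "inj L" using isometry_inj[OF assms(1)] by (auto simp: inj_def L(2))
  moreover have "range L = UNIV"
  proof -
    have "\<exists>x. y = L x" for y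
    proof -
      obtain x where "y + f 0 = f x" using assms(2) by (metis surjD)
      then show ?thesis by (intro exI[of _ x]) (simp add: L(2) eq_diff_eq)
    qed
    then show ?thesis by auto
  qed
  ultimately show ?thesis using dim_image_eq[OF L(1), of UNIV] by simp
qed

lemma nn_integral_translate:
  fixes \<mu> :: "'a::euclidean_space measure"
  assumes sets: "sets \<mu> = sets borel" and invariant: "distr \<mu> borel ((+) a) = \<mu>"
    and [measurable]: "f \<in> borel_measurable borel"
  shows "(\<integral>\<^sup>+x. f x \<partial>\<mu>) = (\<integral>\<^sup>+x. f (a + x) \<partial>\<mu>)"
proof -
  note sets[measurable_cong]
  show ?thesis by (subst invariant[symmetric], subst nn_integral_distr) auto
qed

lemma lborel_unique_translation_invariant:
  fixes \<mu> :: "'a::euclidean_space measure"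
  assumes sets: "sets \<mu> = sets borel" and "sigma_finite_measure \<mu>"
    and invariant: "\<And>a. distr \<mu> borel ((+) a) = \<mu>"
    and ball: "emeasure \<mu> (ball 0 1) = emeasure lborel (ball (0::'a) 1)"
  shows "\<mu> = lborel"
proof (rule measure_eqI)
  interpret \<mu>: sigma_finite_measure \<mu> by fact
  interpret pair_sigma_finite \<mu> "lborel :: 'a measure" ..
  note sets[measurable_cong]
  have space: "space \<mu> = UNIV" using sets_eq_imp_space_eq[OF sets] by simp
  note shift = nn_integral_translate[OF sets invariant]
  let ?B = "ball (0::'a) 1"
  have [measurable]: "?B \<in> sets borel" by simp
  have ball_shift: "(\<integral>\<^sup>+x. indicator ?B (y - x) \<partial>\<mu>) = emeasure lborel ?B" for y
  proof -
    have "(\<integral>\<^sup>+x. indicator ?B (y - x) \<partial>\<mu>) = (\<integral>\<^sup>+x. indicator ?B (y - (y + x)) \<partial>\<mu>)"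
      by (rule shift) measurable
    also have "\<dots> = (\<integral>\<^sup>+x. indicator ?B x \<partial>\<mu>)" by (intro nn_integral_cong) (auto simp: indicator_def)
    finally show ?thesis using ball by (simp add: sets)
  qed
  fix A assume "A \<in> sets \<mu>"
  then have A[measurable]: "A \<in> sets borel" by (simp add: sets)
  have "emeasure \<mu> A * emeasure lborel ?B = (\<integral>\<^sup>+y. (\<integral>\<^sup>+x. indicator ?B y * indicator A x \<partial>\<mu>) \<partial>lborel)"
    by (simp add: sets nn_integral_cmult nn_integral_multc) (rule mult.commute)
  also have "\<dots> = (\<integral>\<^sup>+y. (\<integral>\<^sup>+x. indicator ?B y * indicator A (y + x) \<partial>\<mu>) \<partial>lborel)"
  proof (rule nn_integral_cong)
    fix y
    show "(\<integral>\<^sup>+x. indicator ?B y * indicator A x \<partial>\<mu>) = (\<integral>\<^sup>+x. indicator ?B y * indicator A (y + x) \<partial>\<mu>)"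
      by (rule shift) measurable
  qed
  also have "\<dots> = (\<integral>\<^sup>+x. (\<integral>\<^sup>+y. indicator ?B y * indicator A (y + x) \<partial>lborel) \<partial>\<mu>)"
    by (rule Fubini') measurable
  also have "\<dots> = (\<integral>\<^sup>+x. (\<integral>\<^sup>+y. indicator ?B (y - x) * indicator A y \<partial>lborel) \<partial>\<mu>)"
  proof (rule nn_integral_cong)
    fix x
    show "(\<integral>\<^sup>+y. indicator ?B y * indicator A (y + x) \<partial>lborel) =
        (\<integral>\<^sup>+y. indicator ?B (y - x) * indicator A y \<partial>lborel)"
      by (subst nn_integral_translate[of lborel x "\<lambda>y. indicator ?B (y - x) * indicator A y"])
        (auto simp: lborel_distr_plus add.commute)
  qed
  also have "\<dots> = (\<integral>\<^sup>+y. (\<integral>\<^sup>+x. indicator ?B (y - x) * indicator A y \<partial>\<mu>) \<partial>lborel)"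
    by (rule Fubini'[symmetric]) measurable
  also have "\<dots> = emeasure lborel A * emeasure lborel ?B"
    by (simp add: nn_integral_multc ball_shift nn_integral_cmult mult.commute)
  finally have "emeasure \<mu> A * emeasure lborel ?B = emeasure lborel A * emeasure lborel ?B" .
  moreover have "emeasure lborel ?B \<noteq> 0" "emeasure lborel ?B \<noteq> \<infinity>"
    using unit_ball_vol_pos[of "DIM('a)"] by (auto simp: emeasure_ball simp del: unit_ball_vol_pos)
  ultimately show "emeasure \<mu> A = emeasure lborel A"
    by (metis ennreal_mult_divide_eq infinity_ennreal_def)
qed (simp add: sets)

lemma distr_lborel_isometry:
  fixes f :: "'a::euclidean_space \<Rightarrow> 'b::euclidean_space"
  assumes f: "isometry f" "surj f"
  shows "distr lborel borel f = lborel"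
proof (rule lborel_unique_translation_invariant)
  have f_meas[measurable]: "f \<in> borel_measurable borel"
    using f(1) by (rule borel_measurable_isometry)
  have inv_meas[measurable]: "inv_into UNIV f \<in> borel_measurable borel"
    using isometry_inv[OF f] by (rule borel_measurable_isometry)
  have "distr (distr lborel borel f) borel (inv_into UNIV f) = distr lborel borel (\<lambda>x. x)"
    using isometry_inj[OF f(1)] by (subst distr_distr) (auto simp: comp_def)
  then have "distr (distr lborel borel f) borel (inv_into UNIV f) = lborel" by (simp add: distr_id2)
  then show "sigma_finite_measure (distr lborel borel f)"
    by (intro sigma_finite_measure_distr[where f = "inv_into UNIV f" and N = borel])
      (simp_all add: sigma_finite_lborel)
  show "distr (distr lborel borel f) borel ((+) a) = distr lborel borel f" for a
  proof -
    obtain L where L: "linear L" "\<And>x. L x = f x - f 0" using isometry_linear_part[OF f(1)] by blast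
    obtain b where b: "f b = a + f 0" using f(2) by (metis surjD)
    have "a + f x = f (b + x)" for x
      using linear_add[OF L(1), of b x] by (simp add: L(2) b)
    then have "(+) a \<circ> f = f \<circ> (+) b" by auto
    then have "distr (distr lborel borel f) borel ((+) a) =
        distr (distr lborel borel ((+) b)) borel f"
      by (subst (1 2) distr_distr) auto
    then show ?thesis by (simp add: lborel_distr_plus)
  qed
  obtain z where "f z = 0" using f(2) by (metis surjD)
  then have "f -` ball 0 1 = ball z 1" using isometryD[OF f(1), of z] by auto
  then have "emeasure (distr lborel borel f) (ball 0 1) = emeasure lborel (ball z 1)"
    by (simp add: emeasure_distr)
  also have "\<dots> = emeasure lborel (ball (0::'b) 1)"
    using DIM_eq_isometry[OF f] by (simp add: emeasure_ball)
  finally show "emeasure (distr lborel borel f) (ball 0 1) = emeasure lborel (ball (0::'b) 1)" .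
qed simp

lemma emeasure_normalized_lebesgue:
  assumes "X \<in> sets borel" "A \<in> sets borel" "A \<subseteq> X"
  shows "emeasure (normalized_lebesgue X) A = emeasure lborel A / emeasure lborel X"
proof -
  have "emeasure (normalized_lebesgue X) A = emeasure (uniform_measure lborel X) A"
    unfolding normalized_lebesgue_def using assms by (intro emeasure_restrict_space) auto
  also have "\<dots> = emeasure lborel (X \<inter> A) / emeasure lborel X" using assms by simp
  finally show ?thesis using assms by (simp add: Int_absorb1)
qed

lemma space_normalized_lebesgue [simp]: "space (normalized_lebesgue X) = X"
  by (simp add: normalized_lebesgue_def space_restrict_space)

lemma measurable_normalized_lebesgue_borel:
  assumes "f \<in> measurable borel N"
  shows "f \<in> measurable (normalized_lebesgue X) N"
proof -
  have "measurable (uniform_measure lborel X) N = measurable borel N"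
    by (intro measurable_cong_sets) simp_all
  then show ?thesis unfolding normalized_lebesgue_def
    using assms by (intro measurable_restrict_space1) simp
qed

lemma prob_space_normalized_lebesgue:
  assumes "compact X" "measure lborel X > 0"
  shows "prob_space (normalized_lebesgue X)"
proof (rule prob_spaceI)
  have X: "X \<in> sets borel" using assms by (simp add: borel_compact)
  have "emeasure lborel X \<noteq> 0" "emeasure lborel X \<noteq> \<infinity>"
    using assms(2) emeasure_compact_finite[OF assms(1)] by (auto simp: measure_def)
  then show "emeasure (normalized_lebesgue X) (space (normalized_lebesgue X)) = 1"
    using emeasure_normalized_lebesgue[OF X X]
    by (simp add: ennreal_divide_self top.not_eq_extremum)
qed

lemma measure_normalized_lebesgue_negligible:
  assumes "X \<in> sets borel" "A \<in> sets (normalized_lebesgue X)" "negligible N" "A \<subseteq> N"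
  shows "measure (normalized_lebesgue X) A = 0"
proof -
  have A: "A \<in> sets borel" "A \<subseteq> X" using assms by (auto simp: sets_normalized_lebesgue)
  have "negligible A" using assms negligible_subset by blast
  then have "emeasure lebesgue A = 0" by (simp add: negligible_iff_null_sets null_sets_def)
  then show ?thesis
    using A emeasure_normalized_lebesgue[OF assms(1) A] by (simp add: measure_def)
qed

lemma normalized_lebesgue_isometry:
  fixes T :: "'a::euclidean_space \<Rightarrow> 'b::euclidean_space"
  assumes T: "isometry T" "surj T" and X: "X \<in> sets borel" "T ` X \<in> sets borel"
  shows "T \<in> measurable (normalized_lebesgue X) (normalized_lebesgue (T ` X))"
    and "distr (normalized_lebesgue X) (normalized_lebesgue (T ` X)) T =
        normalized_lebesgue (T ` X)"
proof -
  have T_meas: "T \<in> borel_measurable borel" using T(1) by (rule borel_measurable_isometry)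
  have vimage: "T -` A \<in> sets borel" "T -` A \<subseteq> X" "emeasure lborel (T -` A) = emeasure lborel A"
    if A: "A \<in> sets borel" "A \<subseteq> T ` X" for A
  proof -
    show "T -` A \<in> sets borel" using measurable_sets[OF T_meas A(1)] by simp
    show "T -` A \<subseteq> X" using A(2) isometry_inj[OF T(1)] by (auto dest: injD)
    show "emeasure lborel (T -` A) = emeasure lborel A"
      using emeasure_distr[of T lborel borel A] T_meas A(1)
      by (simp add: distr_lborel_isometry[OF T])
  qed
  have "T -` A \<inter> X \<in> sets (normalized_lebesgue X)" if "A \<in> sets (normalized_lebesgue (T ` X))" for A
    using vimage[of A] that X by (auto simp: sets_normalized_lebesgue)
  then show T_meas': "T \<in> measurable (normalized_lebesgue X) (normalized_lebesgue (T ` X))"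
    by (intro measurableI) auto
  show "distr (normalized_lebesgue X) (normalized_lebesgue (T ` X)) T = normalized_lebesgue (T ` X)"
  proof (rule measure_eqI)
    fix A assume A': "A \<in> sets (distr (normalized_lebesgue X) (normalized_lebesgue (T ` X)) T)"
    then have A: "A \<in> sets borel" "A \<subseteq> T ` X" using X by (simp_all add: sets_normalized_lebesgue)
    have "emeasure lborel X = emeasure lborel (T ` X)"
      using vimage(3)[OF X(2) order_refl] isometry_inj[OF T(1)] by (simp add: inj_vimage_image_eq)
    then show "emeasure (distr (normalized_lebesgue X) (normalized_lebesgue (T ` X)) T) A =
        emeasure (normalized_lebesgue (T ` X)) A"
      using A' T_meas' X A vimage[OF A]
      by (simp add: emeasure_distr emeasure_normalized_lebesgue Int_absorb2)
  qed simp
qed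

section \<open>The symmetry group of a compact set\<close>

lemma Iso_mult_one [simp]: "f \<otimes>\<^bsub>Iso X\<^esub> g = f \<circ> g" "\<one>\<^bsub>Iso X\<^esub> = id"
  by (simp_all add: Iso_def)

lemma carrier_Iso: "f \<in> carrier (Iso X) \<longleftrightarrow> surj f \<and> isometry f \<and> f ` X = X"
  using isometry_inj[of f] by (auto simp: Iso_def isometry_def bij_def)

lemma Iso_mem: "f \<in> carrier (Iso X) \<Longrightarrow> x \<in> X \<Longrightarrow> f x \<in> X"
  by (auto simp: carrier_Iso)

lemma Iso_comp: "f \<in> carrier (Iso X) \<Longrightarrow> g \<in> carrier (Iso X) \<Longrightarrow> f \<circ> g \<in> carrier (Iso X)"
  using group.is_monoid[OF group_Iso, THEN monoid.m_closed, of f X g] by simp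

lemma Iso_inv:
  assumes f: "f \<in> carrier (Iso X)"
  shows "inv_into UNIV f \<in> carrier (Iso X)" "inv\<^bsub>Iso X\<^esub> f = inv_into UNIV f"
proof -
  interpret group "Iso X" by (rule group_Iso)
  have "inv\<^bsub>Iso X\<^esub> f \<circ> f = id" using l_inv[OF f] by simp
  then show "inv\<^bsub>Iso X\<^esub> f = inv_into UNIV f"
    using f isometry_inj[of f] by (intro ext) (metis carrier_Iso comp_apply id_apply surj_f_inv_f)
  then show "inv_into UNIV f \<in> carrier (Iso X)" using inv_closed[OF f] by simp
qed

lemma measure_preserving_action_Iso:
  fixes X :: "'a::euclidean_space set"
  assumes X: "compact X" "measure lborel X > 0"
  shows "measure_preserving_action (normalized_lebesgue X) (Iso X) (\<lambda>f x. f x)"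
proof -
  have "X \<in> sets borel" using X by (simp add: borel_compact)
  then have "f \<in> measurable (normalized_lebesgue X) (normalized_lebesgue X)"
    "distr (normalized_lebesgue X) (normalized_lebesgue X) f = normalized_lebesgue X"
    if "f \<in> carrier (Iso X)" for f
    using normalized_lebesgue_isometry[of f X] that by (simp_all add: carrier_Iso)
  then show ?thesis
    using prob_space_normalized_lebesgue[OF X] group_Iso[of X]
    by (intro measure_preserving_action.intro measure_preserving_action_axioms.intro) auto
qed

lemma Iso_isometry_image:
  assumes T: "isometry T" "surj T"
  shows "(\<lambda>f. T \<circ> f \<circ> inv_into UNIV T) \<in> iso (Iso X) (Iso (T ` X))"
proof (rule isoI)
  have inv_T: "inv_into UNIV T (T x) = x" "T (inv_into UNIV T y) = y" for x y
    using isometry_inj[OF T(1)] T(2) by (simp_all add: surj_f_inv_f)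
  have inv_image: "inv_into UNIV T ` T ` X = X" by (simp add: image_image inv_T)
  have conj_mem: "T \<circ> f \<circ> inv_into UNIV T \<in> carrier (Iso (T ` X))" if "f \<in> carrier (Iso X)" for f
  proof -
    have f: "surj f" "isometry f" "f ` X = X" using that by (simp_all add: carrier_Iso)
    have "surj (T \<circ> f \<circ> inv_into UNIV T)"
      using f(1) T isometry_inj[OF T(1)] by (intro comp_surj) (simp_all add: inj_imp_surj_inv)
    moreover have "isometry (T \<circ> f \<circ> inv_into UNIV T)"
      using f(2) T by (intro isometry_compose isometry_inv)
    moreover have "(T \<circ> f \<circ> inv_into UNIV T) ` T ` X = T ` X"
      using f(3) inv_image by (metis image_comp)
    ultimately show ?thesis by (simp add: carrier_Iso)
  qed
  then show "(\<lambda>f. T \<circ> f \<circ> inv_into UNIV T) \<in> hom (Iso X) (Iso (T ` X))"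
    by (intro homI) (auto simp: fun_eq_iff inv_T)
  have conj_mem': "inv_into UNIV T \<circ> g \<circ> T \<in> carrier (Iso X)" if "g \<in> carrier (Iso (T ` X))" for g
  proof -
    have g: "surj g" "isometry g" "g ` T ` X = T ` X" using that by (simp_all add: carrier_Iso)
    have "surj (inv_into UNIV T \<circ> g \<circ> T)"
      using g(1) T isometry_inj[OF T(1)] by (intro comp_surj) (simp_all add: inj_imp_surj_inv)
    moreover have "isometry (inv_into UNIV T \<circ> g \<circ> T)"
      using g(2) T by (intro isometry_compose isometry_inv)
    moreover have "(inv_into UNIV T \<circ> g \<circ> T) ` X = X"
      using g(3) inv_image by (metis image_comp)
    ultimately show ?thesis by (simp add: carrier_Iso)
  qed
  show "bij_betw (\<lambda>f. T \<circ> f \<circ> inv_into UNIV T) (carrier (Iso X)) (carrier (Iso (T ` X)))"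
    by (rule bij_betw_byWitness[where f' = "\<lambda>g. inv_into UNIV T \<circ> g \<circ> T"])
      (auto simp: fun_eq_iff inv_T intro: conj_mem conj_mem')
qed

lemma measure_lborel_isometry_image:
  fixes T :: "'a::euclidean_space \<Rightarrow> 'b::euclidean_space"
  assumes T: "isometry T" "surj T" and "compact X"
  shows "measure lborel (T ` X) = measure lborel X"
proof -
  have "compact (T ` X)" using assms by (intro compact_continuous_image continuous_on_isometry)
  then have "T ` X \<in> sets borel" by (rule borel_compact)
  then have "measure (distr lborel borel T) (T ` X) = measure lborel (T -` T ` X)"
    using borel_measurable_isometry[OF T(1)] by (simp add: measure_distr)
  then show ?thesis
    using isometry_inj[OF T(1)] by (simp add: distr_lborel_isometry[OF T] inj_vimage_image_eq)
qed

lemma ms_set_le_isometry_image: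
  fixes T :: "'a::euclidean_space \<Rightarrow> 'b::euclidean_space"
  assumes T: "isometry T" "surj T" and X: "compact X" "measure lborel X > 0" and r: "r \<ge> 1"
  shows "ms_set X r \<le> ms_set (T ` X) r"
  unfolding ms_set_def
proof (rule ms_le_factor[OF _ _ r, where \<psi> = "\<lambda>f. T \<circ> f \<circ> inv_into UNIV T" and \<theta> = T])
  have TX: "compact (T ` X)" using T X by (intro compact_continuous_image continuous_on_isometry)
  show "measure_preserving_action (normalized_lebesgue X) (Iso X) (\<lambda>f x. f x)"
    using X by (rule measure_preserving_action_Iso)
  show "measure_preserving_action (normalized_lebesgue (T ` X)) (Iso (T ` X)) (\<lambda>f x. f x)"
    using TX X(2)
    by (intro measure_preserving_action_Iso) (simp_all add: measure_lborel_isometry_image[OF T X(1)])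
  show "T \<in> measurable (normalized_lebesgue X) (normalized_lebesgue (T ` X))"
    "distr (normalized_lebesgue X) (normalized_lebesgue (T ` X)) T = normalized_lebesgue (T ` X)"
    using normalized_lebesgue_isometry[OF T] X TX by (simp_all add: borel_compact)
  show "(\<lambda>f. T \<circ> f \<circ> inv_into UNIV T) \<in> hom (Iso X) (Iso (T ` X))"
    using Iso_isometry_image[OF T] by (simp add: iso_def)
  show "f = \<one>\<^bsub>Iso X\<^esub>" if "T \<circ> f \<circ> inv_into UNIV T = \<one>\<^bsub>Iso (T ` X)\<^esub>" for f
  proof -
    have "T (f (inv_into UNIV T (T x))) = T x" for x using that by (simp add: fun_eq_iff)
    then show ?thesis using isometry_inj[OF T(1)] by (auto simp: fun_eq_iff inj_eq)
  qed
  show "AE x in normalized_lebesgue X. \<forall>f\<in>carrier (Iso X). T (f x) =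
      (T \<circ> f \<circ> inv_into UNIV T) (T x)"
    using isometry_inj[OF T(1)] by simp
qed

lemma ms_set_isometry_image:
  fixes T :: "'a::euclidean_space \<Rightarrow> 'b::euclidean_space"
  assumes T: "isometry T" "surj T" and X: "compact X" "measure lborel X > 0" and r: "r \<ge> 1"
  shows "ms_set (T ` X) r = ms_set X r"
proof (rule antisym)
  have "compact (T ` X)" using T X by (intro compact_continuous_image continuous_on_isometry)
  moreover have "surj (inv_into UNIV T)" using isometry_inj[OF T(1)] by (rule inj_imp_surj_inv)
  ultimately have "ms_set (T ` X) r \<le> ms_set (inv_into UNIV T ` T ` X) r"
    using T X r
    by (intro ms_set_le_isometry_image isometry_inv) (simp_all add: measure_lborel_isometry_image)
  also have "inv_into UNIV T ` T ` X = X" using isometry_inj[OF T(1)] by (rule image_inv_f_f)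
  finally show "ms_set (T ` X) r \<le> ms_set X r" .
qed (use assms in \<open>rule ms_set_le_isometry_image\<close>)

definition centroid :: "'a::euclidean_space set \<Rightarrow> 'a" where
  "centroid X = (\<integral>x. x \<partial>normalized_lebesgue X)"

lemma integrable_normalized_lebesgue_id:
  fixes X :: "'a::euclidean_space set"
  assumes "compact X" "measure lborel X > 0"
  shows "integrable (normalized_lebesgue X) (\<lambda>x. x)"
proof -
  interpret prob_space "normalized_lebesgue X" using assms by (rule prob_space_normalized_lebesgue)
  obtain b where "\<forall>x\<in>X. norm x \<le> b" using compact_imp_bounded[OF assms(1)]
    unfolding bounded_iff by blast
  moreover have "(\<lambda>x. x) \<in> borel_measurable (normalized_lebesgue X)"
    by (rule measurable_normalized_lebesgue_borel) simp
  ultimately show ?thesis by (intro integrable_const_bound[of _ b]) (auto intro: AE_I2)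
qed

lemma Iso_fixes_centroid:
  fixes X :: "'a::euclidean_space set"
  assumes X: "compact X" "measure lborel X > 0" and f: "f \<in> carrier (Iso X)"
  shows "f (centroid X) = centroid X"
proof -
  let ?M = "normalized_lebesgue X"
  interpret measure_preserving_action ?M "Iso X" "\<lambda>f x. f x"
    using X by (rule measure_preserving_action_Iso)
  have "isometry f" using f by (simp add: carrier_Iso)
  then obtain L where L: "linear L" "\<And>x. L x = f x - f 0" using isometry_linear_part by blast
  have L': "bounded_linear L" using L(1) by (simp add: linear_conv_bounded_linear)
  note int = integrable_normalized_lebesgue_id[OF X]
  have "centroid X = (\<integral>x. x \<partial>distr ?M ?M f)" using distr_act[OF f] by (simp add: centroid_def)
  also have "\<dots> = (\<integral>x. f x \<partial>?M)"
    by (rule integral_distr[OF act_measurable[OF f] measurable_normalized_lebesgue_borel]) simp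
  also have "\<dots> = (\<integral>x. L x + f 0 \<partial>?M)" by (simp add: L(2))
  also have "\<dots> = (\<integral>x. L x \<partial>?M) + f 0"
    using integrable_bounded_linear[OF L' int] prob_space by simp
  also have "\<dots> = L (centroid X) + f 0"
    using integral_bounded_linear[OF L' int] by (simp add: centroid_def)
  finally show ?thesis by (simp add: L(2))
qed

lemma negligible_bisector:
  fixes a b :: "'a::euclidean_space"
  assumes "a \<noteq> b"
  shows "negligible {x. dist x a = dist x b}"
proof -
  have "dist x a = dist x b \<longleftrightarrow> (2 *\<^sub>R (b - a)) \<bullet> x = b \<bullet> b - a \<bullet> a" for x
  proof -
    have "dist x a = dist x b \<longleftrightarrow> (x - a) \<bullet> (x - a) = (x - b) \<bullet> (x - b)"
      by (simp add: dist_norm norm_eq_sqrt_inner)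
    also have "\<dots> \<longleftrightarrow> (2 *\<^sub>R (b - a)) \<bullet> x = b \<bullet> b - a \<bullet> a"
      by (simp add: inner_diff_left inner_diff_right inner_commute algebra_simps)
    finally show ?thesis .
  qed
  then show ?thesis using assms negligible_hyperplane[of "2 *\<^sub>R (b - a)"] by simp
qed

lemma negligible_coincidence_isometry:
  fixes f g :: "'a::euclidean_space \<Rightarrow> 'a"
  assumes f: "isometry f" "surj f" and g: "isometry g" and "f \<noteq> g"
  shows "negligible {x. f x = g x}"
proof -
  obtain q where q: "f q \<noteq> g q" using \<open>f \<noteq> g\<close> by auto
  define q' where "q' = inv_into UNIV f (g q)"
  have q': "f q' = g q" using f(2) by (simp add: q'_def surj_f_inv_f)
  have "{x. f x = g x} \<subseteq> {x. dist x q = dist x q'}"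
  proof safe
    fix x assume "f x = g x"
    then show "dist x q = dist x q'"
      using isometryD[OF f(1), of x q'] isometryD[OF g, of x q] q' by simp
  qed
  moreover have "q \<noteq> q'" using q q' by auto
  ultimately show ?thesis by (intro negligible_subset[OF negligible_bisector])
qed

lemma finite_Iso_generic_point:
  fixes X :: "'a::euclidean_space set"
  assumes "finite (carrier (Iso X))"
  obtains p where "inj_on (\<lambda>f. f p) (carrier (Iso X))"
proof -
  let ?G = "carrier (Iso X)"
  have "negligible {x. f x = g x}" if "f \<in> ?G" "g \<in> ?G" "f \<noteq> g" for f g
    using that by (intro negligible_coincidence_isometry) (auto simp: carrier_Iso)
  then have "negligible (\<Union>f\<in>?G. \<Union>g\<in>?G - {f}. {x. f x = g x})"
    using assms by (auto intro!: negligible_Union)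
  then have "(\<Union>f\<in>?G. \<Union>g\<in>?G - {f}. {x. f x = g x}) \<noteq> UNIV" using non_negligible_UNIV by metis
  then obtain p where "p \<notin> (\<Union>f\<in>?G. \<Union>g\<in>?G - {f}. {x. f x = g x})" by blast
  then have "inj_on (\<lambda>f. f p) ?G" by (auto simp: inj_on_def)
  then show ?thesis by (rule that)
qed

definition dirichlet_cell :: "'a::metric_space set \<Rightarrow> 'a \<Rightarrow> 'a set" where
  "dirichlet_cell X p = {x\<in>X. \<forall>g\<in>carrier (Iso X). g \<noteq> id \<longrightarrow> dist x p < dist x (g p)}"

lemma inv_mem_dirichlet_cell_iff:
  assumes g: "g \<in> carrier (Iso X)" and x: "x \<in> X"
  shows "inv_into UNIV g x \<in> dirichlet_cell X p \<longleftrightarrow>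
      (\<forall>h\<in>carrier (Iso X). h \<noteq> g \<longrightarrow> dist x (g p) < dist x (h p))"
proof -
  have g': "surj g" "isometry g" "inj g" using g isometry_inj by (auto simp: carrier_Iso)
  have dist: "dist (inv_into UNIV g x) y = dist x (g y)" for y
    using isometryD[OF g'(2), of "inv_into UNIV g x" y] g'(1) by (simp add: surj_f_inv_f)
  have "inv_into UNIV g x \<in> dirichlet_cell X p \<longleftrightarrow>
      (\<forall>h\<in>carrier (Iso X). h \<noteq> id \<longrightarrow> dist x (g p) < dist x ((g \<circ> h) p))"
    using Iso_mem[OF Iso_inv(1)[OF g] x] by (simp add: dirichlet_cell_def dist)
  also have "\<dots> \<longleftrightarrow> (\<forall>h\<in>carrier (Iso X). h \<noteq> g \<longrightarrow> dist x (g p) < dist x (h p))"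
  proof
    assume nearest: "\<forall>h\<in>carrier (Iso X). h \<noteq> id \<longrightarrow> dist x (g p) < dist x ((g \<circ> h) p)"
    have "dist x (g p) < dist x (h p)" if h: "h \<in> carrier (Iso X)" "h \<noteq> g" for h
    proof -
      have "g \<circ> (inv_into UNIV g \<circ> h) = h" using g'(1) by (simp add: fun_eq_iff surj_f_inv_f)
      moreover from this have "inv_into UNIV g \<circ> h \<noteq> id" using h(2) by auto
      ultimately show ?thesis using nearest Iso_comp[OF Iso_inv(1)[OF g] h(1)] by metis
    qed
    then show "\<forall>h\<in>carrier (Iso X). h \<noteq> g \<longrightarrow> dist x (g p) < dist x (h p)" by blast
  next
    assume nearest: "\<forall>h\<in>carrier (Iso X). h \<noteq> g \<longrightarrow> dist x (g p) < dist x (h p)"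
    have "g \<circ> h \<noteq> g" if "h \<noteq> id" for h using that g'(3) by (auto simp: fun_eq_iff inj_eq)
    then show "\<forall>h\<in>carrier (Iso X). h \<noteq> id \<longrightarrow> dist x (g p) < dist x ((g \<circ> h) p)"
      using nearest Iso_comp[OF g] by blast
  qed
  finally show ?thesis .
qed

lemma sets_dirichlet_cell:
  fixes X :: "'a::euclidean_space set"
  assumes X: "X \<in> sets borel" and fin: "finite (carrier (Iso X))"
  shows "dirichlet_cell X p \<in> sets (normalized_lebesgue X)"
proof -
  have "{x\<in>space borel. \<forall>g\<in>carrier (Iso X). g \<noteq> id \<longrightarrow> dist x p < dist x (g p)} \<in> sets borel"
    using fin by (intro sets.sets_Collect_finite_All) auto
  then have "X \<inter> {x. \<forall>g\<in>carrier (Iso X). g \<noteq> id \<longrightarrow> dist x p < dist x (g p)} \<in> sets borel"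
    using X by simp
  moreover have "dirichlet_cell X p = X \<inter> {x. \<forall>g\<in>carrier (Iso X). g \<noteq> id \<longrightarrow> dist x p < dist x (g p)}"
    by (auto simp: dirichlet_cell_def)
  ultimately show ?thesis using X by (simp add: sets_normalized_lebesgue)
qed

lemma AE_normalized_lebesgue_distances_distinct:
  fixes X :: "'a::euclidean_space set"
  assumes X: "compact X" "measure lborel X > 0" and fin: "finite P"
  shows "AE x in normalized_lebesgue X. inj_on (dist x) P"
proof -
  interpret prob_space "normalized_lebesgue X" using X by (rule prob_space_normalized_lebesgue)
  have X_borel: "X \<in> sets borel" using X by (simp add: borel_compact)
  define N where "N = (\<Union>a\<in>P. \<Union>b\<in>P - {a}. {x. dist x a = dist x b})"
  have "negligible N" unfolding N_def
    using fin by (auto intro!: negligible_Union negligible_bisector)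
  moreover have "N \<in> sets borel" unfolding N_def using fin by (intro sets.finite_UN) auto
  then have "X \<inter> N \<in> events" using X_borel by (auto simp: sets_normalized_lebesgue)
  ultimately have "X \<inter> N \<in> null_sets (normalized_lebesgue X)"
    using measure_normalized_lebesgue_negligible[OF X_borel, of "X \<inter> N" N]
    by (simp add: null_sets_def emeasure_eq_measure)
  then have "AE x in normalized_lebesgue X. x \<notin> X \<inter> N" by (rule AE_not_in)
  then show ?thesis using AE_space by eventually_elim (auto simp: N_def inj_on_def)
qed

lemma fundamental_domain_dirichlet_cell:
  fixes X :: "'a::euclidean_space set"
  assumes X: "compact X" "measure lborel X > 0" and fin: "finite (carrier (Iso X))"
    and p: "inj_on (\<lambda>f. f p) (carrier (Iso X))"
  shows "measure_preserving_action.fundamental_domain (normalized_lebesgue X) (Iso X) (\<lambda>f x. f x)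
    (dirichlet_cell X p)"
proof -
  let ?G = "carrier (Iso X)"
  interpret measure_preserving_action "normalized_lebesgue X" "Iso X" "\<lambda>f x. f x"
    using X by (rule measure_preserving_action_Iso)
  have "AE x in normalized_lebesgue X. \<exists>!g. g \<in> ?G \<and> (inv\<^bsub>Iso X\<^esub> g) x \<in> dirichlet_cell X p"
    using AE_normalized_lebesgue_distances_distinct[OF X finite_imageI[OF fin, of "\<lambda>f. f p"]]
      AE_space
  proof eventually_elim
    case (elim x)
    have x: "x \<in> X" using elim(2) by simp
    have generic: "f = g" if "f \<in> ?G" "g \<in> ?G" "dist x (f p) = dist x (g p)" for f g
      using inj_onD[OF comp_inj_on[OF p elim(1)], of f g] that by simp
    have "?G \<noteq> {}" using one_closed by blast
    then obtain f where f: "f \<in> ?G" "\<And>g. g \<in> ?G \<Longrightarrow> dist x (f p) \<le> dist x (g p)"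
      using arg_min_if_finite[OF fin, of "\<lambda>f. dist x (f p)"] by (metis linorder_not_less)
    have mem_iff: "(inv\<^bsub>Iso X\<^esub> g) x \<in> dirichlet_cell X p \<longleftrightarrow> g = f" if g: "g \<in> ?G" for g
      unfolding Iso_inv(2)[OF g] inv_mem_dirichlet_cell_iff[OF g x]
      using f generic g by (metis less_le not_less)
    show ?case using f(1) mem_iff by blast
  qed
  then show ?thesis
    using X fin by (simp add: fundamental_domain_def sets_dirichlet_cell borel_compact)
qed

theorem ms_set_eq_ms_group_interval:
  fixes X :: "'a::euclidean_space set"
  assumes X: "compact X" "measure lborel X > 0" and fin: "finite (carrier (Iso X))" and r: "r \<ge> 1"
  shows "ms_set X r = ms_group_interval (Iso X) r"
proof -
  interpret measure_preserving_action "normalized_lebesgue X" "Iso X" "\<lambda>f x. f x"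
    using X by (rule measure_preserving_action_Iso)
  have X_borel: "X \<in> sets borel" using X by (simp add: borel_compact)
  obtain p where p: "inj_on (\<lambda>f. f p) (carrier (Iso X))" using finite_Iso_generic_point[OF fin] .
  define f where "f = dist (centroid X)"
  have f_meas: "f \<in> borel_measurable (normalized_lebesgue X)"
    unfolding f_def by (rule measurable_normalized_lebesgue_borel) simp
  show ?thesis
    unfolding ms_set_def
  proof (rule ms_eq_ms_group_interval[OF fin fundamental_domain_dirichlet_cell[OF X fin p] f_meas _ _ r])
    fix g x assume "g \<in> carrier (Iso X)"
    then show "f (g x) = f x"
      using isometryD[of g "centroid X" x] Iso_fixes_centroid[OF X, of g]
      by (simp add: f_def carrier_Iso)
  next
    fix s
    have "{x\<in>space (normalized_lebesgue X). f x = s} \<in> events" using f_meas by measurable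
    moreover have "{x\<in>space (normalized_lebesgue X). f x = s} \<subseteq> sphere (centroid X) s"
      by (auto simp: f_def)
    ultimately show "prob {x\<in>space (normalized_lebesgue X). f x = s} = 0"
      using measure_normalized_lebesgue_negligible[OF X_borel] negligible_sphere by blast
  qed
qed

text \<open>
  Under the half-space colouring by \<open>v \<bullet> x > 0\<close>, a monochromatic set that is invariant under a symmetry
  whose orbits are balanced with respect to \<open>v\<close> lies in the bounding hyperplane.
\<close>

lemma ms_set_eq_0_balanced_orbits:
  fixes X :: "'a::euclidean_space set"
  assumes X: "compact X" "measure lborel X > 0" and r: "r \<ge> 2" and v: "v \<noteq> 0"
    and balanced: "\<And>g. g \<in> carrier (Iso X) \<Longrightarrow> g \<noteq> id \<Longrightarrow> \<exists>n>0. \<forall>x. (\<Sum>k<n. v \<bullet> (g ^^ k) x) = 0"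
  shows "ms_set X r = 0"
proof (rule antisym)
  let ?M = "normalized_lebesgue X"
  have X_borel: "X \<in> sets borel" using X by (simp add: borel_compact)
  define col :: "'a \<Rightarrow> nat" where "col x = (if v \<bullet> x > 0 then 0 else 1)" for x
  have "col \<in> measurable borel (count_space {..<r})"
    unfolding col_def using r by (intro measurable_If) simp_all
  then have col: "col \<in> measurable ?M (count_space {..<r})"
    by (rule measurable_normalized_lebesgue_borel)
  show "ms_set X r \<le> 0"
    unfolding ms_set_def
  proof (rule ms_leI[OF _ col])
    fix A c g assume A: "A \<in> sets ?M" "\<forall>x\<in>A. col x = c" "g ` A = A"
      and g: "g \<in> carrier (Iso X)" "g \<noteq> \<one>\<^bsub>Iso X\<^esub>"
    obtain n where n: "n > 0" "\<And>x. (\<Sum>k<n. v \<bullet> (g ^^ k) x) = 0" using balanced g by auto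
    have "v \<bullet> x = 0" if x: "x \<in> A" for x
    proof -
      have orbit: "(g ^^ k) x \<in> A" for k by (induction k) (use x A(3) in auto)
      show ?thesis
      proof (cases "c = 0")
        case True
        then have "0 < v \<bullet> (g ^^ k) x" for k
          using A(2) orbit[of k] by (auto simp: col_def split: if_splits)
        then have "(\<Sum>k<n. v \<bullet> (g ^^ k) x) > 0" using n(1) by (intro sum_pos) auto
        then show ?thesis using n(2)[of x] by simp
      next
        case False
        then have "0 \<le> - (v \<bullet> (g ^^ k) x)" for k
          using A(2) orbit[of k] by (auto simp: col_def split: if_splits)
        moreover have "(\<Sum>k<n. - (v \<bullet> (g ^^ k) x)) = 0" using n(2)[of x] by (simp add: sum_negf)
        ultimately have "\<forall>k\<in>{..<n}. - (v \<bullet> (g ^^ k) x) = 0"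
          by (subst (asm) sum_nonneg_eq_0_iff) auto
        then show ?thesis using n(1) by force
      qed
    qed
    then have "A \<subseteq> {x. v \<bullet> x = 0}" by blast
    moreover have "negligible {x. v \<bullet> x = 0}" using v by (intro negligible_hyperplane) auto
    ultimately show "measure ?M A \<le> 0"
      using measure_normalized_lebesgue_negligible[OF X_borel A(1)] by simp
  qed simp
  show "0 \<le> ms_set X r"
    unfolding ms_set_def using prob_space_normalized_lebesgue[OF X] r by (intro ms_nonneg) auto
qed

section \<open>Symmetries of centred plane sets\<close>

lemma norm_1_mult_cnj: "norm z = 1 \<Longrightarrow> z * cnj z = 1"
  by (simp add: complex_norm_square[symmetric])

lemma isometry_mult: "norm u = 1 \<Longrightarrow> isometry ((*) (u :: complex))"
  by (simp add: isometry_def dist_norm norm_mult flip: right_diff_distrib)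

lemma isometry_cnj: "isometry cnj"
  unfolding isometry_def by (metis complex_cnj_diff complex_mod_cnj dist_norm)

lemma complex_isometry_fixing_0:
  fixes f :: "complex \<Rightarrow> complex"
  assumes f: "isometry f" and f0: "f 0 = 0"
  shows "norm (f 1) = 1" and "f = (\<lambda>z. f 1 * z) \<or> f = (\<lambda>z. f 1 * cnj z)"
proof -
  show u: "norm (f 1) = 1" using isometryD[OF f, of 1 0] f0 by simp
  define g where "g z = cnj (f 1) * f z" for z
  have f_g: "f z = f 1 * g z" for z
    using norm_1_mult_cnj[OF u] by (simp add: g_def mult.assoc[symmetric])
  have "isometry g"
    unfolding g_def[abs_def]
    using isometry_compose[OF f isometry_mult[of "cnj (f 1)"]] u by (simp add: comp_def)
  moreover have g01: "g 0 = 0" "g 1 = 1"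
    using f0 norm_1_mult_cnj[OF u] by (simp_all add: g_def mult.commute)
  ultimately have g_norm: "norm (g \<i>) = 1" "norm (g \<i> - 1) = norm (\<i> - 1)"
    and "linear g"
    using isometryD[of g \<i> 0] isometryD[of g \<i> 1] isometry_linear[of g]
    by (auto simp: isometry_def dist_norm)
  have "(Re (g \<i>))\<^sup>2 + (Im (g \<i>))\<^sup>2 = 1" "(Re (g \<i>) - 1)\<^sup>2 + (Im (g \<i>))\<^sup>2 = 2"
    using g_norm by (simp_all add: cmod_def)
  then have "Re (g \<i>) = 0" "(Im (g \<i>))\<^sup>2 = 1" by (simp_all add: power2_eq_square algebra_simps)
  then have g_i: "g \<i> = \<i> \<or> g \<i> = - \<i>" by (auto simp: complex_eq_iff power2_eq_1_iff)
  have g_z: "g z = Re z *\<^sub>R 1 + Im z *\<^sub>R g \<i>" for z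
  proof -
    have "g z = g (Re z *\<^sub>R 1 + Im z *\<^sub>R \<i>)" by (rule arg_cong[of _ _ g]) (simp add: complex_eq_iff)
    then show ?thesis using \<open>linear g\<close> g01 by (simp add: linear_add linear_scale)
  qed
  from g_i have "g = (\<lambda>z. z) \<or> g = cnj"
  proof
    assume "g \<i> = \<i>"
    then have "g z = z" for z using g_z[of z] by (simp add: complex_eq_iff)
    then show ?thesis by auto
  next
    assume "g \<i> = - \<i>"
    then have "g z = cnj z" for z using g_z[of z] by (simp add: complex_eq_iff)
    then show ?thesis by auto
  qed
  then show "f = (\<lambda>z. f 1 * z) \<or> f = (\<lambda>z. f 1 * cnj z)" using f_g by (metis ext)
qed

definition rotations :: "complex set \<Rightarrow> complex set" where
  "rotations Y = {u. (*) u \<in> carrier (Iso Y)}"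

definition reflections :: "complex set \<Rightarrow> complex set" where
  "reflections Y = {w. (\<lambda>z. w * cnj z) \<in> carrier (Iso Y)}"

lemma rotations_iff: "u \<in> rotations Y \<longleftrightarrow> norm u = 1 \<and> (\<forall>y\<in>Y. u * y \<in> Y \<and> cnj u * y \<in> Y)"
proof
  assume u: "u \<in> rotations Y"
  then have f: "isometry ((*) u)" "(*) u ` Y = Y" by (simp_all add: rotations_def carrier_Iso)
  have norm_u: "norm u = 1" using isometryD[OF f(1), of 1 0] by simp
  have "u * y \<in> Y \<and> cnj u * y \<in> Y" if y: "y \<in> Y" for y
  proof -
    obtain x where "x \<in> Y" "y = u * x" using y f(2) by blast
    then have "cnj u * y = x"
      using norm_1_mult_cnj[OF norm_u] by (simp add: mult.assoc[symmetric] mult.commute[of "cnj u"])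
    then show ?thesis using \<open>x \<in> Y\<close> y f(2) by auto
  qed
  with norm_u show "norm u = 1 \<and> (\<forall>y\<in>Y. u * y \<in> Y \<and> cnj u * y \<in> Y)" by blast
next
  assume u: "norm u = 1 \<and> (\<forall>y\<in>Y. u * y \<in> Y \<and> cnj u * y \<in> Y)"
  then have inv: "u * (cnj u * z) = z" for z
    using norm_1_mult_cnj[of u] by (simp add: mult.assoc[symmetric])
  have "surj ((*) u)" using inv by (metis surjI)
  moreover have "(*) u ` Y = Y"
  proof
    show "Y \<subseteq> (*) u ` Y"
    proof
      fix y assume "y \<in> Y"
      then show "y \<in> (*) u ` Y" using u inv[of y] by (intro image_eqI[of _ _ "cnj u * y"]) auto
    qed
  qed (use u in auto)
  ultimately show "u \<in> rotations Y"
    using u isometry_mult[of u] by (simp add: rotations_def carrier_Iso)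
qed

lemma one_in_rotations: "1 \<in> rotations Y"
  by (simp add: rotations_iff)

lemma cnj_in_rotations: "u \<in> rotations Y \<Longrightarrow> cnj u \<in> rotations Y"
  by (simp add: rotations_iff)

lemma mult_in_rotations: "u \<in> rotations Y \<Longrightarrow> v \<in> rotations Y \<Longrightarrow> u * v \<in> rotations Y"
  by (simp add: rotations_iff norm_mult mult.assoc)

lemma norm_reflection:
  assumes "w \<in> reflections Y"
  shows "norm w = 1"
proof -
  have "isometry (\<lambda>z. w * cnj z)" using assms by (simp add: reflections_def carrier_Iso)
  from isometryD[OF this, of 1 0] show ?thesis by simp
qed

lemma rotation_mult_reflection:
  assumes "u \<in> rotations Y" "w \<in> reflections Y"
  shows "u * w \<in> reflections Y"
  using Iso_comp[of "(*) u" Y "\<lambda>z. w * cnj z"] assms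
  by (simp add: rotations_def reflections_def comp_def mult.assoc)

lemma reflection_mult_cnj_reflection:
  assumes "v \<in> reflections Y" "w \<in> reflections Y"
  shows "v * cnj w \<in> rotations Y"
proof -
  have "(\<lambda>z. v * cnj z) \<circ> (\<lambda>z. w * cnj z) = (*) (v * cnj w)" by (auto simp: mult.assoc)
  then show ?thesis using Iso_comp[of "\<lambda>z. v * cnj z" Y "\<lambda>z. w * cnj z"] assms
    by (simp add: rotations_def reflections_def)
qed

lemma finite_mult_closed_power_card:
  fixes U :: "'a::field set"
  assumes fin: "finite U" and nz: "0 \<notin> U" and mult: "\<And>u v. u \<in> U \<Longrightarrow> v \<in> U \<Longrightarrow> u * v \<in> U" and u: "u \<in> U"
  shows "u ^ card U = 1"
proof -
  \<comment> \<open>Multiplication by \<open>u\<close> permutes \<open>U\<close>; compare the products of all elements.\<close>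
  have inj: "inj_on ((*) u) U" using u nz by (auto simp: inj_on_def)
  have "(*) u ` U = U" using endo_inj_surj[OF fin _ inj] mult u by blast
  then have "(\<Prod>v\<in>U. v) = (\<Prod>v\<in>U. u * v)" by (metis prod.reindex_cong[OF inj])
  also have "\<dots> = u ^ card U * (\<Prod>v\<in>U. v)" by (simp add: prod.distrib)
  finally show ?thesis using fin nz by auto
qed

lemma finite_rotations_power_card:
  assumes "finite (rotations Y)" "u \<in> rotations Y"
  shows "u ^ card (rotations Y) = 1"
  using assms by (intro finite_mult_closed_power_card mult_in_rotations) (auto simp: rotations_iff)

lemma finite_rotations_eq_roots_of_unity:
  assumes "finite (rotations Y)"
  shows "rotations Y = {z. z ^ card (rotations Y) = 1}"
proof (rule card_subset_eq)
  have n: "card (rotations Y) > 0" using assms one_in_rotations by (auto simp: card_gt_0_iff)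
  then show "finite {z::complex. z ^ card (rotations Y) = 1}" by (simp add: finite_roots_unity)
  show "card (rotations Y) = card {z::complex. z ^ card (rotations Y) = 1}"
    using n by (simp add: card_roots_unity_eq)
qed (use finite_rotations_power_card[OF assms] in auto)

definition unity_root :: "nat \<Rightarrow> int \<Rightarrow> complex" where
  "unity_root n i = cis (2 * pi * real_of_int i / real n)"

lemma unity_root_0 [simp]: "unity_root n 0 = 1"
  by (simp add: unity_root_def)

lemma unity_root_add: "unity_root n (i + j) = unity_root n i * unity_root n j"
  by (simp add: unity_root_def cis_mult add_divide_distrib distrib_left)

lemma cnj_unity_root: "cnj (unity_root n i) = unity_root n (- i)"
  by (simp add: unity_root_def cis_cnj)

lemma unity_root_mod:
  assumes "n \<ge> 1"
  shows "unity_root n (i mod int n) = unity_root n i"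
proof -
  have "unity_root n (int n * (i div int n)) = cis (2 * pi * real_of_int (i div int n))"
    unfolding unity_root_def using assms by (intro arg_cong[of _ _ cis]) simp
  also have "\<dots> = 1" by (rule cis_multiple_2pi) simp
  finally show ?thesis using unity_root_add[of n "int n * (i div int n)" "i mod int n"] by simp
qed

lemma bij_betw_unity_root:
  assumes "n \<ge> 1"
  shows "bij_betw (unity_root n) {0..<int n} {z. z ^ n = 1}"
proof -
  have "bij_betw (\<lambda>k. cis (2 * pi * real k / real n)) {..<n} {z. z ^ n = 1}"
    using assms by (intro Complex.bij_betw_roots_unity) simp
  moreover have "bij_betw nat {0..<int n} {..<n}"
    by (rule bij_betw_byWitness[of _ int]) auto
  ultimately have "bij_betw ((\<lambda>k. cis (2 * pi * real k / real n)) \<circ> nat) {0..<int n} {z. z ^ n = 1}"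
    by (rule bij_betw_trans[rotated])
  then show ?thesis by (rule bij_betw_cong[THEN iffD1, rotated]) (auto simp: unity_root_def)
qed

definition dihedral_isometry :: "nat \<Rightarrow> complex \<Rightarrow> int \<times> bool \<Rightarrow> complex \<Rightarrow> complex" where
  "dihedral_isometry n w = (\<lambda>(i, s) z. unity_root n i * (if s then w * cnj z else z))"

lemma dihedral_isometry_mult:
  assumes n: "n \<ge> 1" and w: "norm w = 1"
  shows "dihedral_isometry n w (x \<otimes>\<^bsub>dihedral_group n\<^esub> y) =
      dihedral_isometry n w x \<circ> dihedral_isometry n w y"
proof -
  obtain i s j t where xy: "x = (i, s)" "y = (j, t)" by force
  have "w * (cnj w * c) = c" for c using norm_1_mult_cnj[OF w] by (simp add: mult.assoc[symmetric])
  then show ?thesis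
    using unity_root_add[of n i "- j"] n
    by (cases s; cases t)
      (auto simp: xy dihedral_group_def dihedral_isometry_def unity_root_mod unity_root_add
        cnj_unity_root fun_eq_iff mult_ac)
qed

lemma dihedral_isometry_eq_id:
  assumes n: "n \<ge> 1" and "w \<noteq> 0"
    and x: "x \<in> carrier (dihedral_group n)" "dihedral_isometry n w x = id"
  shows "x = \<one>\<^bsub>dihedral_group n\<^esub>"
proof -
  obtain i s where x_eq: "x = (i, s)" by force
  have fix_z: "unity_root n i * (if s then w * cnj z else z) = z" for z
    using fun_cong[OF x(2), of z] by (simp add: x_eq dihedral_isometry_def)
  have not_s: "\<not> s"
  proof
    assume s
    then have "(unity_root n i * w) * cnj 1 = 1" "(unity_root n i * w) * cnj \<i> = \<i>"
      using fix_z[of 1] fix_z[of \<i>] by (simp_all only: if_True mult.assoc)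
    then show False by simp
  qed
  have "inj_on (unity_root n) {0..<int n}"
    using bij_betw_unity_root[OF n] by (simp add: bij_betw_def)
  moreover have "unity_root n i = unity_root n 0" using fix_z[of 1] not_s by simp
  moreover have "i \<in> {0..<int n}" "0 \<in> {0..<int n}"
    using x(1) n by (auto simp: x_eq dihedral_group_def)
  ultimately have "i = 0" by (rule inj_onD)
  then show ?thesis using not_s by (simp add: x_eq dihedral_group_def)
qed

locale centred_plane_set =
  fixes Y :: "complex set"
  assumes compact: "compact Y" and measure_pos: "measure lborel Y > 0"
    and Iso_fixes_0: "f \<in> carrier (Iso Y) \<Longrightarrow> f 0 = 0"
begin

lemma Iso_cases:
  assumes f: "f \<in> carrier (Iso Y)"
  obtains (rotation) u where "u \<in> rotations Y" "f = (*) u"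
  | (reflection) w where "w \<in> reflections Y" "f = (\<lambda>z. w * cnj z)"
proof -
  have "isometry f" using f by (simp add: carrier_Iso)
  from complex_isometry_fixing_0(2)[OF this Iso_fixes_0[OF f]] show ?thesis
  proof
    assume eq: "f = (\<lambda>z. f 1 * z)"
    then have "f 1 \<in> rotations Y" using f by (simp add: rotations_def)
    then show ?thesis using eq by (rule rotation)
  next
    assume eq: "f = (\<lambda>z. f 1 * cnj z)"
    then have "f 1 \<in> reflections Y" using f by (simp add: reflections_def)
    then show ?thesis using eq by (rule reflection)
  qed
qed

lemma finite_Iso_iff_finite_rotations: "finite (carrier (Iso Y)) \<longleftrightarrow> finite (rotations Y)"
proof
  assume "finite (carrier (Iso Y))"
  moreover have "(*) ` rotations Y \<subseteq> carrier (Iso Y)" by (auto simp: rotations_def)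
  ultimately have "finite ((*) ` rotations Y)" by (rule finite_subset[rotated])
  moreover have "inj_on (*) (rotations Y)" by (rule inj_onI) (metis mult.right_neutral)
  ultimately show "finite (rotations Y)" by (rule finite_imageD)
next
  assume fin: "finite (rotations Y)"
  have "finite (reflections Y)"
  proof (cases "reflections Y = {}")
    case False
    then obtain w where w: "w \<in> reflections Y" by blast
    have "v \<in> (\<lambda>u. u * w) ` rotations Y" if v: "v \<in> reflections Y" for v
    proof (rule image_eqI)
      show "v = (v * cnj w) * w"
        using norm_1_mult_cnj[OF norm_reflection[OF w]] by (simp add: mult.assoc mult.commute)
    qed (rule reflection_mult_cnj_reflection[OF v w])
    then have "reflections Y \<subseteq> (\<lambda>u. u * w) ` rotations Y" by (rule subsetI)
    then show ?thesis by (rule finite_surj[OF fin])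
  qed simp
  moreover have "carrier (Iso Y) \<subseteq> (*) ` rotations Y \<union> (\<lambda>w z. w * cnj z) ` reflections Y"
    using Iso_cases by blast
  ultimately show "finite (carrier (Iso Y))" using fin finite_subset by blast
qed

lemma card_rotations_ge_1: "finite (rotations Y) \<Longrightarrow> card (rotations Y) \<ge> 1"
  using one_in_rotations by (auto simp: Suc_le_eq card_gt_0_iff)

lemma bij_betw_unity_root_rotations:
  assumes "finite (rotations Y)"
  shows "bij_betw (unity_root (card (rotations Y))) {0..<int (card (rotations Y))} (rotations Y)"
  using bij_betw_unity_root[OF card_rotations_ge_1[OF assms]]
    finite_rotations_eq_roots_of_unity[OF assms] by simp

lemma dihedral_isometry_in_Iso:
  assumes fin: "finite (rotations Y)" and w: "w \<in> reflections Y"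
  shows "dihedral_isometry (card (rotations Y)) w x \<in> carrier (Iso Y)"
proof -
  obtain i s where x: "x = (i, s)" by force
  have "unity_root (card (rotations Y)) (i mod int (card (rotations Y))) \<in> rotations Y"
    using bij_betwE[OF bij_betw_unity_root_rotations[OF fin]] card_rotations_ge_1[OF fin] by simp
  then have root: "unity_root (card (rotations Y)) i \<in> rotations Y"
    by (simp only: unity_root_mod[OF card_rotations_ge_1[OF fin]])
  show ?thesis
  proof (cases s)
    case True
    then show ?thesis
      using rotation_mult_reflection[OF root w]
      by (simp add: x dihedral_isometry_def reflections_def mult.assoc)
  qed (use root in \<open>simp add: x dihedral_isometry_def rotations_def\<close>)
qed

lemma Iso_subset_dihedral_isometries:
  assumes fin: "finite (rotations Y)" and w: "w \<in> reflections Y"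
  shows "carrier (Iso Y) \<subseteq>
    dihedral_isometry (card (rotations Y)) w ` carrier (dihedral_group (card (rotations Y)))"
proof
  let ?n = "card (rotations Y)"
  have root_exists: "\<exists>i\<in>{0..<int ?n}. u = unity_root ?n i" if "u \<in> rotations Y" for u
    using that bij_betw_imp_surj_on[OF bij_betw_unity_root_rotations[OF fin]] by blast
  fix f assume "f \<in> carrier (Iso Y)"
  then show "f \<in> dihedral_isometry ?n w ` carrier (dihedral_group ?n)"
  proof (cases rule: Iso_cases)
    case (rotation u)
    then obtain i where "i \<in> {0..<int ?n}" "u = unity_root ?n i" using root_exists by blast
    then show ?thesis using rotation
      by (intro image_eqI[of _ _ "(i, False)"]) (auto simp: dihedral_isometry_def dihedral_group_def)
  next
    case (reflection v)
    obtain i where "i \<in> {0..<int ?n}" "v * cnj w = unity_root ?n i"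
      using root_exists[OF reflection_mult_cnj_reflection[OF reflection(1) w]] by blast
    moreover have "v = (v * cnj w) * w"
      using norm_1_mult_cnj[OF norm_reflection[OF w]] by (simp add: mult.assoc mult.commute)
    ultimately show ?thesis using reflection
      by (intro image_eqI[of _ _ "(i, True)"]) (auto simp: dihedral_isometry_def dihedral_group_def mult.assoc)
  qed
qed

lemma dihedral_isometry_iso:
  assumes fin: "finite (rotations Y)" and w: "w \<in> reflections Y"
  shows "dihedral_isometry (card (rotations Y)) w \<in>
      iso (dihedral_group (card (rotations Y))) (Iso Y)"
proof -
  define n where "n = card (rotations Y)"
  have n: "n \<ge> 1" unfolding n_def using fin by (rule card_rotations_ge_1)
  have mem: "dihedral_isometry n w x \<in> carrier (Iso Y)" for x
    unfolding n_def using fin w by (rule dihedral_isometry_in_Iso)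
  then have hom: "dihedral_isometry n w \<in> hom (dihedral_group n) (Iso Y)"
    using dihedral_isometry_mult[OF n norm_reflection[OF w]] by (intro homI) simp_all
  interpret group_hom "dihedral_group n" "Iso Y" "dihedral_isometry n w"
    using n hom by (intro group_hom.intro group_dihedral_group group_Iso group_hom_axioms.intro)
  have "w \<noteq> 0" using norm_reflection[OF w] by auto
  then have "inj_on (dihedral_isometry n w) (carrier (dihedral_group n))"
    unfolding inj_on_one_iff using dihedral_isometry_eq_id[OF n] by simp
  moreover have "dihedral_isometry n w ` carrier (dihedral_group n) = carrier (Iso Y)"
    using mem Iso_subset_dihedral_isometries[OF fin w] by (auto simp: n_def)
  ultimately have "bij_betw (dihedral_isometry n w) (carrier (dihedral_group n)) (carrier (Iso Y))"
    by (simp add: bij_betw_def)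
  with hom show ?thesis unfolding n_def[symmetric] by (rule isoI)
qed

lemma ms_set_eq_0_no_reflections:
  assumes fin: "finite (rotations Y)" and none: "reflections Y = {}" and r: "r \<ge> 2"
  shows "ms_set Y r = 0"
proof (rule ms_set_eq_0_balanced_orbits[OF compact measure_pos r, of 1])
  fix g assume g: "g \<in> carrier (Iso Y)" "g \<noteq> id"
  then obtain u where u: "u \<in> rotations Y" "g = (*) u" using none by (cases rule: Iso_cases) auto
  with g have "u \<noteq> 1" by auto
  have power: "(g ^^ k) z = u ^ k * z" for k z by (induction k) (simp_all add: u(2) mult.assoc)
  let ?n = "card (rotations Y)"
  have "(\<Sum>k<?n. u ^ k) = 0"
    using \<open>u \<noteq> 1\<close> finite_rotations_power_card[OF fin u(1)] by (simp add: geometric_sum)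
  then have "(\<Sum>k<?n. 1 \<bullet> (g ^^ k) z) = 0" for z
    unfolding power inner_sum_right[symmetric] sum_distrib_right[symmetric] by simp
  moreover have "?n > 0" using card_rotations_ge_1[OF fin] by simp
  ultimately show "\<exists>n>0. \<forall>z. (\<Sum>k<n. 1 \<bullet> (g ^^ k) z) = 0" by blast
qed simp

lemma ms_set_eq_0_single_reflection:
  assumes trivial: "rotations Y = {1}" and w: "w \<in> reflections Y" and r: "r \<ge> 2"
  shows "ms_set Y r = 0"
proof -
  define v where "v = csqrt w"
  have norm_v: "norm v = 1" using norm_reflection[OF w] by (simp add: v_def)
  have w_v: "w = v * v" by (simp add: v_def power2_eq_square[symmetric])
  have antisym: "(\<i> * v) \<bullet> (w * cnj z) = - ((\<i> * v) \<bullet> z)" for z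
  proof -
    have "(\<i> * v) \<bullet> y = Im (cnj v * y)" for y by (simp add: inner_complex_def)
    moreover have "cnj v * (w * cnj z) = (v * cnj v) * cnj (cnj v * z)" by (simp add: w_v mult_ac)
    ultimately show ?thesis using norm_1_mult_cnj[OF norm_v] by (simp only: mult_1 cnj.sel)
  qed
  show ?thesis
  proof (rule ms_set_eq_0_balanced_orbits[OF compact measure_pos r, of "\<i> * v"])
    fix g assume "g \<in> carrier (Iso Y)" "g \<noteq> id"
    then obtain w' where w': "w' \<in> reflections Y" "g = (\<lambda>z. w' * cnj z)"
      using trivial by (cases rule: Iso_cases) auto
    have "w' * cnj w = 1" using reflection_mult_cnj_reflection[OF w'(1) w] trivial by simp
    then have "w' = w"
      using norm_1_mult_cnj[OF norm_reflection[OF w]] by (metis mult.assoc mult.commute mult_1)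
    then have "(\<Sum>k<2. (\<i> * v) \<bullet> (g ^^ k) z) = 0" for z
      using antisym[of z] w'(2) by (simp add: numeral_2_eq_2)
    then show "\<exists>n>0. \<forall>z. (\<Sum>k<n. (\<i> * v) \<bullet> (g ^^ k) z) = 0" by (intro exI[of _ 2]) simp
  qed (use norm_v in auto)
qed

lemma ms_set_eq_0_not_dihedral:
  assumes fin: "finite (carrier (Iso Y))" and not_dihedral: "\<not> (\<exists>n\<ge>2. Iso Y \<cong> dihedral_group n)"
    and r: "r \<ge> 2"
  shows "ms_set Y r = 0"
proof (cases "reflections Y = {}")
  case True
  with fin r show ?thesis
    by (intro ms_set_eq_0_no_reflections) (simp_all add: finite_Iso_iff_finite_rotations)
next
  case False
  then obtain w where w: "w \<in> reflections Y" by blast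
  have fin_rot: "finite (rotations Y)" using fin by (simp add: finite_Iso_iff_finite_rotations)
  let ?n = "card (rotations Y)"
  have n: "?n \<ge> 1" using fin_rot by (rule card_rotations_ge_1)
  have "dihedral_group ?n \<cong> Iso Y"
    using dihedral_isometry_iso[OF fin_rot w] by (auto simp: is_iso_def)
  then have "Iso Y \<cong> dihedral_group ?n" by (rule group.iso_sym[OF group_dihedral_group[OF n]])
  then have "?n = 1"
    using not_dihedral n by (metis One_nat_def Suc_leI le_neq_implies_less numeral_2_eq_2)
  then have "rotations Y = {1}" using one_in_rotations by (metis card_1_singletonE singletonD)
  then show ?thesis using w r by (rule ms_set_eq_0_single_reflection)
qed

end

definition complex_of_vec :: "real ^ 2 \<Rightarrow> complex" where
  "complex_of_vec v = Complex (v $ 1) (v $ 2)"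

lemma isometry_complex_of_vec: "isometry complex_of_vec"
  by (simp add: isometry_def dist_norm complex_of_vec_def complex_norm norm_vec_def L2_set_def sum_2
      complex_diff cmod_def)

lemma surj_complex_of_vec: "surj complex_of_vec"
proof (rule surjI)
  fix z show "complex_of_vec (\<chi> i. if i = 1 then Re z else Im z) = z"
    by (simp add: complex_of_vec_def)
qed

lemma centred_plane_copy:
  fixes X :: "(real ^ 2) set"
  assumes X: "compact X" "measure lborel X > 0"
  obtains Y where "centred_plane_set Y" "Iso X \<cong> Iso Y" "\<And>r. r \<ge> 1 \<Longrightarrow> ms_set X r = ms_set Y r"
proof -
  define T where "T = (\<lambda>v. complex_of_vec (v - centroid X))"
  have T: "isometry T" using isometry_complex_of_vec by (simp add: T_def isometry_def dist_norm)
  have surj_T: "surj T"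
  proof -
    have "surj (\<lambda>v. v - centroid X)" by (rule surjI[of _ "\<lambda>v. v + centroid X"]) simp
    from comp_surj[OF this surj_complex_of_vec] show ?thesis by (simp add: T_def comp_def)
  qed
  have T_centroid: "inv_into UNIV T 0 = centroid X"
    using isometry_inj[OF T]
    by (intro inv_f_eq) (simp_all add: T_def complex_of_vec_def zero_complex.code)
  have iso: "(\<lambda>f. T \<circ> f \<circ> inv_into UNIV T) \<in> iso (Iso X) (Iso (T ` X))"
    using T surj_T by (rule Iso_isometry_image)
  show ?thesis
  proof (rule that[of "T ` X"])
    show "centred_plane_set (T ` X)"
    proof
      show "compact (T ` X)" using X T by (intro compact_continuous_image continuous_on_isometry)
      show "measure lborel (T ` X) > 0"
        using X by (simp add: measure_lborel_isometry_image[OF T surj_T])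
      fix f assume "f \<in> carrier (Iso (T ` X))"
      then obtain h where h: "h \<in> carrier (Iso X)" "f = T \<circ> h \<circ> inv_into UNIV T"
        using iso by (auto simp: iso_def bij_betw_def)
      then have "f 0 = T (centroid X)" using Iso_fixes_centroid[OF X h(1)] by (simp add: T_centroid)
      then show "f 0 = 0" by (simp add: T_def complex_of_vec_def zero_complex.code)
    qed
    show "Iso X \<cong> Iso (T ` X)" using iso by (auto simp: is_iso_def)
    show "ms_set X r = ms_set (T ` X) r" if "r \<ge> 1" for r
      using ms_set_isometry_image[OF T surj_T X that] by simp
  qed
qed

section \<open>Lacunary colourings of the circle\<close>

definition first_digit :: "nat \<Rightarrow> real \<Rightarrow> nat" where
  "first_digit r y = nat \<lfloor>real r * frac y\<rfloor>"

lemma first_digit_eq_iff: "first_digit r y = i \<longleftrightarrow>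
    real i \<le> real r * frac y \<and> real r * frac y < real i + 1"
proof -
  have "0 \<le> \<lfloor>real r * frac y\<rfloor>" by simp
  then show ?thesis unfolding first_digit_def by linarith
qed

lemma first_digit_less: "r \<ge> 1 \<Longrightarrow> first_digit r y < r"
  using frac_lt_1[of y] by (simp add: first_digit_def nat_less_iff floor_less_iff)

lemma first_digit_add_of_int: "first_digit r (y + of_int k) = first_digit r y"
  by (simp add: first_digit_def)

lemma measurable_first_digit [measurable]: "first_digit r \<in> measurable borel (count_space UNIV)"
  unfolding first_digit_def frac_def by measurable

lemma convex_bounded_real_hull:
  fixes J :: "real set"
  assumes "convex J" "bounded J"
  obtains u v where "u \<le> v" "J \<subseteq> {u..v}" "measure lborel J = v - u"
proof (cases "J = {}")
  case False
  have "convex (closure J)" using assms by (intro convex_closure)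
  then have "connected (closure J)" by (rule convex_connected)
  moreover have "compact (closure J)" using assms by (simp add: compact_closure)
  ultimately have "\<exists>u v. closure J = {u..v}"
    unfolding connected_compact_interval_1[symmetric] by blast
  then obtain u v where uv: "closure J = {u..v}" by blast
  then have J: "J \<subseteq> {u..v}" using closure_subset by blast
  have "measure lebesgue J = measure lebesgue (closure J)"
    using assms by (intro measure_closure[symmetric] negligible_convex_frontier)
  moreover have "J \<in> sets borel"
    using assms by (intro real_interval_borel_measurable) (simp add: is_interval_convex_1)
  ultimately have "measure lborel J = measure lborel {u..v}" by (simp add: uv)
  moreover have "u \<le> v" using J False by fastforce
  ultimately show ?thesis using J by (intro that[of u v]) auto
qed (rule that[of 0 0], auto)

lemma convex_floor_affine_eq: "convex {x::real. \<lfloor>p * x + c\<rfloor> = k}"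
proof -
  have "{x::real. \<lfloor>p * x + c\<rfloor> = k} = (*) p -` {k - c..<k + 1 - c}"
    by (auto simp: floor_eq_iff algebra_simps)
  then show ?thesis by (simp add: convex_linear_vimage linear_times)
qed

lemma first_digit_affine_cells:
  fixes u v q \<theta> :: real and r i :: nat
  assumes "u \<le> v" "q \<noteq> 0" "r \<ge> 1"
  obtains K :: "int set" and l :: "int \<Rightarrow> real"
  where "finite K" "real (card K) \<le> \<bar>q\<bar> * (v - u) + 2"
    "{x\<in>{u..v}. first_digit r (q * x + \<theta>) = i} \<subseteq> (\<Union>k\<in>K. {l k..l k + 1 / (r * \<bar>q\<bar>)})"
proof -
  define a b where "a = min (q * u + \<theta>) (q * v + \<theta>)" and "b = max (q * u + \<theta>) (q * v + \<theta>)"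
  define K where "K = {\<lfloor>a\<rfloor>..\<lfloor>b\<rfloor>}"
  define l where "l k = (if q > 0 then (k + i / r - \<theta>) / q else (k + (i + 1) / r - \<theta>) / q)"
    for k :: int
  have ab: "b - a = \<bar>q\<bar> * (v - u)"
    using assms mult_left_mono[of u v q] mult_left_mono_neg[of u v q]
    by (cases "q > 0") (auto simp: a_def b_def algebra_simps)
  have in_ab: "q * x + \<theta> \<in> {a..b}" if "x \<in> {u..v}" for x
    using that mult_left_mono[of u x q] mult_left_mono[of x v q] mult_left_mono_neg[of u x q]
      mult_left_mono_neg[of x v q]
    by (cases "q > 0") (auto simp: a_def b_def min_le_iff_disj le_max_iff_disj)
  have "\<lfloor>a\<rfloor> \<le> \<lfloor>b\<rfloor>" by (rule floor_mono) (simp add: a_def b_def)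
  then have "real (card K) = real_of_int (\<lfloor>b\<rfloor> - \<lfloor>a\<rfloor> + 1)" by (simp add: K_def)
  then have card: "real (card K) \<le> \<bar>q\<bar> * (v - u) + 2" unfolding ab[symmetric] by simp linarith
  have "{x\<in>{u..v}. first_digit r (q * x + \<theta>) = i} \<subseteq> (\<Union>k\<in>K. {l k..l k + 1 / (r * \<bar>q\<bar>)})"
  proof safe
    fix x assume x: "x \<in> {u..v}" "i = first_digit r (q * x + \<theta>)"
    define k where "k = \<lfloor>q * x + \<theta>\<rfloor>"
    have "k \<in> K" using in_ab[OF x(1)] by (auto simp: k_def K_def intro!: floor_mono)
    moreover have bounds: "k + i / r - \<theta> \<le> q * x" "q * x \<le> k + (i + 1) / r - \<theta>"
      using x(2)[symmetric] \<open>r \<ge> 1\<close>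
      unfolding first_digit_eq_iff by (auto simp: k_def frac_def field_simps)
    have "x \<in> {l k..l k + 1 / (r * \<bar>q\<bar>)}"
    proof (cases "q > 0")
      case True
      then have "l k + 1 / (r * \<bar>q\<bar>) = (k + (i + 1) / r - \<theta>) / q"
        using \<open>r \<ge> 1\<close> by (simp add: l_def field_simps)
      then show ?thesis
        using bounds True by (simp add: l_def pos_divide_le_eq pos_le_divide_eq mult.commute)
    next
      case False
      then have "q < 0" using \<open>q \<noteq> 0\<close> by simp
      then have "l k + 1 / (r * \<bar>q\<bar>) = (k + i / r - \<theta>) / q"
        using \<open>r \<ge> 1\<close> by (simp add: l_def field_simps)
      then show ?thesis
        using bounds \<open>q < 0\<close> by (simp add: l_def neg_divide_le_eq neg_le_divide_eq mult.commute)
    qed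
    ultimately show "x \<in> (\<Union>k\<in>K. {l k..l k + 1 / (r * \<bar>q\<bar>)})" by blast
  qed
  then show ?thesis using card by (intro that[of K l]) (auto simp: K_def)
qed

lemma measure_first_digit_Int_le:
  fixes q \<theta> B :: real and r i :: nat
  assumes J: "convex J" "bounded J" and q: "q \<noteq> 0" and r: "r \<ge> 1" and E: "E \<in> sets borel"
    and B: "\<And>l. measure lborel ({l..l + 1 / (r * \<bar>q\<bar>)} \<inter> E) \<le> B"
  shows "measure lborel {x\<in>J \<inter> E. first_digit r (q * x + \<theta>) = i} \<le> (\<bar>q\<bar> * measure lborel J + 2) * B"
proof -
  obtain u v where uv: "u \<le> v" "J \<subseteq> {u..v}" "measure lborel J = v - u"
    using convex_bounded_real_hull[OF J] .
  obtain K :: "int set" and l where K: "finite K" "real (card K) \<le> \<bar>q\<bar> * (v - u) + 2"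
    and cover: "{x\<in>{u..v}. first_digit r (q * x + \<theta>) = i} \<subseteq> (\<Union>k\<in>K. {l k..l k + 1 / (r * \<bar>q\<bar>)})"
    using first_digit_affine_cells[OF uv(1) q r, of \<theta> i] by blast
  have [measurable]: "J \<in> sets borel"
    using J by (intro real_interval_borel_measurable) (simp add: is_interval_convex_1)
  note [measurable] = E
  let ?cell = "\<lambda>k. {l k..l k + 1 / (r * \<bar>q\<bar>)} \<inter> E"
  have cell: "?cell k \<in> fmeasurable lborel" for k
    using E by (intro fmeasurable_Int_fmeasurable) (auto simp: fmeasurable_compact)
  have "{x\<in>J \<inter> E. first_digit r (q * x + \<theta>) = i} \<subseteq> (\<Union>k\<in>K. ?cell k)" using cover uv(2) by blast
  then have "measure lborel {x\<in>J \<inter> E. first_digit r (q * x + \<theta>) = i} \<le>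
      measure lborel (\<Union>k\<in>K. ?cell k)"
    using K(1) cell by (intro measure_mono_fmeasurable fmeasurable.finite_UN) auto
  also have "\<dots> \<le> (\<Sum>k\<in>K. measure lborel (?cell k))" using K(1) E by (intro measure_UNION_le) auto
  also have "\<dots> \<le> (\<Sum>k\<in>K. B)" by (intro sum_mono B)
  also have "\<dots> = card K * B" by simp
  also have "\<dots> \<le> (\<bar>q\<bar> * measure lborel J + 2) * B"
    using K(2) uv(3) order_trans[OF measure_nonneg B] by (intro mult_right_mono) auto
  finally show ?thesis .
qed

lemma measure_first_digit_le:
  fixes q \<theta> :: real and r i :: nat
  assumes J: "convex J" "bounded J" and q: "q \<noteq> 0" and r: "r \<ge> 1"
  shows "measure lborel {x\<in>J. first_digit r (q * x + \<theta>) = i} \<le> measure lborel J / r + 2 / \<bar>q\<bar>"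
proof -
  have "measure lborel {x\<in>J. first_digit r (q * x + \<theta>) = i} \<le>
      (\<bar>q\<bar> * measure lborel J + 2) * (1 / (r * \<bar>q\<bar>))"
    using measure_first_digit_Int_le[OF J q r, of UNIV "1 / (r * \<bar>q\<bar>)"] by simp
  also have "\<dots> = measure lborel J / r + 2 / (r * \<bar>q\<bar>)" using q r by (simp add: field_simps)
  also have "2 / (r * \<bar>q\<bar>) \<le> 2 / \<bar>q\<bar>" using q r by (intro divide_left_mono) auto
  finally show ?thesis by simp
qed

text \<open>
  If \<open>q\<close> is much larger than \<open>p\<close>, the first digit of \<open>p x + \<theta>\<close> is constant on intervals on which the first
  digit of \<open>q x + \<eta>\<close> equidistributes.
\<close>

lemma measure_two_first_digits_le:
  fixes p q \<theta> \<eta> :: real and r i j :: nat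
  assumes J: "convex J" "bounded J" "measure lborel J \<le> 1" and p: "\<bar>p\<bar> \<ge> 1" and q: "q \<noteq> 0"
    and r: "r \<ge> 1"
  shows "measure lborel {x\<in>J. first_digit r (p * x + \<theta>) = i \<and> first_digit r (q * x + \<eta>) = j}
    \<le> measure lborel J / r\<^sup>2 + 2 / \<bar>p\<bar> + 6 * \<bar>p\<bar> / \<bar>q\<bar>"
proof -
  define E where "E = {x. first_digit r (q * x + \<eta>) = j}"
  define B where "B = 1 / (r * \<bar>p\<bar>) / r + 2 / \<bar>q\<bar>"
  define w where "w = \<bar>p\<bar> * measure lborel J"
  have w: "w \<le> \<bar>p\<bar>" using mult_left_mono[OF J(3), of "\<bar>p\<bar>"] by (simp add: w_def)
  have r_p: "\<bar>p\<bar> \<le> r\<^sup>2 * \<bar>p\<bar>"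
    using mult_right_mono[of 1 "(real r)\<^sup>2" "\<bar>p\<bar>"] one_le_power[of "real r" 2] r by simp
  have cell: "measure lborel ({l..l + 1 / (r * \<bar>p\<bar>)} \<inter> E) \<le> B" for l
  proof -
    have "{l..l + 1 / (r * \<bar>p\<bar>)} \<inter> E = {x\<in>{l..l + 1 / (r * \<bar>p\<bar>)}. first_digit r (q * x + \<eta>) = j}"
      by (auto simp: E_def)
    then show ?thesis
      using measure_first_digit_le[of "{l..l + 1 / (r * \<bar>p\<bar>)}" q r \<eta> j] q r by (simp add: B_def)
  qed
  have "E \<in> sets borel" unfolding E_def by measurable
  then have "measure lborel {x\<in>J \<inter> E. first_digit r (p * x + \<theta>) = i} \<le> (w + 2) * B"
    unfolding w_def using p by (intro measure_first_digit_Int_le J r cell) auto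
  also have "{x\<in>J \<inter> E. first_digit r (p * x + \<theta>) = i} =
      {x\<in>J. first_digit r (p * x + \<theta>) = i \<and> first_digit r (q * x + \<eta>) = j}"
    by (auto simp: E_def)
  also have "(w + 2) * B = measure lborel J / r\<^sup>2 + 2 / (r\<^sup>2 * \<bar>p\<bar>) + 2 * (w + 2) / \<bar>q\<bar>"
    using p r by (simp add: w_def B_def power2_eq_square field_simps)
  also have "\<dots> \<le> measure lborel J / r\<^sup>2 + 2 / \<bar>p\<bar> + 6 * \<bar>p\<bar> / \<bar>q\<bar>"
    using p r w r_p by (intro add_mono divide_left_mono divide_right_mono) auto
  finally show ?thesis .
qed

lemma measure_lacunary_digits_le:
  fixes s t :: real and r i j Q m n :: nat
  assumes J: "convex J" "bounded J" "measure lborel J \<le> 1" and r: "r \<ge> 1" and Q: "Q \<ge> 1"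
    and s: "\<bar>s\<bar> = 1" and "m \<noteq> n"
  shows "measure lborel {x\<in>J. first_digit r (real Q ^ Suc m * x) = i \<and>
      first_digit r (real Q ^ Suc n * (s * x + t)) = j}
    \<le> measure lborel J / r\<^sup>2 + 8 / Q"
proof -
  have error: "2 / real Q ^ Suc a + 6 * real Q ^ Suc a / real Q ^ Suc b \<le> 8 / Q" if "a < b" for a b
  proof -
    have "real Q ^ 1 \<le> real Q ^ Suc a" using Q by (intro power_increasing) auto
    then have "2 / real Q ^ Suc a \<le> 2 / Q" using Q by (intro divide_left_mono) auto
    moreover have "real Q ^ (Suc a + 1) \<le> real Q ^ Suc b"
      using Q that by (intro power_increasing) auto
    then have "6 * real Q ^ Suc a / real Q ^ Suc b \<le> 6 / Q" using Q by (simp add: field_simps)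
    ultimately show ?thesis by linarith
  qed
  have Q_pow: "\<bar>real Q ^ Suc a\<bar> = real Q ^ Suc a" "\<bar>s * real Q ^ Suc a\<bar> = real Q ^ Suc a"
    "real Q ^ Suc a \<ge> 1" for a
    using s Q by (simp_all add: abs_mult one_le_power del: power_Suc)
  have nz: "real Q ^ Suc a \<noteq> 0" "s * real Q ^ Suc a \<noteq> 0" for a using Q s by auto
  have affine: "real Q ^ Suc n * (s * x + t) = (s * real Q ^ Suc n) * x + real Q ^ Suc n * t" for x
    by (simp add: algebra_simps)
  show ?thesis
  proof (cases "m < n")
    case True
    have "measure lborel {x\<in>J. first_digit r (real Q ^ Suc m * x + 0) = i \<and>
        first_digit r ((s * real Q ^ Suc n) * x + real Q ^ Suc n * t) = j}
      \<le> measure lborel J / r\<^sup>2 + 2 / real Q ^ Suc m + 6 * real Q ^ Suc m / real Q ^ Suc n"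
      using measure_two_first_digits_le[OF J _ nz(2) r, of "real Q ^ Suc m"] by (simp only: Q_pow)
    with error[OF True] show ?thesis by (simp only: affine add_0_right)
  next
    case False
    with \<open>m \<noteq> n\<close> have "n < m" by simp
    have "measure lborel {x\<in>J. first_digit r ((s * real Q ^ Suc n) * x + real Q ^ Suc n * t) = j \<and>
        first_digit r (real Q ^ Suc m * x + 0) = i}
      \<le> measure lborel J / r\<^sup>2 + 2 / real Q ^ Suc n + 6 * real Q ^ Suc n / real Q ^ Suc m"
      using measure_two_first_digits_le[OF J _ nz(1) r, of "s * real Q ^ Suc n"]
      by (simp only: Q_pow)
    with error[OF \<open>n < m\<close>] show ?thesis by (simp only: affine add_0_right conj_commute)
  qed
qed

definition arc_index :: "nat \<Rightarrow> real \<Rightarrow> nat" where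
  "arc_index M x = nat (\<lfloor>real M * x\<rfloor> mod int M)"

definition lacunary_colour :: "nat \<Rightarrow> nat \<Rightarrow> nat \<Rightarrow> real \<Rightarrow> nat" where
  "lacunary_colour r M Q x = first_digit r (real Q ^ Suc (arc_index M x) * x)"

lemma measurable_arc_index [measurable]: "arc_index M \<in> measurable borel (count_space UNIV)"
  unfolding arc_index_def by measurable

lemma measurable_same_arc [measurable]:
  "Measurable.pred borel (\<lambda>x. arc_index M x = arc_index M (s * x + t))"
proof -
  have "arc_index M x = arc_index M (s * x + t) \<longleftrightarrow>
      (\<exists>i. arc_index M x = i \<and> arc_index M (s * x + t) = i)" for x
    by auto
  then show ?thesis by (simp only:) measurable
qed

lemma measurable_lacunary_colour [measurable]:
  "lacunary_colour r M Q \<in> measurable borel (count_space UNIV)"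
  unfolding lacunary_colour_def by measurable

lemma arc_index_add_of_int: "arc_index M (x + of_int k) = arc_index M x"
proof -
  have "real M * (x + of_int k) = real M * x + of_int (int M * k)" by (simp add: algebra_simps)
  then show ?thesis unfolding arc_index_def by (simp only: floor_add_int[symmetric] mod_mult_self2)
qed

lemma lacunary_colour_add_of_int: "lacunary_colour r M Q (x + of_int k) = lacunary_colour r M Q x"
proof -
  have "real Q ^ n * (x + of_int k) = real Q ^ n * x + of_int (int Q ^ n * k)" for n
    by (simp add: algebra_simps)
  then show ?thesis
    unfolding lacunary_colour_def arc_index_add_of_int by (simp only: first_digit_add_of_int)
qed

text \<open>
  The maps \<open>x \<mapsto> s x + t\<close> of the circle of length \<open>1\<close> that are reflections, or rotations by at least a
  quarter turn.
\<close>

definition far_circle_isometry :: "real \<Rightarrow> real \<Rightarrow> bool" where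
  "far_circle_isometry s t \<longleftrightarrow> s = -1 \<or> s = 1 \<and> frac t \<in> {1/4..3/4}"

lemma floor_eq_real_interval:
  "M > 0 \<Longrightarrow> {x. \<lfloor>real M * x\<rfloor> = a} = {real_of_int a / M..<(real_of_int a + 1) / M}"
  by (auto simp: floor_eq_iff field_simps)

lemma arc_index_rotation_neq:
  assumes M: "M \<ge> 4" and t: "frac t \<in> {1/4..3/4}"
  shows "arc_index M x \<noteq> arc_index M (x + t)"
proof
  assume "arc_index M x = arc_index M (x + t)"
  from this[symmetric] have "\<lfloor>real M * (x + t)\<rfloor> mod int M = \<lfloor>real M * x\<rfloor> mod int M"
    using M by (simp add: arc_index_def eq_nat_nat_iff)
  then obtain k where "\<lfloor>real M * (x + t)\<rfloor> = \<lfloor>real M * x\<rfloor> + int M * k"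
    by (metis mod_eqE add.commute)
  then have "\<bar>real M * t - real M * real_of_int k\<bar> < 1"
    using floor_correct[of "real M * (x + t)"] floor_correct[of "real M * x"]
    by (simp add: distrib_left) linarith
  then have "real M * \<bar>t - real_of_int k\<bar> < 1" by (simp add: abs_mult flip: right_diff_distrib)
  moreover have "real M * (1 / 4) \<le> real M * \<bar>t - real_of_int k\<bar>"
  proof (rule mult_left_mono)
    have "k \<le> \<lfloor>t\<rfloor> \<or> k \<ge> \<lfloor>t\<rfloor> + 1" by linarith
    then show "1 / 4 \<le> \<bar>t - real_of_int k\<bar>" using t by (auto simp: frac_def)
  qed simp
  ultimately show False using M by simp
qed

lemma arc_index_reflection_eq:
  assumes M: "M \<ge> 1" and x: "x \<in> {0..<1}" and eq: "arc_index M (t - x) = arc_index M x"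
  shows "\<exists>k\<in>{\<lfloor>t\<rfloor> - 1, \<lfloor>t\<rfloor>}. \<lfloor>real M * x\<rfloor> = \<lfloor>real M * (t - real_of_int k) / 2\<rfloor>"
proof -
  have "\<lfloor>real M * (t - x)\<rfloor> mod int M = \<lfloor>real M * x\<rfloor> mod int M"
    using M eq by (simp add: arc_index_def eq_nat_nat_iff)
  then obtain k where k: "\<lfloor>real M * (t - x)\<rfloor> = \<lfloor>real M * x\<rfloor> + int M * k"
    by (metis mod_eqE add.commute)
  define y where "y = real M * (t - real_of_int k) / 2"
  have "2 * y = real M * (t - real_of_int k)" by (simp add: y_def)
  also have "\<dots> = real M * (t - x) + real M * x - real M * real_of_int k"
    by (simp add: algebra_simps)
  finally have "2 * y = real M * (t - x) + real M * x - real M * real_of_int k" .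
  then have floor_y: "\<lfloor>real M * x\<rfloor> = \<lfloor>y\<rfloor>"
    using arg_cong[OF k, of real_of_int] floor_correct[of "real M * (t - x)"]
      floor_correct[of "real M * x"]
    by (intro floor_unique[symmetric]) (simp_all del: of_int_floor_le, linarith+)
  have "0 \<le> real M * x" "real M * x < real M" using x M by auto
  then have "0 \<le> \<lfloor>y\<rfloor>" "\<lfloor>y\<rfloor> < int M" unfolding floor_y[symmetric] by (simp_all add: floor_less_iff)
  then have "0 \<le> y" "y < real M" by (simp_all add: floor_less_iff)
  then have "0 \<le> t - real_of_int k" "t - real_of_int k < 2"
    using M by (simp_all add: y_def zero_le_mult_iff)
  then have "k = \<lfloor>t\<rfloor> - 1 \<or> k = \<lfloor>t\<rfloor>" by linarith
  then show ?thesis using floor_y unfolding y_def by blast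
qed

lemma measure_same_arc_le:
  assumes M: "M \<ge> 4" and st: "far_circle_isometry s t"
  shows "measure lborel {x\<in>{0..<1}. arc_index M x = arc_index M (s * x + t)} \<le> 2 / M"
proof (cases "s = -1")
  case True
  define K where "K = {\<lfloor>t\<rfloor> - 1, \<lfloor>t\<rfloor>}"
  define A where "A k = {x. \<lfloor>real M * x\<rfloor> = \<lfloor>real M * (t - real_of_int k) / 2\<rfloor>}" for k
  have A: "A k \<in> fmeasurable lborel" "measure lborel (A k) = 1 / M" for k
    using M by (simp_all add: A_def floor_eq_real_interval fmeasurable_def add_divide_distrib)
  have "{x\<in>{0..<1}. arc_index M x = arc_index M (s * x + t)} \<subseteq> (\<Union>k\<in>K. A k)"
  proof
    fix x assume "x \<in> {x\<in>{0..<1}. arc_index M x = arc_index M (s * x + t)}"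
    then show "x \<in> (\<Union>k\<in>K. A k)"
      using arc_index_reflection_eq[of M x t] M True by (simp add: K_def A_def)
  qed
  then have "measure lborel {x\<in>{0..<1}. arc_index M x = arc_index M (s * x + t)} \<le>
      measure lborel (\<Union>k\<in>K. A k)"
    using A by (intro measure_mono_fmeasurable fmeasurable.finite_UN) (auto simp: K_def)
  also have "\<dots> \<le> (\<Sum>k\<in>K. measure lborel (A k))"
    using A(1) by (intro measure_UNION_le fmeasurableD) (auto simp: K_def)
  also have "\<dots> = 2 / M" by (simp add: A K_def)
  finally show ?thesis .
next
  case False
  then have "{x\<in>{0..<1}. arc_index M x = arc_index M (s * x + t)} = {}"
    using arc_index_rotation_neq[OF M, of t] st by (auto simp: far_circle_isometry_def)
  then show ?thesis by (simp only: measure_empty) simp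
qed

definition arc_overlap :: "nat \<Rightarrow> real \<Rightarrow> real \<Rightarrow> int \<times> int \<Rightarrow> real set" where
  "arc_overlap M s t = (\<lambda>(a, b). {x. \<lfloor>real M * x\<rfloor> = a \<and> \<lfloor>real M * (s * x + t)\<rfloor> = b})"

definition off_diagonal_arcs :: "nat \<Rightarrow> real \<Rightarrow> (int \<times> int) set" where
  "off_diagonal_arcs M t = {(a, b) \<in> {0..<int M} \<times> {\<lfloor>real M * t\<rfloor> - int M..\<lfloor>real M * t\<rfloor> + int M}.
    a mod int M \<noteq> b mod int M}"

lemma off_diagonal_arcs_finite: "finite (off_diagonal_arcs M t)"
  and card_off_diagonal_arcs_le: "real (card (off_diagonal_arcs M t)) \<le> 3 * (real M)\<^sup>2"
proof -
  have subset: "off_diagonal_arcs M t \<subseteq> {0..<int M} \<times> {\<lfloor>real M * t\<rfloor> - int M..\<lfloor>real M * t\<rfloor> + int M}"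
    by (auto simp: off_diagonal_arcs_def)
  then show "finite (off_diagonal_arcs M t)" by (rule finite_subset) simp
  have "card (off_diagonal_arcs M t) \<le> M * (2 * M + 1)"
    using card_mono[OF _ subset]
    by (simp add: card_cartesian_product nat_add_distrib nat_mult_distrib)
  also have "\<dots> \<le> 3 * M\<^sup>2" by (simp add: power2_eq_square)
  finally have "real (card (off_diagonal_arcs M t)) \<le> real (3 * M\<^sup>2)" by (simp only: of_nat_le_iff)
  then show "real (card (off_diagonal_arcs M t)) \<le> 3 * (real M)\<^sup>2" by simp
qed

lemma mem_off_diagonal_arcs:
  assumes s: "\<bar>s\<bar> = 1" and M: "M \<ge> 1" and x: "x \<in> {0..<1::real}"
    and neq: "arc_index M x \<noteq> arc_index M (s * x + t)"
  shows "(\<lfloor>real M * x\<rfloor>, \<lfloor>real M * (s * x + t)\<rfloor>) \<in> off_diagonal_arcs M t"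
proof -
  have Mx: "0 \<le> real M * x" "real M * x < real M" using x M by auto
  have "s = 1 \<or> s = -1" using s by auto
  then have "real M * (s * x + t) = real M * t + real M * x \<or>
      real M * (s * x + t) = real M * t - real M * x"
    by (auto simp: algebra_simps)
  then have "\<lfloor>real M * (s * x + t)\<rfloor> \<in> {\<lfloor>real M * t\<rfloor> - int M..\<lfloor>real M * t\<rfloor> + int M}"
    using Mx unfolding atLeastAtMost_iff by linarith
  moreover have "\<lfloor>real M * x\<rfloor> \<in> {0..<int M}" using Mx by (simp add: floor_less_iff)
  ultimately show ?thesis using neq by (auto simp: off_diagonal_arcs_def arc_index_def)
qed

lemma convex_arc_overlap: "convex (arc_overlap M s t k)"
proof -
  obtain a b where k: "k = (a, b)" by force
  have "arc_overlap M s t k = {x. \<lfloor>real M * x + 0\<rfloor> = a} \<inter> {x. \<lfloor>(real M * s) * x + real M * t\<rfloor> = b}"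
    by (auto simp: k arc_overlap_def algebra_simps)
  then show ?thesis by (simp only: convex_Int convex_floor_affine_eq)
qed

lemma arc_overlap_subset: "k \<in> off_diagonal_arcs M t \<Longrightarrow> arc_overlap M s t k \<subseteq> {0..<1}"
proof
  fix x assume "k \<in> off_diagonal_arcs M t" "x \<in> arc_overlap M s t k"
  then have "0 \<le> \<lfloor>real M * x\<rfloor>" "\<lfloor>real M * x\<rfloor> < int M"
    by (auto simp: off_diagonal_arcs_def arc_overlap_def)
  then have "0 \<le> real M * x" "real M * x < real M" by (simp_all add: floor_less_iff)
  then show "x \<in> {0..<1}" by (cases "M = 0") (auto simp: zero_le_mult_iff)
qed

lemma sets_arc_overlap: "arc_overlap M s t k \<in> sets borel"
  using convex_arc_overlap
  by (intro real_interval_borel_measurable) (simp add: is_interval_convex_1)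

lemma fmeasurable_unit_subset:
  assumes "A \<subseteq> {0..<1::real}" "A \<in> sets borel"
  shows "A \<in> fmeasurable lborel"
  by (rule fmeasurableI2[of "{0..<1}"]) (use assms in \<open>auto simp: fmeasurable_def\<close>)

lemma measure_unit_subset_le:
  assumes "A \<subseteq> {0..<1::real}" "A \<in> sets borel"
  shows "measure lborel A \<le> 1"
  using measure_mono_fmeasurable[of A "{0..<1}" lborel] assms by (simp add: fmeasurable_def)

lemma sum_arc_overlap_le: "(\<Sum>k\<in>off_diagonal_arcs M t. measure lborel (arc_overlap M s t k)) \<le> 1"
proof -
  have "pairwise (\<lambda>j k. disjnt (arc_overlap M s t j) (arc_overlap M s t k)) (off_diagonal_arcs M t)"
    unfolding pairwise_def disjnt_def by (auto simp: arc_overlap_def)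
  then have "(\<Sum>k\<in>off_diagonal_arcs M t. measure lborel (arc_overlap M s t k)) =
      measure lborel (\<Union>k\<in>off_diagonal_arcs M t. arc_overlap M s t k)"
    using off_diagonal_arcs_finite fmeasurable_unit_subset[OF arc_overlap_subset sets_arc_overlap]
    by (intro measure_UNION'[symmetric])
  also have "\<dots> \<le> 1"
    using arc_overlap_subset off_diagonal_arcs_finite sets_arc_overlap
    by (intro measure_unit_subset_le UN_least sets.finite_UN) auto
  finally show ?thesis .
qed

definition monochromatic_overlap ::
  "nat \<Rightarrow> nat \<Rightarrow> nat \<Rightarrow> real \<Rightarrow> real \<Rightarrow> nat \<Rightarrow> int \<times> int \<Rightarrow> real set" where
  "monochromatic_overlap r M Q s t i k =
    {x\<in>arc_overlap M s t k. lacunary_colour r M Q x = i \<and> lacunary_colour r M Q (s * x + t) = i}"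

lemma sets_monochromatic_overlap: "monochromatic_overlap r M Q s t i k \<in> sets borel"
proof -
  note [measurable] = sets_arc_overlap
  show ?thesis unfolding monochromatic_overlap_def by measurable
qed

lemma monochromatic_overlap_subset:
  "k \<in> off_diagonal_arcs M t \<Longrightarrow> monochromatic_overlap r M Q s t i k \<subseteq> {0..<1}"
  using arc_overlap_subset[of k M t s] by (auto simp: monochromatic_overlap_def)

lemma measure_monochromatic_overlap_le:
  fixes s t :: real and r i M Q :: nat
  assumes r: "r \<ge> 1" and M: "M \<ge> 1" and Q: "Q \<ge> 1" and s: "\<bar>s\<bar> = 1"
    and k: "k \<in> off_diagonal_arcs M t"
  shows "measure lborel (monochromatic_overlap r M Q s t i k)
    \<le> measure lborel (arc_overlap M s t k) / r\<^sup>2 + 8 / Q"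
proof -
  define index where "index a = nat (a mod int M)" for a
  obtain a b where ab: "k = (a, b)" "index a \<noteq> index b"
    using k M by (auto simp: off_diagonal_arcs_def index_def eq_nat_nat_iff)
  have "bounded (arc_overlap M s t k)"
    using arc_overlap_subset[OF k, of s]
    by (intro bounded_subset[OF bounded_closed_interval[of 0 "1::real"]]) auto
  moreover have "monochromatic_overlap r M Q s t i k =
      {x\<in>arc_overlap M s t k. first_digit r (real Q ^ Suc (index a) * x) = i \<and>
        first_digit r (real Q ^ Suc (index b) * (s * x + t)) = i}"
    by (auto simp: monochromatic_overlap_def ab(1) arc_overlap_def lacunary_colour_def arc_index_def index_def)
  ultimately show ?thesis
    using measure_lacunary_digits_le[OF convex_arc_overlap _ _ r Q s ab(2),
        where i = i and j = i and t = t]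
      measure_unit_subset_le[OF arc_overlap_subset[OF k] sets_arc_overlap]
    by simp
qed

lemma measure_lacunary_off_diagonal_le:
  fixes s t :: real and r i M Q :: nat
  assumes r: "r \<ge> 1" and M: "M \<ge> 1" and Q: "Q \<ge> 1" and s: "\<bar>s\<bar> = 1"
  shows "measure lborel {x\<in>{0..<1}. arc_index M x \<noteq> arc_index M (s * x + t) \<and>
      lacunary_colour r M Q x = i \<and> lacunary_colour r M Q (s * x + t) = i}
    \<le> 1 / r\<^sup>2 + 24 * M\<^sup>2 / Q"
    (is "measure lborel ?A \<le> _")
proof -
  let ?P = "off_diagonal_arcs M t" and ?C = "arc_overlap M s t"
    and ?D = "monochromatic_overlap r M Q s t i"
  have D: "?D k \<in> fmeasurable lborel" if "k \<in> ?P" for k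
    using monochromatic_overlap_subset[OF that] sets_monochromatic_overlap
    by (rule fmeasurable_unit_subset)
  have "?A \<subseteq> (\<Union>k\<in>?P. ?D k)"
  proof
    fix x assume x: "x \<in> ?A"
    then have "x \<in> ?D (\<lfloor>real M * x\<rfloor>, \<lfloor>real M * (s * x + t)\<rfloor>)"
      by (simp add: monochromatic_overlap_def arc_overlap_def)
    then show "x \<in> (\<Union>k\<in>?P. ?D k)" using mem_off_diagonal_arcs[OF s M, of x t] x by blast
  qed
  then have "measure lborel ?A \<le> measure lborel (\<Union>k\<in>?P. ?D k)"
    using off_diagonal_arcs_finite D by (intro measure_mono_fmeasurable fmeasurable.finite_UN) auto
  also have "\<dots> \<le> (\<Sum>k\<in>?P. measure lborel (?D k))"
    using off_diagonal_arcs_finite D by (intro measure_UNION_le fmeasurableD)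
  also have "\<dots> \<le> (\<Sum>k\<in>?P. measure lborel (?C k) / r\<^sup>2 + 8 / Q)"
    using r M Q s by (intro sum_mono measure_monochromatic_overlap_le)
  also have "\<dots> = (\<Sum>k\<in>?P. measure lborel (?C k)) / r\<^sup>2 + card ?P * (8 / Q)"
    by (simp add: sum.distrib sum_divide_distrib)
  also have "\<dots> \<le> 1 / r\<^sup>2 + 3 * (real M)\<^sup>2 * (8 / Q)"
    by (intro add_mono divide_right_mono mult_right_mono sum_arc_overlap_le card_off_diagonal_arcs_le) auto
  finally show ?thesis by simp
qed

lemma measure_lacunary_colour_le:
  fixes s t :: real and r i M Q :: nat
  assumes r: "r \<ge> 1" and M: "M \<ge> 4" and Q: "Q \<ge> 1" and st: "far_circle_isometry s t"
  shows "measure lborel {x\<in>{0..<1}. lacunary_colour r M Q x = i \<and>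
      lacunary_colour r M Q (s * x + t) = i}
    \<le> 1 / r\<^sup>2 + 24 * M\<^sup>2 / Q + 2 / M"
    (is "measure lborel ?A \<le> _")
proof -
  let ?D = "{x\<in>{0..<1}. arc_index M x = arc_index M (s * x + t)}"
  let ?O = "{x\<in>{0..<1}. arc_index M x \<noteq> arc_index M (s * x + t) \<and>
    lacunary_colour r M Q x = i \<and> lacunary_colour r M Q (s * x + t) = i}"
  have fm: "{x\<in>{0..<1::real}. P x} \<in> fmeasurable lborel"
    if [measurable]: "Measurable.pred borel P" for P
    by (rule fmeasurable_unit_subset) auto
  have "measure lborel ?A \<le> measure lborel (?O \<union> ?D)"
    by (intro measure_mono_fmeasurable fmeasurable.Un fm) auto
  also have "\<dots> \<le> measure lborel ?O + measure lborel ?D"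
    by (intro measure_Un_le fmeasurableD fm) measurable
  also have "\<dots> \<le> (1 / r\<^sup>2 + 24 * M\<^sup>2 / Q) + 2 / M"
    using r M Q st by (intro add_mono measure_lacunary_off_diagonal_le measure_same_arc_le)
      (auto simp: far_circle_isometry_def)
  finally show ?thesis .
qed

lemma lacunary_colouring:
  fixes r :: nat and \<delta> :: real
  assumes "r \<ge> 1" "\<delta> > 0"
  obtains c :: "real \<Rightarrow> nat"
    where "c \<in> measurable borel (count_space UNIV)" "\<And>x. c x < r" "\<And>x. c (frac x) = c x"
    "\<And>s t i. far_circle_isometry s t \<Longrightarrow> measure lborel {x\<in>{0..<1}. c x = i \<and> c (s * x + t) = i} \<le>
        1 / r\<^sup>2 + \<delta>"
proof -
  obtain M0 :: nat where "4 / \<delta> < M0" using reals_Archimedean2 by blast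
  then have "4 / \<delta> \<le> real (max 4 M0)" by simp
  then obtain M :: nat where M: "M \<ge> 4" "2 / M \<le> \<delta> / 2"
    using assms by (intro that[of "max 4 M0"]) (simp_all add: field_simps)
  obtain Q0 :: nat where "48 * M\<^sup>2 / \<delta> < Q0" using reals_Archimedean2 by blast
  then have "48 * M\<^sup>2 / \<delta> \<le> real (max 1 Q0)" by simp
  then obtain Q :: nat where Q: "Q \<ge> 1" "24 * M\<^sup>2 / Q \<le> \<delta> / 2"
    using assms by (intro that[of "max 1 Q0"]) (simp_all add: field_simps)
  show ?thesis
  proof (rule that[of "lacunary_colour r M Q"])
    show "lacunary_colour r M Q (frac x) = lacunary_colour r M Q x" for x
      using lacunary_colour_add_of_int[of r M Q x "- \<lfloor>x\<rfloor>"] by (simp add: frac_def)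
    fix s t :: real and i assume "far_circle_isometry s t"
    then show "measure lborel {x\<in>{0..<1}. lacunary_colour r M Q x = i \<and>
        lacunary_colour r M Q (s * x + t) = i}
        \<le> 1 / r\<^sup>2 + \<delta>"
      using measure_lacunary_colour_le[OF assms(1) M(1) Q(1), of s t i] M(2) Q(2) by linarith
  qed (use assms in \<open>simp_all add: lacunary_colour_def first_digit_less\<close>)
qed

section \<open>Infinite symmetry groups\<close>

lemma infinite_circle_subgroup_accumulates_at_1:
  fixes U :: "complex set"
  assumes U: "U \<subseteq> sphere 0 1" "infinite U"
    and mult: "\<And>u v. u \<in> U \<Longrightarrow> v \<in> U \<Longrightarrow> u * v \<in> U" and cnj: "\<And>u. u \<in> U \<Longrightarrow> cnj u \<in> U" and "d > 0"
  shows "\<exists>v\<in>U. v \<noteq> 1 \<and> dist v 1 < d"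
proof -
  obtain x where x: "x islimpt U"
    using U compact_sphere[of "0::complex" 1] unfolding compact_eq_Bolzano_Weierstrass by blast
  have "d / 2 > 0" using \<open>d > 0\<close> by simp
  then obtain u where u: "u \<in> U" "u \<noteq> x" "dist u x < d / 2" using x
    unfolding islimpt_approachable by blast
  have "min (d / 2) (dist u x) > 0" using \<open>d / 2 > 0\<close> u by simp
  then obtain u' where u': "u' \<in> U" "u' \<noteq> x" "dist u' x < min (d / 2) (dist u x)"
    using x unfolding islimpt_approachable by meson
  have "norm u = 1" using U(1) u(1) by auto
  then have "u' * cnj u - 1 = (u' - u) * cnj u"
    using norm_1_mult_cnj[of u] by (simp add: left_diff_distrib)
  then have dist_eq: "dist (u' * cnj u) 1 = dist u' u"
    using \<open>norm u = 1\<close> by (simp add: dist_norm norm_mult)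
  moreover have "u' \<noteq> u" using u' by auto
  ultimately have "u' * cnj u \<noteq> 1" by auto
  moreover have "dist u' u < d" using u u' dist_triangle2[of u' u x] by simp
  ultimately show ?thesis using mult[OF u'(1) cnj[OF u(1)]] dist_eq by auto
qed

lemma infinite_circle_subgroup_small_angle:
  fixes U :: "complex set"
  assumes U: "U \<subseteq> sphere 0 1" "infinite U"
    and mult: "\<And>u v. u \<in> U \<Longrightarrow> v \<in> U \<Longrightarrow> u * v \<in> U" and cnj: "\<And>u. u \<in> U \<Longrightarrow> cnj u \<in> U" and "d > 0"
  obtains \<alpha> where "0 < \<alpha>" "\<alpha> < d" "cis \<alpha> \<in> U"
proof -
  have "isCont Arg 1" by (rule continuous_at_Arg) auto
  then obtain e where e: "e > 0" "\<And>v. dist v 1 < e \<Longrightarrow> dist (Arg v) (Arg 1) < d"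
    using \<open>d > 0\<close> unfolding continuous_at_eps_delta by (metis dist_commute)
  obtain v where v: "v \<in> U" "v \<noteq> 1" "dist v 1 < e"
    using infinite_circle_subgroup_accumulates_at_1[OF U mult cnj e(1)] by blast
  have small: "\<bar>Arg v\<bar> < d" using e(2)[OF v(3)] by (simp add: dist_real_def)
  have "norm v = 1" using U(1) v(1) by auto
  then have v_cis: "v = cis (Arg v)" using rcis_cmod_Arg[of v] by (simp add: rcis_def)
  then have "Arg v \<noteq> 0" using v(2) by auto
  moreover have "cis (- Arg v) \<in> U" using cnj[OF v(1)] v_cis by (metis cis_cnj)
  ultimately show ?thesis
    using that[of "Arg v"] that[of "- Arg v"] small v(1) v_cis by (cases "Arg v > 0") auto
qed

lemma cis_power_near:
  assumes "\<alpha> > 0" "\<phi> \<ge> 0"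
  shows "\<exists>k. dist (cis \<alpha> ^ k) (cis \<phi>) < \<alpha>"
proof
  define k where "k = nat \<lfloor>\<phi> / \<alpha>\<rfloor>"
  define \<beta> where "\<beta> = \<phi> - k * \<alpha>"
  have "real k \<le> \<phi> / \<alpha>" "\<phi> / \<alpha> < real k + 1" using assms by (auto simp: k_def)
  then have \<beta>: "0 \<le> \<beta>" "\<beta> < \<alpha>" using assms by (auto simp: \<beta>_def field_simps)
  have "cis \<phi> = cis \<alpha> ^ k * cis \<beta>" by (simp add: Complex.DeMoivre cis_mult \<beta>_def)
  then have "dist (cis \<alpha> ^ k) (cis \<phi>) = norm (cis \<alpha> ^ k * (1 - cis \<beta>))"
    by (simp add: dist_norm right_diff_distrib)
  also have "\<dots> = norm (cis \<beta> - 1)" by (simp add: norm_mult norm_power norm_minus_commute)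
  also have "\<dots> = 2 * \<bar>sin (\<beta> / 2)\<bar>" using dist_exp_i_1[of \<beta>] by (simp add: cis_conv_exp dist_norm)
  also have "\<dots> \<le> \<beta>" using abs_sin_x_le_abs_x[of "\<beta> / 2"] \<beta> by simp
  finally show "dist (cis \<alpha> ^ k) (cis \<phi>) < \<alpha>" using \<beta> by simp
qed

lemma closed_infinite_circle_subgroup:
  fixes U :: "complex set"
  assumes U: "U \<subseteq> sphere 0 1" "infinite U" "closed U" and one: "1 \<in> U"
    and mult: "\<And>u v. u \<in> U \<Longrightarrow> v \<in> U \<Longrightarrow> u * v \<in> U" and cnj: "\<And>u. u \<in> U \<Longrightarrow> cnj u \<in> U"
  shows "U = sphere 0 1"
proof
  show "sphere 0 1 \<subseteq> U"
  proof
    fix w :: complex assume "w \<in> sphere 0 1"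
    then have w: "w = cis (Arg2pi w)" using complex_norm_eq_1_exp[of w] by (simp add: cis_conv_exp)
    have "\<exists>u\<in>U. dist u w < d" if d: "d > 0" for d
    proof -
      obtain \<alpha> where \<alpha>: "0 < \<alpha>" "\<alpha> < d" "cis \<alpha> \<in> U"
        using infinite_circle_subgroup_small_angle[OF U(1,2) mult cnj d] .
      obtain k where "dist (cis \<alpha> ^ k) w < \<alpha>" using cis_power_near[OF \<alpha>(1) Arg2pi_ge_0] w by metis
      moreover have "cis \<alpha> ^ k \<in> U" by (induction k) (simp_all add: one mult[OF \<alpha>(3)])
      ultimately show ?thesis using \<alpha>(2) by (intro bexI[of _ "cis \<alpha> ^ k"]) auto
    qed
    then show "w \<in> U" using closed_approachable[OF U(3)] by blast
  qed
qed (rule U(1))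

lemma closed_rotations:
  assumes "closed Y"
  shows "closed (rotations Y)"
proof -
  have "rotations Y = sphere 0 1 \<inter> (\<Inter>y\<in>Y. (\<lambda>u. u * y) -` Y \<inter> (\<lambda>u. cnj u * y) -` Y)"
    by (auto simp: rotations_iff)
  moreover have "closed ((\<lambda>u. u * y) -` Y)" "closed ((\<lambda>u. cnj u * y) -` Y)" for y
    using assms by (intro continuous_closed_vimage continuous_intros; simp)+
  ultimately show ?thesis by (simp add: closed_INT closed_Int)
qed

abbreviation circle_interval :: "real measure" where
  "circle_interval \<equiv> restrict_space lborel {0..<1}"

abbreviation turn :: "real \<Rightarrow> complex" where
  "turn t \<equiv> cis (2 * pi * t)"

lemma emeasure_circle_interval [simp]: "emeasure circle_interval {0..<1} = 1"
  by (simp add: emeasure_restrict_space)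

lemma prob_space_circle_interval: "prob_space circle_interval"
  by (rule prob_spaceI) (simp add: space_restrict_space)

lemma turn_frac: "turn (frac t) = turn t"
proof -
  have "turn t = turn (frac t) * turn (of_int \<lfloor>t\<rfloor>)" by (simp add: cis_mult frac_def algebra_simps)
  moreover have "turn (of_int \<lfloor>t\<rfloor>) = 1" by (rule cis_multiple_2pi) simp
  ultimately show ?thesis by simp
qed

lemma turn_add: "turn (s + t) = turn s * turn t"
  by (simp add: cis_mult distrib_left)

lemma turn_surj:
  assumes "norm u = 1"
  obtains s where "u = turn s"
proof
  show "u = turn (Arg2pi u / (2 * pi))"
    using assms complex_norm_eq_1_exp[of u] by (simp add: cis_conv_exp)
qed

lemma measurable_turn [measurable]: "(\<lambda>t. turn t) \<in> borel_measurable borel"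
  by (intro borel_measurable_continuous_onI continuous_intros)

lemma measurable_cnj [measurable]: "cnj \<in> borel_measurable borel"
  by (rule borel_measurable_isometry[OF isometry_cnj])

lemma measurable_frac_shift:
  "(\<lambda>t. frac (t + s)) \<in> measurable circle_interval circle_interval"
proof (rule measurable_restrict_space2)
  show "(\<lambda>t. frac (t + s)) \<in> measurable circle_interval lborel"
    unfolding frac_def by (rule measurable_restrict_space1) measurable
qed (simp add: frac_lt_1)

lemma distr_frac_shift: "distr circle_interval circle_interval (\<lambda>t. frac (t + s)) = circle_interval"
proof (rule measure_eqI)
  define \<sigma> where "\<sigma> = frac s"
  have \<sigma>: "0 \<le> \<sigma>" "\<sigma> < 1" by (simp_all add: \<sigma>_def frac_lt_1)
  have frac_\<sigma>: "frac (t + s) = frac (t + \<sigma>)" for t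
    by (simp add: \<sigma>_def)
  have shift: "emeasure lborel {t. t + c \<in> B} = emeasure lborel B"
    if "B \<in> sets borel" for B and c :: real
    using that emeasure_distr[of "(+) c" lborel borel B]
    by (simp add: lborel_distr_plus vimage_def add.commute)
  fix A assume "A \<in> sets (distr circle_interval circle_interval (\<lambda>t. frac (t + s)))"
  then have A: "A \<in> sets circle_interval" "A \<in> sets borel" "A \<subseteq> {0..<1}"
    by (auto simp: sets_restrict_space_iff)
  let ?L = "{t. t + \<sigma> \<in> A \<inter> {\<sigma>..<1}}" and ?R = "{t. t + (\<sigma> - 1) \<in> A \<inter> {0..<\<sigma>}}"
  have pieces: "{t\<in>{0..<1}. frac (t + \<sigma>) \<in> A} = ?L \<union> ?R"
  proof -
    have "frac (t + \<sigma>) = (if t + \<sigma> < 1 then t + \<sigma> else t + (\<sigma> - 1))" if "t \<in> {0..<1}" for t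
      using that \<sigma> by (auto simp: frac_unique_iff)
    then show ?thesis using \<sigma> A(3) by (auto split: if_splits)
  qed
  have "?L \<in> sets borel" "?R \<in> sets borel" using A(2) by measurable
  moreover have "?L \<inter> ?R = {}" by auto
  ultimately have "emeasure lborel (?L \<union> ?R) = emeasure lborel ?L + emeasure lborel ?R"
    by (intro plus_emeasure[symmetric]) auto
  also have "\<dots> = emeasure lborel (A \<inter> {\<sigma>..<1}) + emeasure lborel (A \<inter> {0..<\<sigma>})"
    using shift[of "A \<inter> {\<sigma>..<1}" \<sigma>] shift[of "A \<inter> {0..<\<sigma>}" "\<sigma> - 1"] A(2) by simp
  also have "\<dots> = emeasure lborel (A \<inter> {\<sigma>..<1} \<union> A \<inter> {0..<\<sigma>})"
    using A(2) by (intro plus_emeasure) auto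
  also have "A \<inter> {\<sigma>..<1} \<union> A \<inter> {0..<\<sigma>} = A" using A(3) \<sigma> by auto
  finally have "emeasure lborel {t\<in>{0..<1}. frac (t + s) \<in> A} = emeasure lborel A"
    by (simp only: pieces frac_\<sigma>)
  moreover have "(\<lambda>t. frac (t + s)) -` A \<inter> space circle_interval = {t\<in>{0..<1}. frac (t + s) \<in> A}"
    by (auto simp: space_restrict_space)
  ultimately show "emeasure (distr circle_interval circle_interval (\<lambda>t. frac (t + s))) A =
      emeasure circle_interval A"
    using A
    by (simp add: emeasure_distr[OF measurable_frac_shift] emeasure_restrict_space subset_iff)
qed simp

definition circle_mean :: "(complex \<Rightarrow> ennreal) \<Rightarrow> complex \<Rightarrow> ennreal" where
  "circle_mean f z = (\<integral>\<^sup>+t. f (turn t * z) \<partial>circle_interval)"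

lemma turn_measurable_circle_interval [measurable]:
  "(\<lambda>t. turn t) \<in> borel_measurable circle_interval"
  by (rule measurable_restrict_space1) simp

lemma borel_measurable_circle_mean [measurable]:
  assumes [measurable]: "f \<in> borel_measurable borel"
  shows "circle_mean f \<in> borel_measurable borel"
proof -
  interpret prob_space circle_interval by (rule prob_space_circle_interval)
  show ?thesis unfolding circle_mean_def[abs_def] by measurable
qed

lemma circle_mean_rotate:
  assumes [measurable]: "f \<in> borel_measurable borel" and "norm u = 1"
  shows "circle_mean f (u * z) = circle_mean f z"
proof -
  obtain s where u: "u = turn s" using turn_surj[OF assms(2)] .
  have "turn (frac (t + s)) * z = turn t * (u * z)" for t
    unfolding turn_frac turn_add u by (rule mult.assoc)
  then have "circle_mean f (u * z) = (\<integral>\<^sup>+t. f (turn (frac (t + s)) * z) \<partial>circle_interval)"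
    by (simp only: circle_mean_def)
  also have "\<dots> = (\<integral>\<^sup>+t. f (turn t * z) \<partial>distr circle_interval circle_interval (\<lambda>t. frac (t + s)))"
    by (rule nn_integral_distr[OF measurable_frac_shift, symmetric]) measurable
  also have "\<dots> = circle_mean f z" by (simp only: distr_frac_shift circle_mean_def)
  finally show ?thesis .
qed

lemma circle_mean_cnj:
  assumes "f \<in> borel_measurable borel"
  shows "circle_mean f (cnj z) = circle_mean f z"
proof (cases "z = 0")
  case False
  then have "norm (cnj z / z) = 1" by (simp add: norm_divide)
  from circle_mean_rotate[OF assms this, of z] False show ?thesis by simp
qed simp

lemma exists_multiple_far_from_Ints:
  fixes \<sigma> :: real
  assumes "\<sigma> \<notin> \<int>"
  obtains k :: nat where "frac (real k * \<sigma>) \<in> {1/4..3/4}"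
proof -
  have small: "\<exists>k::nat. 1 / 4 \<le> k * x \<and> k * x \<le> 3 / 4" if "0 < x" "x < 1 / 4" for x :: real
  proof (intro exI conjI)
    let ?k = "nat \<lceil>1 / (4 * x)\<rceil>"
    have "1 / (4 * x) > 0" using that by simp
    then have k: "1 / (4 * x) \<le> ?k" "?k < 1 / (4 * x) + 1" by linarith+
    have "1 / (4 * x) * x \<le> ?k * x" "?k * x \<le> (1 / (4 * x) + 1) * x"
      using k that by (intro mult_right_mono; simp)+
    then show "1 / 4 \<le> ?k * x" "?k * x \<le> 3 / 4" using that by (auto simp: distrib_right)
  qed
  have frac_mult: "frac (real k * \<sigma>) = frac (real k * frac \<sigma>)" for k
  proof -
    have "real k * \<sigma> = real k * frac \<sigma> + of_int (int k * \<lfloor>\<sigma>\<rfloor>)" by (simp add: frac_def algebra_simps)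
    then show ?thesis by (simp only: frac_add_of_int_right)
  qed
  have pos: "frac \<sigma> > 0" using assms by simp
  consider "frac \<sigma> < 1 / 4" | "frac \<sigma> \<in> {1/4..3/4}" | "1 - frac \<sigma> < 1 / 4" by fastforce
  then show ?thesis
  proof cases
    case 1
    then obtain k :: nat where "1 / 4 \<le> k * frac \<sigma>" "k * frac \<sigma> \<le> 3 / 4" using small pos by blast
    then show ?thesis by (intro that[of k]) (simp add: frac_mult)
  next
    case 2
    then show ?thesis by (intro that[of 1]) simp
  next
    case 3
    then obtain k :: nat where k: "1 / 4 \<le> k * (1 - frac \<sigma>)" "k * (1 - frac \<sigma>) \<le> 3 / 4"
      using small[of "1 - frac \<sigma>"] frac_lt_1[of \<sigma>] by auto
    have "real k * frac \<sigma> = (1 - k * (1 - frac \<sigma>)) + of_int (int k - 1)"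
      by (simp add: algebra_simps)
    then have "frac (real k * frac \<sigma>) = frac (1 - k * (1 - frac \<sigma>))"
      by (simp only: frac_add_of_int_right)
    also have "\<dots> = 1 - k * (1 - frac \<sigma>)" using k by simp
    finally show ?thesis using k by (intro that[of k]) (simp add: frac_mult)
  qed
qed

lemma rotation_power_far_turn:
  assumes u: "norm u = 1" "u \<noteq> 1"
  obtains k :: nat and \<tau> where "u ^ k = turn \<tau>" "frac \<tau> \<in> {1/4..3/4}"
proof -
  obtain \<sigma> where \<sigma>: "u = turn \<sigma>" using turn_surj[OF u(1)] .
  then have "\<sigma> \<notin> \<int>" using u(2) cis_multiple_2pi by blast
  then obtain k :: nat where "frac (real k * \<sigma>) \<in> {1/4..3/4}"
    by (rule exists_multiple_far_from_Ints)
  moreover have "u ^ k = turn (real k * \<sigma>)" by (simp add: \<sigma> Complex.DeMoivre mult_ac)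
  ultimately show ?thesis by (intro that)
qed

lemma sum_squares_ennreal_ge:
  fixes a :: "nat \<Rightarrow> ennreal"
  assumes "(\<Sum>i<r. a i) = 1"
  shows "ennreal (1 / r) \<le> (\<Sum>i<r. a i * a i)"
proof -
  have "a i \<le> 1" if "i < r" for i using member_le_sum[of i "{..<r}" a] that assms by simp
  then obtain \<alpha> where \<alpha>: "\<And>i. i < r \<Longrightarrow> a i = ennreal (\<alpha> i)" "\<And>i. i < r \<Longrightarrow> 0 \<le> \<alpha> i"
    by (intro that[of "\<lambda>i. enn2real (a i)"]) (auto simp: le_less_trans[OF _ ennreal_one_less_top])
  have "ennreal (\<Sum>i<r. \<alpha> i) = (\<Sum>i<r. a i)" using \<alpha> by (subst sum_ennreal[symmetric]) auto
  then have sum: "(\<Sum>i<r. \<alpha> i) = 1" using assms \<alpha>(2) by (simp add: sum_nonneg)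
  have "r > 0" using sum by (cases r) auto
  then have "1 / r \<le> (\<Sum>i<r. \<alpha> i * \<alpha> i)"
    using sum_squared_le_sum_of_squares[of \<alpha> "{..<r}"] sum
    by (simp add: field_simps power2_eq_square)
  then have "ennreal (1 / r) \<le> ennreal (\<Sum>i<r. \<alpha> i * \<alpha> i)" by (rule ennreal_leI)
  also have "\<dots> = (\<Sum>i<r. a i * a i)"
    using \<alpha> by (subst sum_ennreal[symmetric]) (auto simp: ennreal_mult)
  finally show ?thesis .
qed

lemma (in centred_plane_set) infinite_Iso_rotations:
  assumes "infinite (carrier (Iso Y))"
  shows "rotations Y = sphere 0 1"
proof (rule closed_infinite_circle_subgroup)
  show "rotations Y \<subseteq> sphere 0 1" by (auto simp: rotations_iff)
  show "infinite (rotations Y)" using assms by (simp add: finite_Iso_iff_finite_rotations)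
  show "closed (rotations Y)" using compact by (intro closed_rotations compact_imp_closed)
qed (rule one_in_rotations mult_in_rotations cnj_in_rotations; assumption?)+

locale circular_plane_set = centred_plane_set +
  assumes rotations_eq: "rotations Y = sphere 0 1"
begin

sublocale measure_preserving_action "normalized_lebesgue Y" "Iso Y" "\<lambda>f x. f x"
  using compact measure_pos by (rule measure_preserving_action_Iso)

sublocale circle: prob_space circle_interval
  by (rule prob_space_circle_interval)

sublocale circle: pair_sigma_finite circle_interval "normalized_lebesgue Y" ..

lemma Y_borel: "Y \<in> sets borel"
  using compact by (rule borel_compact)

lemma measurable_id_normalized_lebesgue [measurable]:
  "(\<lambda>z. z) \<in> borel_measurable (normalized_lebesgue Y)"
  by (rule measurable_normalized_lebesgue_borel) simp

lemma rotate_mem: "norm u = 1 \<Longrightarrow> z \<in> Y \<Longrightarrow> u * z \<in> Y"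
  using rotations_eq rotations_iff[of u Y] by auto

lemma reflections_eq: "reflections Y = sphere 0 1"
proof
  show "sphere 0 1 \<subseteq> reflections Y"
  proof
    fix w :: complex assume w: "w \<in> sphere 0 1"
    have cnj_mem: "cnj z \<in> Y" if "z \<in> Y" for z
    proof (cases "z = 0")
      case False
      then show ?thesis using rotate_mem[of "cnj z / z" z] that by (simp add: norm_divide)
    qed (use that in simp)
    have "cnj ` Y = Y"
    proof
      show "Y \<subseteq> cnj ` Y" using cnj_mem by (metis complex_cnj_cnj image_eqI subsetI)
    qed (use cnj_mem in auto)
    moreover have "surj cnj" by (rule surjI[of _ cnj]) simp
    ultimately have "1 \<in> reflections Y" by (simp add: reflections_def carrier_Iso isometry_cnj)
    then show "w \<in> reflections Y" using rotation_mult_reflection[of w Y 1] w rotations_eq by simp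
  qed
qed (auto dest: norm_reflection)

lemma rotation_in_Iso:
  assumes "norm u = 1"
  shows "(*) u \<in> carrier (Iso Y)"
proof -
  have "u \<in> rotations Y" using assms by (simp add: rotations_eq)
  then show ?thesis by (simp add: rotations_def)
qed

lemma reflection_in_Iso:
  assumes "norm w = 1"
  shows "(\<lambda>z. w * cnj z) \<in> carrier (Iso Y)"
proof -
  have "w \<in> reflections Y" using assms by (simp add: reflections_eq)
  then show ?thesis by (simp add: reflections_def)
qed

lemma nn_integral_circle_mean:
  assumes f[measurable]: "f \<in> borel_measurable borel"
  shows "(\<integral>\<^sup>+z. circle_mean f z \<partial>normalized_lebesgue Y) = (\<integral>\<^sup>+z. f z \<partial>normalized_lebesgue Y)"
proof -
  let ?M = "normalized_lebesgue Y"
  have rotate: "(\<integral>\<^sup>+z. f (turn t * z) \<partial>?M) = (\<integral>\<^sup>+z. f z \<partial>?M)" for t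
  proof -
    have g: "(*) (turn t) \<in> carrier (Iso Y)" by (rule rotation_in_Iso) simp
    have "(\<integral>\<^sup>+z. f z \<partial>?M) = (\<integral>\<^sup>+z. f z \<partial>distr ?M ?M ((*) (turn t)))" by (simp only: distr_act[OF g])
    also have "\<dots> = (\<integral>\<^sup>+z. f (turn t * z) \<partial>?M)"
      using act_measurable[OF g] measurable_normalized_lebesgue_borel[OF f]
      by (simp add: nn_integral_distr)
    finally show ?thesis by simp
  qed
  have "(\<integral>\<^sup>+z. circle_mean f z \<partial>?M) = (\<integral>\<^sup>+t. (\<integral>\<^sup>+z. f (turn t * z) \<partial>?M) \<partial>circle_interval)"
    unfolding circle_mean_def by (rule circle.Fubini') measurable
  also have "\<dots> = (\<integral>\<^sup>+z. f z \<partial>?M)" by (simp add: rotate)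
  finally show ?thesis .
qed

lemma nn_integral_mult_circle_mean:
  assumes [measurable]: "f \<in> borel_measurable borel"
  shows "(\<integral>\<^sup>+z. f z * circle_mean f z \<partial>normalized_lebesgue Y) =
    (\<integral>\<^sup>+z. circle_mean f z * circle_mean f z \<partial>normalized_lebesgue Y)"
proof -
  have "circle_mean (\<lambda>z. f z * circle_mean f z) z = circle_mean f z * circle_mean f z" for z
  proof -
    have "circle_mean (\<lambda>z. f z * circle_mean f z) z =
        (\<integral>\<^sup>+t. f (turn t * z) * circle_mean f z \<partial>circle_interval)"
      by (simp add: circle_mean_def[of "\<lambda>z. f z * circle_mean f z"] circle_mean_rotate)
    also have "\<dots> = circle_mean f z * circle_mean f z"
      by (subst nn_integral_multc) (simp_all add: circle_mean_def)
    finally show ?thesis .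
  qed
  then show ?thesis using nn_integral_circle_mean[of "\<lambda>z. f z * circle_mean f z"] by simp
qed

definition reflection_overlap :: "complex set \<Rightarrow> real \<Rightarrow> complex set" where
  "reflection_overlap C t = {z\<in>C. turn t * cnj z \<in> C}"

lemma sets_reflection_overlap:
  assumes "C \<in> events"
  shows "reflection_overlap C t \<in> events"
proof -
  have C[measurable]: "C \<in> sets borel" and sub: "C \<subseteq> Y"
    using assms Y_borel by (auto simp: sets_normalized_lebesgue)
  have "{z\<in>space borel. z \<in> C \<and> turn t * cnj z \<in> C} \<in> sets borel" by measurable
  then show ?thesis
    using sub Y_borel by (auto simp: sets_normalized_lebesgue reflection_overlap_def)
qed

lemma reflection_overlap_invariant:
  "(\<lambda>z. turn t * cnj z) ` reflection_overlap C t = reflection_overlap C t"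
proof -
  have involution: "turn t * cnj (turn t * cnj z) = z" for z
    by (simp add: cis_cnj mult.assoc[symmetric] cis_mult)
  then have "turn t * cnj z \<in> reflection_overlap C t" if "z \<in> reflection_overlap C t" for z
    using that by (simp add: reflection_overlap_def del: complex_cnj_mult)
  then show ?thesis
    using involution by (metis (no_types, lifting) image_eqI image_subsetI subsetI subset_antisym)
qed

lemma average_reflection_overlap:
  assumes "C \<in> events"
  shows "(\<integral>\<^sup>+t. emeasure (normalized_lebesgue Y) (reflection_overlap C t) \<partial>circle_interval) =
    (\<integral>\<^sup>+z. circle_mean (indicator C) z * circle_mean (indicator C) z \<partial>normalized_lebesgue Y)"
proof -
  let ?M = "normalized_lebesgue Y"
  have C[measurable]: "C \<in> sets borel" using assms Y_borel by (simp add: sets_normalized_lebesgue)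
  have "emeasure ?M (reflection_overlap C t) =
      (\<integral>\<^sup>+z. indicator C z * indicator C (turn t * cnj z) \<partial>?M)" for t
  proof -
    have "emeasure ?M (reflection_overlap C t) = (\<integral>\<^sup>+z. indicator (reflection_overlap C t) z \<partial>?M)"
      using sets_reflection_overlap[OF assms] by simp
    also have "\<dots> = (\<integral>\<^sup>+z. indicator C z * indicator C (turn t * cnj z) \<partial>?M)"
      by (intro nn_integral_cong) (auto simp: reflection_overlap_def indicator_def)
    finally show ?thesis .
  qed
  then have "(\<integral>\<^sup>+t. emeasure ?M (reflection_overlap C t) \<partial>circle_interval) =
      (\<integral>\<^sup>+t. (\<integral>\<^sup>+z. indicator C z * indicator C (turn t * cnj z) \<partial>?M) \<partial>circle_interval)"
    by simp
  also have "\<dots> = (\<integral>\<^sup>+z. (\<integral>\<^sup>+t. indicator C z * indicator C (turn t * cnj z) \<partial>circle_interval) \<partial>?M)"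
    by (rule circle.Fubini'[symmetric]) measurable
  also have "\<dots> = (\<integral>\<^sup>+z. indicator C z * circle_mean (indicator C) z \<partial>?M)"
  proof (rule nn_integral_cong)
    fix z
    have "(\<integral>\<^sup>+t. indicator C z * indicator C (turn t * cnj z) \<partial>circle_interval) =
        indicator C z * circle_mean (indicator C) (cnj z)"
      unfolding circle_mean_def by (rule nn_integral_cmult) measurable
    then show "(\<integral>\<^sup>+t. indicator C z * indicator C (turn t * cnj z) \<partial>circle_interval) =
        indicator C z * circle_mean (indicator C) z"
      by (simp add: circle_mean_cnj)
  qed
  also have "\<dots> = (\<integral>\<^sup>+z. circle_mean (indicator C) z * circle_mean (indicator C) z \<partial>?M)"
    by (rule nn_integral_mult_circle_mean) measurable
  finally show ?thesis .
qed

lemma sets_colour_class: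
  assumes "col \<in> measurable (normalized_lebesgue Y) (count_space S)"
  shows "{z\<in>Y. col z = i} \<in> events"
proof -
  have "Measurable.pred (normalized_lebesgue Y) (\<lambda>z. col z = i)"
    using assms by (rule pred_eq_const1) simp
  then have "{z\<in>space (normalized_lebesgue Y). col z = i} \<in> events" by measurable
  then show ?thesis by simp
qed

lemma sum_circle_mean_colour_classes:
  fixes col :: "complex \<Rightarrow> nat"
  assumes col: "\<And>z. z \<in> Y \<Longrightarrow> col z < r" and meas: "\<And>i. {z\<in>Y. col z = i} \<in> sets borel" and z: "z \<in> Y"
  shows "(\<Sum>i<r. circle_mean (indicator {z\<in>Y. col z = i}) z) = 1"
proof -
  note [measurable] = meas
  have "(\<Sum>i<r. circle_mean (indicator {z\<in>Y. col z = i}) z) =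
      (\<integral>\<^sup>+t. (\<Sum>i<r. indicator {z\<in>Y. col z = i} (turn t * z)) \<partial>circle_interval)"
    unfolding circle_mean_def by (rule nn_integral_sum[symmetric]) measurable
  also have "\<dots> = (\<integral>\<^sup>+t. 1 \<partial>circle_interval)"
  proof (rule nn_integral_cong)
    fix t
    have "turn t * z \<in> Y" using z by (intro rotate_mem) auto
    then show "(\<Sum>i<r. indicator {z\<in>Y. col z = i} (turn t * z)) = (1 :: ennreal)"
      using col by (simp add: indicator_def of_bool_def)
  qed
  finally show ?thesis by simp
qed

text \<open>
  With \<open>a\<^sub>i(z)\<close> the proportion of colour \<open>i\<close> on the circle through \<open>z\<close>, the average over all reflections
  of the measure of the points of colour \<open>i\<close> whose mirror image has colour \<open>i\<close> is the integral of \<open>a\<^sub>i\<^sup>2\<close>,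
  and the \<open>a\<^sub>i\<close> sum to \<open>1\<close>.
\<close>

lemma exists_large_reflection_overlap:
  fixes r :: nat and \<epsilon> :: real
  assumes col: "col \<in> measurable (normalized_lebesgue Y) (count_space {..<r})"
    and r: "r \<ge> 1" and \<epsilon>: "0 \<le> \<epsilon>" "\<epsilon> < 1 / (real r)\<^sup>2"
  shows "\<exists>i<r. \<exists>t. \<epsilon> \<le> prob (reflection_overlap {z\<in>Y. col z = i} t)"
proof (rule ccontr)
  let ?M = "normalized_lebesgue Y"
  let ?a = "\<lambda>i. circle_mean (indicator {z\<in>Y. col z = i})"
  assume "\<not> ?thesis"
  then have small: "prob (reflection_overlap {z\<in>Y. col z = i} t) \<le> \<epsilon>" if "i < r" for i t
    using that by (meson less_imp_le not_le)
  have col_less: "col z < r" if "z \<in> Y" for z using measurable_space[OF col, of z] that by simp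
  note classes = sets_colour_class[OF col]
  then have [measurable]: "{z\<in>Y. col z = i} \<in> sets borel" for i
    using Y_borel by (simp add: sets_normalized_lebesgue)
  have "ennreal (1 / r) = (\<integral>\<^sup>+z. ennreal (1 / r) \<partial>?M)" using emeasure_space_1 by simp
  also have "\<dots> \<le> (\<integral>\<^sup>+z. (\<Sum>i<r. ?a i z * ?a i z) \<partial>?M)"
    by (intro nn_integral_mono sum_squares_ennreal_ge sum_circle_mean_colour_classes col_less) auto
  also have "\<dots> = (\<Sum>i<r. (\<integral>\<^sup>+z. ?a i z * ?a i z \<partial>?M))"
    by (intro nn_integral_sum measurable_normalized_lebesgue_borel) measurable
  also have "\<dots> = (\<Sum>i<r. (\<integral>\<^sup>+t.
      emeasure ?M (reflection_overlap {z\<in>Y. col z = i} t) \<partial>circle_interval))"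
    by (simp only: average_reflection_overlap[OF classes])
  also have "\<dots> \<le> (\<Sum>i<r. (\<integral>\<^sup>+t. ennreal \<epsilon> \<partial>circle_interval))"
    using small by (intro sum_mono nn_integral_mono) (simp add: emeasure_eq_measure ennreal_leI)
  also have "\<dots> = ennreal (r * \<epsilon>)"
    using \<epsilon>(1) by (simp add: ennreal_mult ennreal_of_nat_eq_real_of_nat)
  finally have "1 / r \<le> r * \<epsilon>" using \<epsilon>(1) by (simp add: ennreal_le_iff)
  moreover have "r * \<epsilon> < r * (1 / (real r)\<^sup>2)" using \<epsilon>(2) r by (intro mult_strict_left_mono) auto
  ultimately show False using r by (simp add: power2_eq_square)
qed

lemma ms_set_ge:
  assumes r: "r \<ge> 1"
  shows "1 / (real r)\<^sup>2 \<le> ms_set Y r"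
proof (rule dense_le)
  fix \<epsilon> :: real assume \<epsilon>: "\<epsilon> < 1 / (real r)\<^sup>2"
  show "\<epsilon> \<le> ms_set Y r"
    unfolding ms_set_def
  proof (rule ms_geI[OF prob_space_axioms r])
    assume "\<epsilon> > 0"
    show "admissible (normalized_lebesgue Y) (Iso Y) (\<lambda>f x. f x) r \<epsilon>"
      unfolding admissible_def
    proof
      fix col assume col: "col \<in> measurable (normalized_lebesgue Y) (count_space {..<r})"
      obtain i t where i: "i < r" and large: "\<epsilon> \<le> prob (reflection_overlap {z\<in>Y. col z = i} t)"
        using exists_large_reflection_overlap[OF col r _ \<epsilon>] \<open>\<epsilon> > 0\<close> by auto
      have "reflection_overlap {z\<in>Y. col z = i} t \<in> events"
        using col by (intro sets_reflection_overlap sets_colour_class)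
      moreover have "\<forall>z\<in>reflection_overlap {z\<in>Y. col z = i} t. col z = i"
        by (simp add: reflection_overlap_def)
      moreover have "(\<lambda>z. turn t * cnj z) \<in> carrier (Iso Y)" by (rule reflection_in_Iso) simp
      moreover have "(\<lambda>z. turn t * cnj z) \<noteq> id"
      proof
        assume "(\<lambda>z. turn t * cnj z) = id"
        from fun_cong[OF this, of 1] fun_cong[OF this, of \<i>] show False by simp
      qed
      ultimately show "\<exists>A\<in>events. (\<exists>c<r. \<forall>x\<in>A. col x = c) \<and> \<epsilon> \<le> prob A \<and>
          (\<exists>g\<in>carrier (Iso Y). g \<noteq> \<one>\<^bsub>Iso Y\<^esub> \<and> g ` A = A)"
        using i large reflection_overlap_invariant[of t "{z\<in>Y. col z = i}"]
        by (intro bexI[of _ "reflection_overlap {z\<in>Y. col z = i} t"] conjI exI[of _ i]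
            bexI[of _ "\<lambda>z. turn t * cnj z"])
          simp_all
    qed
  qed
qed

lemma prob_le_angular_measure:
  assumes A: "A \<in> events" and B: "0 \<le> B"
    and angular: "\<And>\<rho>. \<rho> > 0 \<Longrightarrow> measure lborel {t\<in>{0..<1}. turn t * of_real \<rho> \<in> A} \<le> B"
  shows "prob A \<le> B"
proof -
  let ?M = "normalized_lebesgue Y"
  have A_borel[measurable]: "A \<in> sets borel" using A Y_borel by (simp add: sets_normalized_lebesgue)
  have mean: "circle_mean (indicator A) z \<le> ennreal B" if "z \<noteq> 0" for z
  proof -
    have S: "{t\<in>{0..<1}. turn t * of_real (norm z) \<in> A} \<in> sets borel" by measurable
    have "norm (z / of_real (norm z)) = 1" using that by (simp add: norm_divide)
    from circle_mean_rotate[of "indicator A", OF _ this, of "of_real (norm z)"]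
    have "circle_mean (indicator A) z = circle_mean (indicator A) (of_real (norm z))"
      using that by simp
    also have "\<dots> = emeasure lborel {t\<in>{0..<1}. turn t * of_real (norm z) \<in> A}"
    proof -
      have "circle_mean (indicator A) (of_real (norm z)) =
          (\<integral>\<^sup>+t. indicator {t\<in>{0..<1}. turn t * of_real (norm z) \<in> A} t \<partial>circle_interval)"
        unfolding circle_mean_def
        by (intro nn_integral_cong) (auto simp: space_restrict_space indicator_def)
      also have "\<dots> = emeasure circle_interval {t\<in>{0..<1}. turn t * of_real (norm z) \<in> A}"
        using S by (intro nn_integral_indicator) (auto simp: sets_restrict_space_iff)
      also have "\<dots> = emeasure lborel {t\<in>{0..<1}. turn t * of_real (norm z) \<in> A}"
        by (rule emeasure_restrict_space[OF _ Collect_restrict]) simp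
      finally show ?thesis .
    qed
    also have "\<dots> = ennreal (measure lborel {t\<in>{0..<1}. turn t * of_real (norm z) \<in> A})"
      by (intro emeasure_eq_measure2 fmeasurable_unit_subset Collect_restrict S)
    also have "\<dots> \<le> ennreal B" using that by (intro ennreal_leI angular) simp
    finally show ?thesis .
  qed
  have "Y \<inter> {0} \<in> events" using Y_borel by (simp add: sets_normalized_lebesgue)
  moreover from this have "prob (Y \<inter> {0}) = 0"
    by (rule measure_normalized_lebesgue_negligible[OF Y_borel _ negligible_sing]) auto
  ultimately have "Y \<inter> {0} \<in> null_sets ?M" by (simp add: null_sets_def emeasure_eq_measure)
  then have nonzero: "AE z in ?M. z \<noteq> 0" by (rule AE_I') auto
  have "emeasure ?M A = (\<integral>\<^sup>+z. circle_mean (indicator A) z \<partial>?M)"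
    using A by (subst nn_integral_circle_mean) simp_all
  also have "\<dots> \<le> (\<integral>\<^sup>+z. ennreal B \<partial>?M)"
    using nonzero mean by (intro nn_integral_mono_AE) (auto elim: eventually_mono)
  also have "\<dots> = ennreal B" using emeasure_space_1 by simp
  finally show ?thesis using B by (simp add: emeasure_eq_measure ennreal_le_iff)
qed

end

lemma borel_measurable_Arg2pi: "Arg2pi \<in> borel_measurable borel"
  unfolding borel_measurable_iff_greater using open_Arg2pi2pi_gt by (auto intro!: borel_open)

definition angular_colour :: "(real \<Rightarrow> 'c) \<Rightarrow> complex \<Rightarrow> 'c" where
  "angular_colour c z = c (Arg2pi z / (2 * pi))"

lemma angular_colour_turn:
  assumes periodic: "\<And>x. c (frac x) = c x" and "\<rho> > 0"
  shows "angular_colour c (turn t * of_real \<rho>) = c t"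
proof -
  have "Arg2pi (turn (frac t) * of_real \<rho>) = 2 * pi * frac t"
    using \<open>\<rho> > 0\<close> frac_lt_1[of t]
    by (intro Arg2pi_unique[of \<rho>]) (auto simp: cis_conv_exp mult.commute)
  then show ?thesis by (simp add: angular_colour_def turn_frac periodic)
qed

context circular_plane_set
begin

lemma prob_angular_monochromatic_le:
  fixes c :: "real \<Rightarrow> nat" and s \<tau> B :: real
  assumes c_meas: "c \<in> measurable borel (count_space UNIV)" and periodic: "\<And>x. c (frac x) = c x"
    and bound: "measure lborel {x\<in>{0..<1}. c x = i \<and> c (s * x + \<tau>) = i} \<le> B"
    and s: "s = 1 \<or> s = -1" and A: "A \<in> events" "\<forall>z\<in>A. angular_colour c z = i"
    and g: "\<And>z. z \<in> A \<Longrightarrow> turn \<tau> * (if s = 1 then z else cnj z) \<in> A"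
  shows "prob A \<le> B"
proof (rule prob_le_angular_measure[OF A(1)])
  show "0 \<le> B" using order_trans[OF measure_nonneg bound] .
  fix \<rho> :: real assume \<rho>: "\<rho> > 0"
  have [measurable]: "A \<in> sets borel" using A Y_borel by (simp add: sets_normalized_lebesgue)
  note [measurable] = c_meas
  have "{t\<in>{0..<1}. turn t * of_real \<rho> \<in> A} \<subseteq> {x\<in>{0..<1}. c x = i \<and> c (s * x + \<tau>) = i}"
  proof safe
    fix t assume t: "turn t * of_real \<rho> \<in> A"
    then show "c t = i" using A(2) angular_colour_turn[of c, OF periodic \<rho>] by metis
    have "turn (s * t + \<tau>) = turn \<tau> * (if s = 1 then turn t else cnj (turn t))"
      using s turn_add[of \<tau> "s * t"] by (auto simp: cis_cnj add.commute)
    then have "turn (s * t + \<tau>) * of_real \<rho> =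
        turn \<tau> * (if s = 1 then turn t * of_real \<rho> else cnj (turn t * of_real \<rho>))"
      by simp
    then have "turn (s * t + \<tau>) * of_real \<rho> \<in> A" using g[OF t] by (simp only:)
    then show "c (s * t + \<tau>) = i" using A(2) angular_colour_turn[of c, OF periodic \<rho>] by metis
  qed
  then have "measure lborel {t\<in>{0..<1}. turn t * of_real \<rho> \<in> A} \<le>
      measure lborel {x\<in>{0..<1}. c x = i \<and> c (s * x + \<tau>) = i}"
    by (intro measure_mono_fmeasurable fmeasurable_unit_subset) auto
  then show "measure lborel {t\<in>{0..<1}. turn t * of_real \<rho> \<in> A} \<le> B" using bound by simp
qed

lemma ms_set_le:
  assumes r: "r \<ge> 1"
  shows "ms_set Y r \<le> 1 / (real r)\<^sup>2"
proof (rule field_le_epsilon)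
  fix \<delta> :: real assume "\<delta> > 0"
  obtain c :: "real \<Rightarrow> nat" where c_meas: "c \<in> measurable borel (count_space UNIV)"
    and c_less: "\<And>x. c x < r"
    and periodic: "\<And>x. c (frac x) = c x"
    and bound: "\<And>s t i. far_circle_isometry s t \<Longrightarrow>
      measure lborel {x\<in>{0..<1}. c x = i \<and> c (s * x + t) = i} \<le> 1 / r\<^sup>2 + \<delta>"
    using lacunary_colouring[OF r \<open>\<delta> > 0\<close>] by blast
  have "(\<lambda>z. Arg2pi z / (2 * pi)) \<in> borel_measurable borel" using borel_measurable_Arg2pi by simp
  from measurable_compose[OF this c_meas] have
      "angular_colour c \<in> measurable borel (count_space {..<r})"
    using c_less by (auto simp: measurable_def angular_colour_def[abs_def])
  then have col: "angular_colour c \<in> measurable (normalized_lebesgue Y) (count_space {..<r})"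
    by (rule measurable_normalized_lebesgue_borel)
  show "ms_set Y r \<le> 1 / (real r)\<^sup>2 + \<delta>"
    unfolding ms_set_def
  proof (rule ms_leI[OF _ col])
    fix A i f assume A: "A \<in> events" "\<forall>z\<in>A. angular_colour c z = i"
      and f: "f \<in> carrier (Iso Y)" "f \<noteq> \<one>\<^bsub>Iso Y\<^esub>" "f ` A = A"
    have f_mem: "f z \<in> A" if "z \<in> A" for z using f(3) that by blast
    from f(1) show "prob A \<le> 1 / (real r)\<^sup>2 + \<delta>"
    proof (cases rule: Iso_cases)
      case (rotation u)
      then have "norm u = 1" "u \<noteq> 1" using f(2) by (auto simp: rotations_iff)
      then obtain k :: nat and \<tau> where k: "u ^ k = turn \<tau>" "frac \<tau> \<in> {1/4..3/4}"
        by (rule rotation_power_far_turn)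
      have rotate: "turn \<tau> * z \<in> A" if "z \<in> A" for z
        unfolding k(1)[symmetric]
        by (induction k) (use that f_mem rotation(2) in \<open>auto simp: mult.assoc\<close>)
      have "far_circle_isometry 1 \<tau>" using k(2) by (simp add: far_circle_isometry_def)
      then have "prob A \<le> 1 / r\<^sup>2 + \<delta>"
        by (rule prob_angular_monochromatic_le[OF c_meas periodic bound _ A])
          (use rotate in simp_all)
      then show ?thesis by simp
    next
      case (reflection w)
      obtain \<tau> where \<tau>: "w = turn \<tau>" using turn_surj norm_reflection[OF reflection(1)] by blast
      have "far_circle_isometry (-1) \<tau>" by (simp add: far_circle_isometry_def)
      then have "prob A \<le> 1 / r\<^sup>2 + \<delta>"
        by (rule prob_angular_monochromatic_le[OF c_meas periodic bound _ A])
          (use f_mem reflection(2) \<tau> in simp_all)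
      then show ?thesis by simp
    qed
  qed (use \<open>\<delta> > 0\<close> in simp)
qed

end

theorem theorem7p3:
  fixes X :: "(real ^ 2) set" and r :: nat
  assumes "compact X" and "measure lborel X > 0" and "r \<ge> 2"
  shows "(infinite (carrier (Iso X)) \<longrightarrow> ms_set X r = 1 / (real r)\<^sup>2) \<and>
         (\<forall>n\<ge>2. Iso X \<cong> dihedral_group n \<longrightarrow> ms_set X r = ms_group_interval (dihedral_group n) r) \<and>
         (finite (carrier (Iso X)) \<and> \<not> (\<exists>n\<ge>2. Iso X \<cong> dihedral_group n) \<longrightarrow> ms_set X r = 0)"
proof (intro conjI allI impI)
  have r: "r \<ge> 1" using assms(3) by simp
  obtain Y where "centred_plane_set Y" and iso: "Iso X \<cong> Iso Y" and ms_Y: "ms_set X r = ms_set Y r"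
    using centred_plane_copy[OF assms(1,2)] r by metis
  then interpret centred_plane_set Y by simp
  note finite_iff = finite_carrier_iso[OF iso]
  show "ms_set X r = 1 / (real r)\<^sup>2" if "infinite (carrier (Iso X))"
  proof -
    interpret circular_plane_set Y
      by unfold_locales (use that infinite_Iso_rotations in \<open>simp add: finite_iff\<close>)
    show ?thesis unfolding ms_Y using ms_set_le[OF r] ms_set_ge[OF r] by (rule antisym)
  qed
  show "ms_set X r = ms_group_interval (dihedral_group n) r"
    if "n \<ge> 2" "Iso X \<cong> dihedral_group n" for n
  proof -
    have fin: "finite (carrier (Iso X))"
      using finite_carrier_iso[OF that(2)] by (simp add: dihedral_group_def)
    have "ms_set X r = ms_group_interval (Iso X) r"
      using assms(1,2) fin r by (rule ms_set_eq_ms_group_interval)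
    also have "\<dots> = ms_group_interval (dihedral_group n) r"
      using that fin r by (intro ms_group_interval_cong_iso group_Iso group_dihedral_group) simp_all
    finally show ?thesis .
  qed
  show "ms_set X r = 0" if "finite (carrier (Iso X)) \<and> \<not> (\<exists>n\<ge>2. Iso X \<cong> dihedral_group n)"
    unfolding ms_Y using that iso_trans[OF iso] assms(3)
    by (intro ms_set_eq_0_not_dihedral) (auto simp: finite_iff)
qed

end
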